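(* Let $p>1$ and let $\mathcal F^p_{\mathbb Z}(B^3)$ be the class of measurable real-valued $2$-forms $F$ on the open unit ball $B^3\subset\mathbb R^3$ such that $\int_{B^3}|F|^p\,dx<\infty$ and, for every $x\in B^3$ and almost every $0<r<\operatorname{dist}(x,\partial B^3)$, $\int_{\partial B_r(x)} i^*_{\partial B_r(x)}F\in\mathbb Z$ (with $i_{\partial B_r(x)}$ the inclusion of the sphere). If $F_n\in\mathcal F^p_{\mathbb Z}(B^3)$ and $\|F_n\|_{L^p}\le C<\infty$ for all $n$, then there is a subsequence $F_{n'}$ converging weakly in $L^p$ to a $2$-form belonging to $\mathcal F^p_{\mathbb Z}(B^3)$. *)

theory Defs
  imports "HOL-Analysis.Analysis"
begin

text \<open>A real 2-form on an open subset of R^3 is represented by its coefficient field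
  F = (F1, F2, F3), meaning F1 dx2/\dx3 + F2 dx3/\dx1 + F3 dx1/\dx2.  Its pointwise
  norm |F| is the Euclidean norm of the coefficient vector.\<close>

type_synonym form2 = "real^3 \<Rightarrow> real^3"

definition B3 :: "(real^3) set" where
  "B3 = ball 0 1"

definition sph :: "real \<Rightarrow> real \<Rightarrow> real^3" where
  "sph t s = vector [sin t * cos s, sin t * sin s, cos t]"

definition sph_dom :: "(real \<times> real) set" where
  "sph_dom = {0<..<pi} \<times> {0<..<2*pi}"

text \<open>Integrand of the pulled-back 2-form: for Phi(t,s) = x + r sph t s one has
  Phi^* F = (F(Phi) . (d_t Phi \<times> d_s Phi)) dt/\ds = (F(Phi) . sph t s) r^2 sin t dt/\ds.\<close>
definition sphere_pullback :: "form2 \<Rightarrow> real^3 \<Rightarrow> real \<Rightarrow> real \<times> real \<Rightarrow> real" where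
  "sphere_pullback F x r = (\<lambda>(t, s). (F (x + r *\<^sub>R sph t s) \<bullet> sph t s) * r^2 * sin t)"

definition sphere_flux :: "form2 \<Rightarrow> real^3 \<Rightarrow> real \<Rightarrow> real" where
  "sphere_flux F x r = integral\<^sup>L (lebesgue_on sph_dom) (sphere_pullback F x r)"

definition Lp_norm :: "real \<Rightarrow> form2 \<Rightarrow> real" where
  "Lp_norm p F = (integral\<^sup>L (lebesgue_on B3) (\<lambda>x. norm (F x) powr p)) powr (1 / p)"

definition FpZ :: "real \<Rightarrow> form2 set" where
  "FpZ p = {F. F \<in> borel_measurable (lebesgue_on B3)
     \<and> integrable (lebesgue_on B3) (\<lambda>x. norm (F x) powr p)
     \<and> (\<forall>x\<in>B3. AE r in lebesgue_on {0<..<infdist x (- B3)}.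
            integrable (lebesgue_on sph_dom) (sphere_pullback F x r)
            \<and> sphere_flux F x r \<in> \<int>)}"

definition weak_Lp_conv :: "real \<Rightarrow> (nat \<Rightarrow> form2) \<Rightarrow> form2 \<Rightarrow> bool" where
  "weak_Lp_conv p Fs F \<longleftrightarrow>
     (\<forall>G. G \<in> borel_measurable (lebesgue_on B3)
        \<and> integrable (lebesgue_on B3) (\<lambda>x. norm (G x) powr (p / (p - 1)))
        \<longrightarrow> (\<lambda>n. integral\<^sup>L (lebesgue_on B3) (\<lambda>x. Fs n x \<bullet> G x))
              \<longlonglongrightarrow> integral\<^sup>L (lebesgue_on B3) (\<lambda>x. F x \<bullet> G x))"

end

(*
  For a sequence in the class, the flux functions f_n(r) of the spheres around a fixed centre x converge weakly to the
  flux function f of the weak limit; the point is to exclude oscillation, i.e. to show that f_n -> f in L^1.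
  An integer flux satisfies |flux| <= |flux|^p up to constants, so the integral of F against a radial field supported
  in B_h(y) is at most C h^(2p-2) times the integral of |F|^p over B_h(y).
  For a gradient W = grad T of a radial Lipschitz function T, mollify twice at scale h = 2^-k: the difference between
  the scales k and k+1 is a sum of two convolutions of (the difference of two mollifications of T) = O(h) with gradients
  of mollifiers, i.e. with radial kernels of size h^-4 supported in B_h.  Integrating the previous bound over the centres
  of the balls bounds the pairing of F_n with this difference by C h^(2p-2) ||F_n||_p^p, which is summable over the
  scales because p > 1.  So F_n can be replaced by its mollification, uniformly in n and in T, and mollifications of a
  weakly convergent sequence converge strongly in L^1.  Hence f_n -> f in L^1, and f is integer valued.
*)
theory Submission
  imports Defs "HOL-Complex_Analysis.Great_Picard"
begin

section \<open>Spherical coordinates\<close>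

text \<open>Weak convergence alone does not preserve integrality: functions with values 0 and 1 can
  oscillate and converge weakly to 1/2. The integer bound is superlinear because a sphere of radius
  r has area of order r^2: truncating |F| at a height of order r^-2 costs only half a unit of flux,
  so any nonzero flux must be paid for by p-energy above that height. Mollifying twice is forced by
  the count of powers. The gradient kernel, the bound over one ball and the volume h^3 of the set of
  centres together give h^(2p-3), which need not be small. Writing a and b for convolution with the
  two mollifiers, a^2 - b^2 = (a - b)(a + b): one factor makes a difference of potentials, of size
  h, and the other carries the gradient. After a single mollification T itself would stand in place
  of the difference, and the factor h would be missing. The limit is not known to have integer
  fluxes, so the error estimate is never applied to it; it inherits the bound from the sequence by
  weak convergence. Test functions live on compact intervals of radii, so that every ball of radius
  h that occurs stays inside the unit ball.\<close>

definition vec3 :: "real \<times> real \<times> real \<Rightarrow> real^3" where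
  "vec3 = (\<lambda>(a, b, c). vector [a, b, c])"

lemma inner_vec3: "(x::real^3) \<bullet> y = x$1 * y$1 + x$2 * y$2 + x$3 * y$3"
  by (simp add: inner_vec_def sum_3)

lemma continuous_on_vec3: "continuous_on UNIV vec3"
proof -
  have "vec3 = (\<lambda>p. \<chi> i. if i = 1 then fst p else if i = 2 then fst (snd p) else snd (snd p))"
    by (auto simp: vec3_def vec_eq_iff forall_3)
  moreover have "continuous_on UNIV (\<lambda>p::real \<times> real \<times> real. (\<chi> i. if i = 1 then fst p else if i = 2 then fst (snd p) else snd (snd p)) :: real^3)"
  proof (rule continuous_on_vec_lambda)
    fix i :: 3
    consider "i = 1" | "i = 2" | "i = 3" using exhaust_3 by blast
    then show "continuous_on UNIV (\<lambda>p::real \<times> real \<times> real. if i = 1 then fst p else if i = 2 then fst (snd p) else snd (snd p))"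
      by cases (auto intro!: continuous_intros)
  qed
  ultimately show ?thesis by (simp only:)
qed

lemma borel_measurable_vec3 [measurable]: "vec3 \<in> borel_measurable borel"
  using continuous_on_vec3 by (rule borel_measurable_continuous_onI)

lemma prod_Basis_vec3: "(\<Prod>b\<in>(Basis::(real^3) set). f b) = f (axis 1 1) * f (axis 2 1) * f (axis 3 1)"
proof -
  have B: "(Basis :: (real^3) set) = {axis 1 1, axis 2 1, axis 3 1}"
    by (auto simp: Basis_vec_def UNIV_3)
  show ?thesis
    unfolding B by (simp add: axis_eq_axis mult.assoc)
qed

text \<open>Fubini is used on nested pairs and the Jacobian formula on \<open>real^3\<close>; this
  equality carries Lebesgue measure from one to the other. It suffices to compare the two measures
  on boxes.\<close>

lemma lborel_vec3: "(lborel :: (real^3) measure) = distr lborel borel vec3"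
proof (rule lborel_eqI)
  fix l u :: "real^3"
  assume lu: "\<And>b. b \<in> Basis \<Longrightarrow> l \<bullet> b \<le> u \<bullet> b"
  have le: "l $ i \<le> u $ i" for i
    using lu[of "axis i 1"] by (simp add: inner_axis axis_in_Basis_iff)
  have "vec3 -` box l u = box (l$1, l$2, l$3) (u$1, u$2, u$3)"
    by (auto simp: vec3_def box_def mem_box_cart Basis_prod_def forall_3 axis_in_Basis_iff inner_axis Basis_vec_def)
  then have "emeasure (distr lborel borel vec3) (box l u) = emeasure lborel (box (l$1, l$2, l$3) (u$1, u$2, u$3))"
    by (simp add: emeasure_distr)
  also have "\<dots> = ennreal (\<Prod>b\<in>Basis. ((u$1, u$2, u$3) - (l$1, l$2, l$3)) \<bullet> b)"
    using le by (intro emeasure_lborel_box) (auto simp: Basis_prod_def)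
  also have "(\<Prod>b\<in>Basis. ((u$1, u$2, u$3) - (l$1, l$2, l$3)) \<bullet> b) = (u$1-l$1) * (u$2-l$2) * (u$3-l$3)"
    by (simp add: Basis_prod_def prod.union_disjoint image_Un  
        prod.reindex inj_on_def)
  also have "\<dots> = (\<Prod>b\<in>Basis. (u - l) \<bullet> b)"
    by (simp add: prod_Basis_vec3 inner_axis)
  finally show "emeasure (distr lborel borel vec3) (box l u) = ennreal (\<Prod>b\<in>Basis. (u - l) \<bullet> b)" .
qed simp

lemma nn_integral_vec3:
  assumes [measurable]: "g \<in> borel_measurable borel"
  shows "(\<integral>\<^sup>+v. g v \<partial>lborel) = (\<integral>\<^sup>+p. g (vec3 p) \<partial>lborel)"
  by (subst lborel_vec3) (simp add: nn_integral_distr)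

lemma sph_nth [simp]: "sph t s $ 1 = sin t * cos s" "sph t s $ 2 = sin t * sin s" "sph t s $ 3 = cos t"
  by (simp_all add: sph_def)

lemma norm_sph [simp]: "norm (sph t s) = 1"
proof -
  have "sph t s \<bullet> sph t s = (sin t)\<^sup>2 * ((cos s)\<^sup>2 + (sin s)\<^sup>2) + (cos t)\<^sup>2"
    by (simp only: inner_vec3 sph_nth) (simp only: power2_eq_square algebra_simps)
  then show ?thesis
    by (simp add: norm_eq_sqrt_inner)
qed

definition polar3 :: "real^3 \<Rightarrow> real^3" where
  "polar3 v = v$1 *\<^sub>R sph (v$2) (v$3)"

definition polar3_deriv :: "real^3 \<Rightarrow> real^3^3" where
  "polar3_deriv v = vector
     [vector [sin (v$2) * cos (v$3), v$1 * (cos (v$2) * cos (v$3)), - (v$1 * (sin (v$2) * sin (v$3)))],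
      vector [sin (v$2) * sin (v$3), v$1 * (cos (v$2) * sin (v$3)), v$1 * (sin (v$2) * cos (v$3))],
      vector [cos (v$2), - (v$1 * sin (v$2)), 0]]"

text \<open>The open ranges leave out the poles and the seam at longitude 0. This makes
  \<open>polar3\<close> injective, and the points that are lost form a null set.\<close>

definition polar3_dom :: "(real^3) set" where
  "polar3_dom = {v. 0 < v$1 \<and> 0 < v$2 \<and> v$2 < pi \<and> 0 < v$3 \<and> v$3 < 2 * pi}"

lemma has_derivative_polar3:
  "(polar3 has_derivative (\<lambda>h. polar3_deriv v *v h)) (at v within S)"
proof -
  have nth: "((\<lambda>v::real^3. v $ i) has_derivative (\<lambda>h. h $ i)) (at v within S)" for i
    by (rule bounded_linear_imp_has_derivative) (rule bounded_linear_vec_nth)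
  have 1: "((\<lambda>v. polar3 v $ i) has_derivative (\<lambda>h. (polar3_deriv v *v h) $ i)) (at v within S)" for i
  proof -
    consider "i = 1" | "i = 2" | "i = 3" using exhaust_3 by blast
    then show ?thesis
      by cases (auto simp: polar3_def polar3_deriv_def matrix_vector_mult_def sum_3 algebra_simps
          intro!: derivative_eq_intros nth)
  qed
  show ?thesis
    by (rule iffD2[OF has_derivative_componentwise_within])
      (auto simp: Basis_vec_def inner_axis 1)
qed

lemma det_polar3_deriv: "det (polar3_deriv v) = (v$1)\<^sup>2 * sin (v$2)"
proof -
  \<comment> \<open>The factors that equal 1 for sines and cosines are kept on the left, so that the
    identity is purely polynomial; the Pythagorean relation enters only when it is
    instantiated.\<close>
  have "(s\<^sup>2 + c\<^sup>2) * (a\<^sup>2 + b\<^sup>2) * (r\<^sup>2 * a) =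
      det (vector [vector [a * c, r * (b * c), - (r * (a * s))],
        vector [a * s, r * (b * s), r * (a * c)], vector [b, - (r * a), 0]] :: real^3^3)" for a b c s r :: real
    by (simp only: det_3 vector_3) (simp add: power2_eq_square algebra_simps)
  from this[of "sin (v$3)" "cos (v$3)" "sin (v$2)" "cos (v$2)" "v$1"] show ?thesis
    by (simp add: polar3_deriv_def)
qed

lemma norm_polar3: "0 \<le> v$1 \<Longrightarrow> norm (polar3 v) = v$1"
  by (simp add: polar3_def)

lemma sin_cos_inj_2pi:
  assumes "0 \<le> s" "s < 2 * pi" "0 \<le> s'" "s' < 2 * pi" "sin s = sin s'" "cos s = cos s'"
  shows "s = s'"
proof -
  obtain n :: int where "s = s' + 2 * n * pi"
    using assms sin_cos_eq_iff[of s s'] by auto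
  then have "2 * n * pi < 2 * pi" "- (2 * pi) < 2 * n * pi"
    using assms by linarith+
  then have "n * (2 * pi) < 1 * (2 * pi)" "(- 1) * (2 * pi) < n * (2 * pi)"
    by (auto simp: algebra_simps)
  then have "real_of_int n < 1" "- 1 < real_of_int n"
    using pi_gt_zero mult_less_cancel_right_pos[of "2*pi" n 1] mult_less_cancel_right_pos[of "2*pi" "-1" n] by linarith+
  then have "n = 0" by linarith
  with \<open>s = _\<close> show ?thesis by simp
qed

lemma inj_on_polar3: "inj_on polar3 polar3_dom"
proof (rule inj_onI)
  fix v w assume v: "v \<in> polar3_dom" and w: "w \<in> polar3_dom" and eq: "polar3 v = polar3 w"
  have 1: "v$1 = w$1"
    using norm_polar3[of v] norm_polar3[of w] v w eq by (simp add: polar3_dom_def)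
  then have sph: "sph (v$2) (v$3) = sph (w$2) (w$3)"
    using eq v by (auto simp: polar3_def polar3_dom_def)
  then have "cos (v$2) = cos (w$2)"
    by (metis sph_nth(3))
  then have 2: "v$2 = w$2"
    using v w by (intro cos_inj_pi[of "v$2" "w$2"]) (auto simp: polar3_dom_def)
  have "sin (v$2) > 0"
    using v by (auto simp: polar3_dom_def intro: sin_gt_zero)
  then have "cos (v$3) = cos (w$3)" "sin (v$3) = sin (w$3)"
    using arg_cong[OF sph, of "\<lambda>v. v$1"] arg_cong[OF sph, of "\<lambda>v. v$2"] 2 by auto
  then have "v$3 = w$3"
    using v w by (intro sin_cos_inj_2pi[of "v$3" "w$3"]) (auto simp: polar3_dom_def)
  with 1 2 show "v = w" by (simp add: vec_eq_iff forall_3)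
qed

text \<open>A point with nonzero second coordinate is off the polar axis and off the seam, and its
  polar coordinates can be written down. All missed points thus lie in one coordinate plane.\<close>

lemma negligible_compl_polar3_image: "negligible (UNIV - polar3 ` polar3_dom)"
proof (rule negligible_subset)
  show "negligible {z::real^3. axis 2 1 \<bullet> z = 0}"
    by (rule negligible_hyperplane) (simp add: axis_eq_0_iff)
  show "UNIV - polar3 ` polar3_dom \<subseteq> {z. axis 2 1 \<bullet> z = 0}"
  proof (rule ccontr)
    assume "\<not> ?thesis"
    then obtain z where z: "z \<notin> polar3 ` polar3_dom" "z $ 2 \<noteq> 0"
      by (auto simp: inner_axis')
    define r where "r = norm z"
    define q where "q = sqrt ((z$1)\<^sup>2 + (z$2)\<^sup>2)"
    have r0: "r > 0" using z by (auto simp: r_def)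
    have q0: "q > 0" using z by (simp add: q_def sum_power2_gt_zero_iff)
    have q2: "q\<^sup>2 = (z$1)\<^sup>2 + (z$2)\<^sup>2" by (simp add: q_def)
    have r2: "r\<^sup>2 = q\<^sup>2 + (z$3)\<^sup>2"
    proof -
      have "r\<^sup>2 = z \<bullet> z" by (simp add: r_def power2_norm_eq_inner)
      then show ?thesis unfolding q2 by (simp add: inner_vec3 power2_eq_square)
    qed
    have "(z$3 / r)\<^sup>2 + (q / r)\<^sup>2 = 1"
      using r0 r2 by (auto simp add: power_divide simp flip: add_divide_distrib)
    moreover have "0 \<le> q / r" using q0 r0 by simp
    ultimately obtain t where t: "0 \<le> t" "t \<le> pi" "z$3 / r = cos t" "q / r = sin t"
      using sincos_total_pi by blast
    have "(z$1 / q)\<^sup>2 + (z$2 / q)\<^sup>2 = 1"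
      using q0 q2 by (auto simp add: power_divide simp flip: add_divide_distrib)
    then obtain s where s: "0 \<le> s" "s < 2 * pi" "z$1 / q = cos s" "z$2 / q = sin s"
      using sincos_total_2pi by metis
    have "s \<noteq> 0" using s z q0 by auto
    moreover have "t \<noteq> 0" "t \<noteq> pi" using t q0 r0 by auto
    ultimately have "vector [r, t, s] \<in> polar3_dom"
      using s t r0 by (auto simp: polar3_dom_def)
    moreover have "polar3 (vector [r, t, s]) = z"
    proof -
      have "z$3 = r * cos t" "q = r * sin t" "z$1 = q * cos s" "z$2 = q * sin s"
        using s t q0 r0 by (simp_all add: field_simps)
      then show ?thesis
        by (auto simp: polar3_def vec_eq_iff forall_3 mult.assoc)
    qed
    ultimately show False using z by blast
  qed
qed

lemma nn_integral_polar3_box: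
  fixes l u :: "real^3"
  shows "(\<integral>\<^sup>+v. ennreal (((v$1)\<^sup>2 * sin (v$2)) * indicat_real (box l u) (polar3 v)) * indicator polar3_dom v \<partial>lborel)
    = emeasure lborel (box l u)"
proof -
  \<comment> \<open>The change-of-variables theorem speaks of vector-valued integrands, so the
    indicator is wrapped into \<open>real^1\<close> and unwrapped at the end by taking component
    1.\<close>
  define f :: "real^3 \<Rightarrow> real^1" where "f = (\<lambda>z. vec (indicat_real (box l u) z))"
  define b where "b = measure lborel (box l u)"
  have neg: "negligible (UNIV - polar3 ` polar3_dom)"
    by (rule negligible_compl_polar3_image)
  have dom: "polar3_dom \<in> sets borel"
    unfolding polar3_dom_def by measurable
  have "((\<lambda>x. 1::real) has_integral b) (box l u)"
    using has_integral_measure_lborel[of "box l u"] emeasure_bounded_finite[OF bounded_box, of l u] by (simp add: b_def)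
  then have "((\<lambda>x. if x \<in> box l u then 1 else 0::real) has_integral b) UNIV"
    by (simp only: has_integral_restrict_UNIV)
  then have 1: "((\<lambda>z. indicat_real (box l u) z) has_integral b) UNIV"
    by (rule has_integral_eq[rotated]) auto
  then have 2: "((\<lambda>z. indicat_real (box l u) z) has_integral b) (polar3 ` polar3_dom)"
    by (subst has_integral_spike_set_eq[where T=UNIV]) (auto intro: negligible_subset[OF neg])
  then have 3: "(\<lambda>z. indicat_real (box l u) z) absolutely_integrable_on (polar3 ` polar3_dom)"
    by (intro nonnegative_absolutely_integrable_1) (auto simp: has_integral_integrable)
  have lin: "linear (vec :: real \<Rightarrow> real^1)"
    by (rule linearI) (auto simp: vec_eq_iff)
  have "f absolutely_integrable_on (polar3 ` polar3_dom)"
    using absolutely_integrable_linear[OF 3, of "vec :: real \<Rightarrow> real^1"] lin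
    by (simp add: f_def o_def linear_conv_bounded_linear)
  moreover have "(f has_integral vec b) (polar3 ` polar3_dom)"
    using has_integral_linear[OF 2, of "vec :: real \<Rightarrow> real^1"] lin
    by (simp add: f_def o_def linear_conv_bounded_linear)
  then have "integral (polar3 ` polar3_dom) f = vec b" by (rule integral_unique)
  ultimately have rhs: "f absolutely_integrable_on (polar3 ` polar3_dom) \<and> integral (polar3 ` polar3_dom) f = vec b"
    by (rule conjI)
  have "polar3_dom \<in> sets lebesgue"
    using dom by simp
  then have lhs: "(\<lambda>x. \<bar>det (matrix ((*v) (polar3_deriv x)))\<bar> *\<^sub>R f (polar3 x)) absolutely_integrable_on polar3_dom \<and>
    integral polar3_dom (\<lambda>x. \<bar>det (matrix ((*v) (polar3_deriv x)))\<bar> *\<^sub>R f (polar3 x)) = vec b"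
    by (rule iffD2[OF has_absolute_integral_change_of_variables[OF _ has_derivative_polar3 inj_on_polar3] rhs])
  have "((\<lambda>x. \<bar>det (matrix ((*v) (polar3_deriv x)))\<bar> *\<^sub>R f (polar3 x)) has_integral vec b) polar3_dom"
    using integrable_integral[OF set_lebesgue_integral_eq_integral(1)[OF lhs[THEN conjunct1]]]
    unfolding lhs[THEN conjunct2] .
  from has_integral_linear[OF this bounded_linear_vec_nth[of 1]]
  have abs: "((\<lambda>v. \<bar>(v$1)\<^sup>2 * sin (v$2)\<bar> * indicat_real (box l u) (polar3 v)) has_integral b) polar3_dom"
    by (simp add: det_polar3_deriv f_def o_def)
  have sin0: "0 \<le> sin (v$2)" if "v \<in> polar3_dom" for v
    using that by (intro sin_ge_zero) (auto simp: polar3_dom_def)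
  have "((\<lambda>v. ((v$1)\<^sup>2 * sin (v$2)) * indicat_real (box l u) (polar3 v)) has_integral b) polar3_dom"
    by (rule has_integral_eq[OF _ abs]) (simp add: abs_mult sin0)
  then have "(\<integral>\<^sup>+v. ennreal (((v$1)\<^sup>2 * sin (v$2)) * indicat_real (box l u) (polar3 v)) * indicator polar3_dom v \<partial>lborel) = ennreal b"
    by (intro nn_integral_has_integral_lebesgue') (simp_all add: sin0)
  also have "ennreal b = emeasure lborel (box l u)"
    using emeasure_bounded_finite[OF bounded_box, of l u] by (simp add: b_def emeasure_eq_ennreal_measure)
  finally show ?thesis .
qed

lemma sph_dom_borel [measurable]: "sph_dom \<in> sets borel"
  unfolding sph_dom_def by (auto intro!: borel_open open_Times)

lemma sph_fst_snd_vec3: "r *\<^sub>R sph t s = polar3 (vec3 (r, t, s))"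
  by (simp add: polar3_def vec3_def)

lemma borel_measurable_polar3 [measurable]: "polar3 \<in> borel_measurable borel"
  using has_derivative_polar3 has_derivative_continuous_on[of UNIV polar3 "\<lambda>v. (*v) (polar3_deriv v)"] 
  by (intro borel_measurable_continuous_onI) blast

lemma borel_measurable_sph [measurable]: "(\<lambda>w. sph (fst w) (snd w)) \<in> borel_measurable borel"
proof -
  have "(\<lambda>w. sph (fst w) (snd w)) = (\<lambda>w. polar3 (vec3 (1, w)))"
    by (auto simp: sph_fst_snd_vec3[symmetric])
  then show ?thesis by simp
qed

lemma sin_nonneg_sph_dom: "w \<in> sph_dom \<Longrightarrow> 0 \<le> sin (fst w)"
  by (auto simp: sph_dom_def intro!: sin_ge_zero)

lemma polar_map_borel:
  "(\<lambda>(r, w). y + r *\<^sub>R sph (fst w) (snd w)) \<in> borel_measurable borel"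
proof -
  have "(\<lambda>(r, w). y + r *\<^sub>R sph (fst w) (snd w)) = (\<lambda>p. y + polar3 (vec3 p))"
    by (auto simp: sph_fst_snd_vec3)
  then show ?thesis by simp
qed

lemma polar_weight_borel:
  "(\<lambda>(r, w). ennreal (r\<^sup>2 * sin (fst w)) * indicator ({0<..} \<times> sph_dom) (r, w)) \<in> borel_measurable borel"
proof -
  have S: "{0::real<..} \<times> sph_dom \<in> sets borel"
    by (intro borel_Times) auto
  have c: "(\<lambda>x::real \<times> real \<times> real. ennreal ((fst x)\<^sup>2 * sin (fst (snd x)))) \<in> borel_measurable borel"
    by (rule measurable_compose[OF _ measurable_ennreal])
      (intro borel_measurable_continuous_onI continuous_intros)
  have "(\<lambda>x::real \<times> real \<times> real. ennreal ((fst x)\<^sup>2 * sin (fst (snd x))) * indicator ({0<..} \<times> sph_dom) x) \<in> borel_measurable borel"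
    by (rule borel_measurable_times_ennreal[OF c borel_measurable_indicator[OF S]])
  then show ?thesis
    by (simp add: split_beta')
qed

lemma polar_integrand_borel:
  fixes g :: "real^3 \<Rightarrow> ennreal"
  assumes g: "g \<in> borel_measurable borel"
  shows "(\<lambda>(r, w). ennreal (r\<^sup>2 * sin (fst w)) * g (y + r *\<^sub>R sph (fst w) (snd w)) * indicator sph_dom w)
    \<in> borel_measurable (lborel \<Otimes>\<^sub>M lborel)"
proof -
  have a: "(\<lambda>x::real \<times> real \<times> real. ennreal ((fst x)\<^sup>2 * sin (fst (snd x)))) \<in> borel_measurable borel"
    by (rule measurable_compose[OF _ measurable_ennreal])
      (intro borel_measurable_continuous_onI continuous_intros)
  have b: "(\<lambda>p. g ((\<lambda>(r, w). y + r *\<^sub>R sph (fst w) (snd w)) p)) \<in> borel_measurable borel"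
    by (rule measurable_compose[OF polar_map_borel g])
  have "(\<lambda>x::real \<times> real \<times> real. snd x) \<in> borel_measurable borel"
    by (intro borel_measurable_continuous_onI continuous_intros)
  then have d: "(\<lambda>x::real \<times> real \<times> real. indicator sph_dom (snd x) :: ennreal) \<in> borel_measurable borel"
    by (rule measurable_compose) simp
  show ?thesis
    unfolding lborel_prod measurable_lborel2
    using borel_measurable_times_ennreal[OF borel_measurable_times_ennreal[OF a b] d]
    by (simp add: split_beta')
qed

text \<open>Polar coordinates are stated as an equality of measures, because the formulas for
  nonnegative functions and for Bochner integrals then both follow from the rules for
  \<open>distr\<close> and \<open>density\<close>. The centre y only translates the test
  box.\<close>

lemma lborel_polar:
  "(lborel :: (real^3) measure) = distr (density lborel
     (\<lambda>(r, w). ennreal (r\<^sup>2 * sin (fst w)) * indicator ({0<..} \<times> sph_dom) (r, w)))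
     borel (\<lambda>(r, w). y + r *\<^sub>R sph (fst w) (snd w))"
proof (rule lborel_eqI)
  let ?d = "\<lambda>(r, w). ennreal (r\<^sup>2 * sin (fst w)) * indicator ({0<..} \<times> sph_dom) (r, w)"
  fix l u :: "real^3"
  assume lu: "\<And>b. b \<in> Basis \<Longrightarrow> l \<bullet> b \<le> u \<bullet> b"
  note d = polar_weight_borel
  have m: "(\<lambda>(r, w). y + r *\<^sub>R sph (fst w) (snd w)) = (\<lambda>p. y + polar3 (vec3 p))"
    by (auto simp: sph_fst_snd_vec3)
  have "emeasure (distr (density lborel ?d) borel (\<lambda>(r, w). y + r *\<^sub>R sph (fst w) (snd w))) (box l u)
     = emeasure (density lborel ?d) ((\<lambda>p. y + polar3 (vec3 p)) -` box l u)"
    unfolding m by (subst emeasure_distr) auto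
  also have "\<dots> = (\<integral>\<^sup>+p. ?d p * indicator ((\<lambda>p. y + polar3 (vec3 p)) -` box l u) p \<partial>lborel)"
    using d by (subst emeasure_density) (auto intro!: measurable_sets_borel[of _ borel])
  also have "\<dots> = (\<integral>\<^sup>+p. ?d p * indicator (box (l - y) (u - y)) (polar3 (vec3 p)) \<partial>lborel)"
    by (intro nn_integral_cong) (auto simp: mem_box algebra_simps split: split_indicator)
  also have "\<dots> = (\<integral>\<^sup>+p. ennreal (((vec3 p$1)\<^sup>2 * sin (vec3 p$2)) * indicat_real (box (l - y) (u - y)) (polar3 (vec3 p))) * indicator polar3_dom (vec3 p) \<partial>lborel)"
    by (intro nn_integral_cong) (auto simp: vec3_def polar3_dom_def sph_dom_def split: split_indicator)
  also have "\<dots> = emeasure lborel (box (l - y) (u - y))"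
  proof -
    have [measurable]: "polar3_dom \<in> sets borel"
      unfolding polar3_dom_def by measurable
    show ?thesis
      unfolding nn_integral_polar3_box[symmetric] 
      by (rule nn_integral_vec3[symmetric]) measurable
  qed
  also have "\<dots> = ennreal (\<Prod>b\<in>Basis. (u - l) \<bullet> b)"
    using lu by (subst emeasure_lborel_box) (auto simp: inner_diff_left)
  finally show "emeasure (distr (density lborel ?d) borel (\<lambda>(r, w). y + r *\<^sub>R sph (fst w) (snd w))) (box l u)
     = ennreal (\<Prod>b\<in>Basis. (u - l) \<bullet> b)" .
qed simp

lemma nn_integral_polar:
  fixes g :: "real^3 \<Rightarrow> ennreal"
  assumes g [measurable]: "g \<in> borel_measurable borel"
  shows "(\<integral>\<^sup>+z. g z \<partial>lborel) = (\<integral>\<^sup>+r. (\<integral>\<^sup>+w. ennreal (r\<^sup>2 * sin (fst w)) *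
     g (y + r *\<^sub>R sph (fst w) (snd w)) * indicator sph_dom w \<partial>lborel) * indicator {0<..} r \<partial>lborel)"
proof -
  note d = polar_weight_borel and s = polar_map_borel[of y]
  let ?d = "\<lambda>(r, w). ennreal (r\<^sup>2 * sin (fst w)) * indicator ({0<..} \<times> sph_dom) (r, w)"
  let ?m = "\<lambda>(r, w). y + r *\<^sub>R sph (fst w) (snd w)"
  have gm: "(\<lambda>p. g (?m p)) \<in> borel_measurable borel"
    by (rule measurable_compose[OF s g])
  have h: "(\<lambda>p. ?d p * g (?m p)) \<in> borel_measurable (lborel \<Otimes>\<^sub>M lborel)"
    unfolding lborel_prod measurable_lborel2 by (rule borel_measurable_times_ennreal[OF d gm])
  have "(\<integral>\<^sup>+z. g z \<partial>lborel) = integral\<^sup>N (distr (density lborel ?d) borel ?m) g"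
    by (rule arg_cong[where f="\<lambda>M. integral\<^sup>N M g"]) (rule lborel_polar)
  also have "\<dots> = integral\<^sup>N (density lborel ?d) (\<lambda>p. g (?m p))"
    by (rule nn_integral_distr) (use s g in simp_all)
  also have "\<dots> = (\<integral>\<^sup>+p. ?d p * g (?m p) \<partial>lborel)"
    by (rule nn_integral_density) (use d gm in simp_all)
  also have "\<dots> = (\<integral>\<^sup>+r. \<integral>\<^sup>+w. ?d (r, w) * g (?m (r, w)) \<partial>lborel \<partial>lborel)"
    by (subst lborel.nn_integral_fst[OF h]) (simp only: lborel_prod)
  also have "\<dots> = (\<integral>\<^sup>+r. (\<integral>\<^sup>+w. ennreal (r\<^sup>2 * sin (fst w)) *
     g (y + r *\<^sub>R sph (fst w) (snd w)) * indicator sph_dom w \<partial>lborel) * indicator {0<..} r \<partial>lborel)"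
  proof (rule nn_integral_cong)
    fix r :: real
    show "(\<integral>\<^sup>+w. ?d (r, w) * g (?m (r, w)) \<partial>lborel) = (\<integral>\<^sup>+w. ennreal (r\<^sup>2 * sin (fst w)) *
       g (y + r *\<^sub>R sph (fst w) (snd w)) * indicator sph_dom w \<partial>lborel) * indicator {0<..} r"
      by (cases "0 < r") (auto simp: indicator_times intro!: nn_integral_cong split: split_indicator)
  qed
  finally show ?thesis .
qed

section \<open>Fluxes as radial integrals\<close>

text \<open>Jacobian and parameter domain are part of the integrand, so that Fubini runs over the
  whole of \<open>lborel\<close> without restricted measures.\<close>

definition polar_fun :: "(real^3 \<Rightarrow> real) \<Rightarrow> real^3 \<Rightarrow> real \<Rightarrow> real \<times> real \<Rightarrow> real" where
  "polar_fun f y r w = indicator ({0<..} \<times> sph_dom) (r, w) * (r\<^sup>2 * sin (fst w)) * f (y + r *\<^sub>R sph (fst w) (snd w))"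

lemma polar_density_borel:
  "(\<lambda>(r, w). indicator ({0<..} \<times> sph_dom) (r, w) * (r\<^sup>2 * sin (fst w)) :: real) \<in> borel_measurable borel"
proof -
  have S: "{0::real<..} \<times> sph_dom \<in> sets borel"
    by (intro borel_Times) auto
  have c: "(\<lambda>x::real \<times> real \<times> real. (fst x)\<^sup>2 * sin (fst (snd x))) \<in> borel_measurable borel"
    by (intro borel_measurable_continuous_onI continuous_intros)
  have "(\<lambda>x::real \<times> real \<times> real. indicator ({0<..} \<times> sph_dom) x * ((fst x)\<^sup>2 * sin (fst (snd x)))) \<in> borel_measurable borel"
    by (rule borel_measurable_times[OF borel_measurable_indicator[OF S] c])
  then show ?thesis
    by (simp add: split_beta')
qed

lemma
  fixes f :: "real^3 \<Rightarrow> real"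
  assumes f: "integrable lborel f" "f \<in> borel_measurable borel"
  shows AE_integrable_polar_fun: "AE r in lborel. integrable lborel (polar_fun f y r)"
    and integrable_integral_polar_fun: "integrable lborel (\<lambda>r. LBINT w. polar_fun f y r w)"
    and integral_polar_fun: "(LBINT z. f z) = (LBINT r. LBINT w. polar_fun f y r w)"
proof -
  let ?d = "\<lambda>(r, w). indicator ({0<..} \<times> sph_dom) (r, w) * (r\<^sup>2 * sin (fst w)) :: real"
  let ?m = "\<lambda>(r, w). y + r *\<^sub>R sph (fst w) (snd w)"
  have d0: "0 \<le> ?d p" for p
    using sin_nonneg_sph_dom[of "snd p"] by (auto simp: split_beta' split: split_indicator)
  have L: "lborel = distr (density lborel (\<lambda>p. ennreal (?d p))) borel ?m"
    by (subst lborel_polar[of y], intro arg_cong3[where f=distr] arg_cong2[where f=density])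
      (auto simp: fun_eq_iff split: split_indicator)
  have pf: "(\<lambda>p. ?d p * f (?m p)) = (\<lambda>(r, w). polar_fun f y r w)"
    by (auto simp: polar_fun_def)
  have fm: "(\<lambda>p. f (?m p)) \<in> borel_measurable borel"
    using measurable_compose[OF polar_map_borel f(2)] by simp
  have m1: "?m \<in> measurable (density lborel (\<lambda>p. ennreal (?d p))) borel"
    using polar_map_borel[of y] by simp
  have "integrable (distr (density lborel (\<lambda>p. ennreal (?d p))) borel ?m) f"
    by (simp only: L[symmetric] f(1))
  then have "integrable (density lborel (\<lambda>p. ennreal (?d p))) (\<lambda>p. f (?m p))"
    by (subst (asm) integrable_distr_eq[OF m1 f(2)])
  then have "integrable lborel (\<lambda>p. ?d p *\<^sub>R f (?m p))"
    by (subst (asm) integrable_density) (use fm polar_density_borel d0 in \<open>simp_all only: measurable_lborel1 measurable_lborel2 always_eventually simp_thms\<close>)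
  then have i: "integrable lborel (\<lambda>p. ?d p * f (?m p))"
    by (simp only: real_scaleR_def)
  then have I: "integrable (lborel \<Otimes>\<^sub>M lborel) (\<lambda>(r, w). polar_fun f y r w)"
    unfolding pf lborel_prod .
  have "(LBINT z. f z) = integral\<^sup>L (distr (density lborel (\<lambda>p. ennreal (?d p))) borel ?m) f"
    by (simp only: L[symmetric])
  also have "\<dots> = integral\<^sup>L (density lborel (\<lambda>p. ennreal (?d p))) (\<lambda>p. f (?m p))"
    by (rule integral_distr[OF m1 f(2)])
  also have "\<dots> = (LBINT p. ?d p *\<^sub>R f (?m p))"
    by (rule integral_density) (use fm polar_density_borel d0 in \<open>simp_all only: measurable_lborel1 measurable_lborel2 always_eventually simp_thms\<close>)
  also have "\<dots> = (LBINT p. ?d p * f (?m p))"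
    by (simp only: real_scaleR_def)
  also have "\<dots> = (LBINT r. LBINT w. polar_fun f y r w)"
    unfolding pf using lborel_pair.integral_fst'[OF I] by (simp add: lborel_prod)
  finally show "(LBINT z. f z) = (LBINT r. LBINT w. polar_fun f y r w)" .
  show "AE r in lborel. integrable lborel (polar_fun f y r)"
    using lborel_pair.AE_integrable_fst'[OF I] by simp
  show "integrable lborel (\<lambda>r. LBINT w. polar_fun f y r w)"
    using lborel_pair.integrable_fst'[OF I] by simp
qed

text \<open>For z different from 0, \<open>sgn z\<close> is the outer unit normal of the sphere
  about 0 through z. Pairing a 2-form with such a field therefore sees only its fluxes through
  concentric spheres. At the centre the value is 0, since \<open>sgn 0 = 0\<close>.\<close>

definition radial :: "(real \<Rightarrow> real) \<Rightarrow> real^3 \<Rightarrow> real^3" where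
  "radial k z = k (norm z) *\<^sub>R sgn z"

lemma radial_borel [measurable]:
  assumes [measurable]: "k \<in> borel_measurable borel"
  shows "radial k \<in> borel_measurable borel"
  unfolding radial_def[abs_def] sgn_div_norm by measurable

lemma norm_radial_le: "\<bar>k (norm z)\<bar> \<le> M \<Longrightarrow> norm (radial k z) \<le> M"
  by (auto simp: radial_def norm_sgn)

lemma sphere_pullback_borel:
  assumes [measurable]: "F \<in> borel_measurable borel"
  shows "sphere_pullback F x r \<in> borel_measurable borel"
proof -
  have [measurable]: "(\<lambda>w::real \<times> real. sin (fst w)) \<in> borel_measurable borel"
    by (intro borel_measurable_continuous_onI continuous_intros)
  have "(\<lambda>w. (F (x + r *\<^sub>R sph (fst w) (snd w)) \<bullet> sph (fst w) (snd w)) * r\<^sup>2 * sin (fst w)) \<in> borel_measurable borel"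
    by measurable
  then show ?thesis by (simp add: sphere_pullback_def[abs_def] split_beta')
qed

lemma
  fixes h :: "real \<times> real \<Rightarrow> real"
  assumes [measurable]: "h \<in> borel_measurable borel"
  shows integrable_lebesgue_on_sph_dom: "integrable (lebesgue_on sph_dom) h \<longleftrightarrow> integrable lborel (\<lambda>w. indicator sph_dom w * h w)"
    and integral_lebesgue_on_sph_dom: "integral\<^sup>L (lebesgue_on sph_dom) h = (LBINT w. indicator sph_dom w * h w)"
proof -
  have s: "sph_dom \<inter> space lebesgue \<in> sets lebesgue"
    by simp
  have m: "(\<lambda>w. indicator sph_dom w *\<^sub>R h w) \<in> borel_measurable lborel"
    by simp
  show "integrable (lebesgue_on sph_dom) h \<longleftrightarrow> integrable lborel (\<lambda>w. indicator sph_dom w * h w)"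
    using integrable_restrict_space[OF s, of h] integrable_completion[OF m] by simp
  show "integral\<^sup>L (lebesgue_on sph_dom) h = (LBINT w. indicator sph_dom w * h w)"
    using integral_restrict_space[OF s, of h] integral_completion[OF m] by simp
qed

lemma polar_fun_radial:
  assumes "0 < r"
  shows "polar_fun (\<lambda>z. F z \<bullet> radial k (z - x)) x r w = k r * (indicator sph_dom w * sphere_pullback F x r w)"
  using assms by (auto simp: polar_fun_def radial_def sgn_div_norm sphere_pullback_def split_beta' split: split_indicator)

lemma polar_fun_nonpos: "\<not> 0 < r \<Longrightarrow> polar_fun f x r w = 0"
  by (simp add: polar_fun_def)

lemma integrable_inner_bounded:
  fixes F V :: "'a::euclidean_space \<Rightarrow> 'b::euclidean_space"
  assumes F: "integrable lborel F" and V [measurable]: "V \<in> borel_measurable borel"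
    and M: "\<And>z. norm (V z) \<le> M"
  shows "integrable lborel (\<lambda>z. F z \<bullet> V z)"
proof (rule Bochner_Integration.integrable_bound)
  show "integrable lborel (\<lambda>z. M * norm (F z))"
    using F by simp
  show "(\<lambda>z. F z \<bullet> V z) \<in> borel_measurable lborel"
    using F by (intro borel_measurable_inner) auto
  have "\<bar>F z \<bullet> V z\<bar> \<le> \<bar>M * norm (F z)\<bar>" for z
  proof -
    have "\<bar>F z \<bullet> V z\<bar> \<le> norm (F z) * norm (V z)" by (rule Cauchy_Schwarz_ineq2)
    also have "\<dots> \<le> norm (F z) * M" by (intro mult_left_mono M) auto
    finally show ?thesis by (simp add: mult.commute)
  qed
  then show "AE z in lborel. norm (F z \<bullet> V z) \<le> norm (M * norm (F z))"
    by simp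
qed

text \<open>Slicing by spheres: all three facts are the polar formula for the pairing of F with
  \<open>radial k\<close>, the first two with k = 1. An integrable field thus has a flux through
  almost every sphere about x, and radial test fields act on that flux as functions of r.\<close>

lemma
  fixes F :: form2
  assumes F: "integrable lborel F" and Fm [measurable]: "F \<in> borel_measurable borel"
  shows AE_integrable_sphere_pullback: "AE r in lborel. 0 < r \<longrightarrow> integrable (lebesgue_on sph_dom) (sphere_pullback F x r)"
    and integrable_sphere_flux: "integrable lborel (\<lambda>r. indicator {0<..} r * sphere_flux F x r)"
    and integral_inner_radial: "\<And>k M. k \<in> borel_measurable borel \<Longrightarrow> (\<And>r. \<bar>k r\<bar> \<le> M) \<Longrightarrow>
      (LBINT z. F z \<bullet> radial k (z - x)) = (LBINT r. k r * (indicator {0<..} r * sphere_flux F x r))"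
proof -
  have I: "integrable lborel (\<lambda>z. F z \<bullet> radial k (z - x))" 
    if "k \<in> borel_measurable borel" "\<And>r. \<bar>k r\<bar> \<le> M" for k M
    using that by (intro integrable_inner_bounded[OF F, where M=M]) (auto intro: norm_radial_le)
  have Bm: "(\<lambda>z. F z \<bullet> radial k (z - x)) \<in> borel_measurable borel" if "k \<in> borel_measurable borel" for k
    using that by measurable
  have pf: "(LBINT w. polar_fun (\<lambda>z. F z \<bullet> radial k (z - x)) x r w) = k r * (indicator {0<..} r * sphere_flux F x r)" for r k
    by (cases "0 < r") (simp_all add: polar_fun_radial polar_fun_nonpos sphere_flux_def
          integral_lebesgue_on_sph_dom sphere_pullback_borel)
  show "AE r in lborel. 0 < r \<longrightarrow> integrable (lebesgue_on sph_dom) (sphere_pullback F x r)"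
    using AE_integrable_polar_fun[OF I[of "\<lambda>_. 1" 1] Bm[of "\<lambda>_. 1"], of x, simplified]
  proof eventually_elim
    case (elim r)
    have "polar_fun (\<lambda>z. F z \<bullet> radial (\<lambda>_. 1) (z - x)) x r = (\<lambda>w. indicator sph_dom w * sphere_pullback F x r w)" if "0 < r"
      using polar_fun_radial[OF that] by auto
    then show ?case
      using elim by (auto simp: integrable_lebesgue_on_sph_dom sphere_pullback_borel)
  qed
  show "integrable lborel (\<lambda>r. indicator {0<..} r * sphere_flux F x r)"
    using integrable_integral_polar_fun[OF I[of "\<lambda>_. 1" 1] Bm[of "\<lambda>_. 1"], of x] by (simp add: pf)
  show "(LBINT z. F z \<bullet> radial k (z - x)) = (LBINT r. k r * (indicator {0<..} r * sphere_flux F x r))"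
    if "k \<in> borel_measurable borel" "\<And>r. \<bar>k r\<bar> \<le> M" for k M
    using integral_polar_fun[OF I[OF that] Bm[OF that(1)], of x] by (simp add: pf)
qed

section \<open>The superlinear bound for integer fluxes\<close>

lemma le_truncation_powr:
  fixes a l p :: real
  assumes "0 \<le> a" "0 < l" "1 < p"
  shows "a \<le> l + l powr (1 - p) * a powr p"
proof (cases "a \<le> l")
  case True
  then show ?thesis using assms by (simp add: add_increasing2)
next
  case False
  then have a: "0 < a" using assms by simp
  \<comment> \<open>Above the height l the first power is traded for the p-th: 1 - p is negative, so
    \<open>a powr (1 - p)\<close> is at most \<open>l powr (1 - p)\<close>.\<close>
  have "a = a powr (1 - p) * a powr p"
    using a by (simp flip: powr_add)
  also have "\<dots> \<le> l powr (1 - p) * a powr p"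
    using False assms by (intro mult_right_mono powr_mono2') auto
  finally show ?thesis using assms by linarith
qed

text \<open>No integrability is assumed, since the Bochner integral of a non-integrable function is
  0 by convention.\<close>

lemma norm_integral_le_nn_integral:
  fixes f :: "'a \<Rightarrow> 'b::{banach, second_countable_topology}"
  shows "ennreal (norm (integral\<^sup>L M f)) \<le> (\<integral>\<^sup>+x. ennreal (norm (f x)) \<partial>M)"
  by (cases "integrable M f") (simp_all add: integral_norm_bound_ennreal not_integrable_integral_eq)

lemma emeasure_sph_dom: "emeasure lborel sph_dom = ennreal (2 * pi\<^sup>2)"
proof -
  have "sph_dom = box (0, 0) (pi, 2 * pi)"
    by (auto simp: sph_dom_def mem_box Basis_prod_def)
  moreover have "emeasure lborel (box (0, 0) (pi, 2 * pi)) = ennreal (\<Prod>b\<in>Basis. ((pi, 2 * pi) - (0, 0)) \<bullet> b)"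
    by (rule emeasure_lborel_box) (auto simp: Basis_prod_def)
  moreover have "(\<Prod>b\<in>Basis. ((pi, 2 * pi) - (0, 0)) \<bullet> b) = 2 * pi\<^sup>2"
    by (simp add: Basis_prod_def power2_eq_square)
  ultimately show ?thesis by simp
qed

text \<open>Bounding the sine by 1 gives this constant in place of the true area 4 pi r^2; only the
  order r^2 matters.\<close>

lemma nn_integral_sphere_area_le:
  "(\<integral>\<^sup>+w. ennreal (r\<^sup>2 * sin (fst w)) * indicator sph_dom w \<partial>lborel) \<le> ennreal (2 * pi\<^sup>2 * r\<^sup>2)"
proof -
  have "(\<integral>\<^sup>+w. ennreal (r\<^sup>2 * sin (fst w)) * indicator sph_dom w \<partial>lborel) \<le> (\<integral>\<^sup>+w. ennreal (r\<^sup>2) * indicator sph_dom w \<partial>lborel)"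
  proof (rule nn_integral_mono)
    fix w :: "real \<times> real"
    have "r\<^sup>2 * sin (fst w) \<le> r\<^sup>2 * 1"
      by (intro mult_left_mono) auto
    then show "ennreal (r\<^sup>2 * sin (fst w)) * indicator sph_dom w \<le> ennreal (r\<^sup>2) * indicator sph_dom w"
      by (intro mult_right_mono ennreal_leI) auto
  qed
  also have "\<dots> = ennreal (r\<^sup>2) * emeasure lborel sph_dom"
    by (rule nn_integral_cmult_indicator) simp
  also have "\<dots> = ennreal (2 * pi\<^sup>2 * r\<^sup>2)"
    unfolding emeasure_sph_dom by (subst ennreal_mult[symmetric]) (auto simp: mult_ac)
  finally show ?thesis .
qed

lemma sphere_pullback_abs_le:
  assumes "w \<in> sph_dom"
  shows "\<bar>sphere_pullback F y r w\<bar> \<le> r\<^sup>2 * sin (fst w) * norm (F (y + r *\<^sub>R sph (fst w) (snd w)))"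
proof -
  let ?z = "F (y + r *\<^sub>R sph (fst w) (snd w))" and ?s = "sph (fst w) (snd w)"
  have "\<bar>sphere_pullback F y r w\<bar> = r\<^sup>2 * sin (fst w) * \<bar>?z \<bullet> ?s\<bar>"
    using sin_nonneg_sph_dom[OF assms] by (simp add: sphere_pullback_def split_beta' abs_mult)
  also have "\<dots> \<le> r\<^sup>2 * sin (fst w) * norm ?z"
    using Cauchy_Schwarz_ineq2[of ?z ?s] sin_nonneg_sph_dom[OF assms] by (intro mult_left_mono) auto
  finally show ?thesis .
qed

text \<open>In substance this is Hoelder's inequality together with |m| <= |m|^p for integers m.
  Truncation gives it directly in a form linear in \<open>?J\<close>, without fractional powers of
  an integral, so that it can be integrated over radii and then over centres. The factor is of order
  r^(2p-2).\<close>

lemma integer_flux_le: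
  fixes F :: form2
  assumes F [measurable]: "F \<in> borel_measurable borel" and p: "1 < p" and r: "0 < r"
    and int: "sphere_flux F y r \<in> \<int>"
  shows "ennreal \<bar>sphere_flux F y r\<bar> \<le> ennreal (2 * (4 * pi\<^sup>2 * r\<^sup>2) powr (p - 1)) *
    (\<integral>\<^sup>+w. ennreal (r\<^sup>2 * sin (fst w)) * ennreal (norm (F (y + r *\<^sub>R sph (fst w) (snd w))) powr p) * indicator sph_dom w \<partial>lborel)"
    (is "_ \<le> _ * ?J")
proof -
  define A where "A = 2 * pi\<^sup>2 * r\<^sup>2"
  \<comment> \<open>A bounds the area of the sphere, so truncating |F| at height l costs at most 1/2, which a nonzero integer absorbs.\<close>
  define l where "l = 1 / (2 * A)"
  have A: "0 < A" using r by (simp add: A_def)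
  have l: "0 < l" using A by (simp add: l_def)
  have lp: "l powr (1 - p) = (4 * pi\<^sup>2 * r\<^sup>2) powr (p - 1)"
    using A by (simp add: l_def powr_divide powr_minus_divide[symmetric] A_def mult.assoc)
  let ?n = "\<lambda>w. norm (F (y + r *\<^sub>R sph (fst w) (snd w)))"
  have [measurable]: "(\<lambda>w::real \<times> real. sin (fst w)) \<in> borel_measurable borel"
    by (intro borel_measurable_continuous_onI continuous_intros)
  have "ennreal \<bar>sphere_flux F y r\<bar> \<le> (\<integral>\<^sup>+w. ennreal \<bar>indicator sph_dom w * sphere_pullback F y r w\<bar> \<partial>lborel)"
    using norm_integral_le_nn_integral[of lborel "\<lambda>w. indicator sph_dom w * sphere_pullback F y r w"]
    by (simp add: sphere_flux_def integral_lebesgue_on_sph_dom sphere_pullback_borel)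
  also have "\<dots> \<le> (\<integral>\<^sup>+w. ennreal l * (ennreal (r\<^sup>2 * sin (fst w)) * indicator sph_dom w)
      + ennreal (l powr (1 - p)) * (ennreal (r\<^sup>2 * sin (fst w)) * ennreal (?n w powr p) * indicator sph_dom w) \<partial>lborel)"
  proof (rule nn_integral_mono)
    fix w :: "real \<times> real"
    show "ennreal \<bar>indicator sph_dom w * sphere_pullback F y r w\<bar> \<le> ennreal l * (ennreal (r\<^sup>2 * sin (fst w)) * indicator sph_dom w)
      + ennreal (l powr (1 - p)) * (ennreal (r\<^sup>2 * sin (fst w)) * ennreal (?n w powr p) * indicator sph_dom w)"
    proof (cases "w \<in> sph_dom")
      case True
      have s: "0 \<le> r\<^sup>2 * sin (fst w)" using sin_nonneg_sph_dom[OF True] by simp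
      have "\<bar>sphere_pullback F y r w\<bar> \<le> r\<^sup>2 * sin (fst w) * ?n w"
        by (rule sphere_pullback_abs_le[OF True])
      also have "\<dots> \<le> r\<^sup>2 * sin (fst w) * (l + l powr (1 - p) * ?n w powr p)"
        by (intro mult_left_mono le_truncation_powr s l p) auto
      also have "\<dots> = l * (r\<^sup>2 * sin (fst w)) + l powr (1 - p) * (r\<^sup>2 * sin (fst w) * ?n w powr p)"
        by (simp add: algebra_simps)
      finally have "ennreal \<bar>sphere_pullback F y r w\<bar> \<le> ennreal (l * (r\<^sup>2 * sin (fst w)) + l powr (1 - p) * (r\<^sup>2 * sin (fst w) * ?n w powr p))"
        by (rule ennreal_leI)
      also have "\<dots> = ennreal l * ennreal (r\<^sup>2 * sin (fst w)) + ennreal (l powr (1 - p)) * (ennreal (r\<^sup>2 * sin (fst w)) * ennreal (?n w powr p))"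
        using s l by (simp add: ennreal_plus ennreal_mult)
      finally show ?thesis using True by simp
    qed simp
  qed
  also have "\<dots> = ennreal l * (\<integral>\<^sup>+w. ennreal (r\<^sup>2 * sin (fst w)) * indicator sph_dom w \<partial>lborel) + ennreal (l powr (1 - p)) * ?J"
    by (subst nn_integral_add; (subst nn_integral_cmult)?; (subst nn_integral_cmult)?; simp)
  also have "\<dots> \<le> ennreal l * ennreal A + ennreal (l powr (1 - p)) * ?J"
    unfolding A_def by (intro add_right_mono mult_left_mono nn_integral_sphere_area_le) auto
  also have "ennreal l * ennreal A = ennreal (1/2)"
    using A l by (subst ennreal_mult[symmetric]) (auto simp: l_def)
  finally have le: "ennreal \<bar>sphere_flux F y r\<bar> \<le> ennreal (1/2) + ennreal (l powr (1 - p)) * ?J" .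
  show ?thesis
  proof (cases "?J = \<infinity>")
    \<comment> \<open>As \<open>0 < r\<close>, the factor in front is positive and the right-hand
      side is infinite.\<close>
    case True
    then show ?thesis using r by (simp add: ennreal_mult_top)
  next
    case False
    define j where "j = enn2real ?J"
    have J: "?J = ennreal j" and j0: "0 \<le> j"
      using False by (simp_all add: j_def ennreal_enn2real_if)
    define c where "c = (4 * pi\<^sup>2 * r\<^sup>2) powr (p - 1)"
    have c0: "0 \<le> c" by (simp add: c_def)
    have "ennreal \<bar>sphere_flux F y r\<bar> \<le> ennreal (1/2 + c * j)"
      using le j0 c0 unfolding J lp c_def[symmetric] by (simp add: ennreal_plus ennreal_mult)
    then have 1: "\<bar>sphere_flux F y r\<bar> \<le> 1/2 + c * j"
      using j0 c0 by (subst (asm) ennreal_le_iff) auto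
    have "\<bar>sphere_flux F y r\<bar> \<le> 2 * c * j"
    proof (cases "sphere_flux F y r = 0")
      case True
      then show ?thesis using j0 c0 by simp
    next
      case False
      then have "1 \<le> \<bar>sphere_flux F y r\<bar>"
        using int by (rule Ints_nonzero_abs_ge1[rotated])
      then show ?thesis using 1 by linarith
    qed
    then show ?thesis
      unfolding J c_def[symmetric] using j0 c0 by (subst ennreal_mult[symmetric]) (auto intro: ennreal_leI)
  qed
qed

text \<open>The factor of the flux bound increases with r because p > 1, so its value at h serves
  all radii below h. Polar coordinates about y then reassemble the spherical integrals into one
  integral over the ball.\<close>

lemma integer_flux_radial_le:
  fixes F :: form2
  assumes F: "integrable lborel F" and Fm [measurable]: "F \<in> borel_measurable borel" and p: "1 < p"
    and int: "AE r in lborel. 0 < r \<and> r < h \<longrightarrow> sphere_flux F y r \<in> \<int>"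
    and k: "k \<in> borel_measurable borel" "\<And>r. \<bar>k r\<bar> \<le> 1" "\<And>r. h \<le> r \<Longrightarrow> k r = 0"
  shows "ennreal \<bar>\<integral>z. F z \<bullet> radial k (z - y) \<partial>lborel\<bar> \<le> ennreal (2 * (4 * pi\<^sup>2 * h\<^sup>2) powr (p - 1)) *
    (\<integral>\<^sup>+z. ennreal (norm (F z) powr p) * indicator (ball y h) z \<partial>lborel)"
proof -
  define c where "c = ennreal (2 * (4 * pi\<^sup>2 * h\<^sup>2) powr (p - 1))"
  let ?g = "\<lambda>z. ennreal (norm (F z) powr p) * indicator (ball y h) z"
  have g: "?g \<in> borel_measurable borel"
    by (intro borel_measurable_times_ennreal borel_measurable_indicator) simp_all
  let ?J = "\<lambda>r. (\<integral>\<^sup>+w. ennreal (r\<^sup>2 * sin (fst w)) *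
     ?g (y + r *\<^sub>R sph (fst w) (snd w)) * indicator sph_dom w \<partial>lborel) * indicator {0<..} r"
  have "ennreal \<bar>\<integral>z. F z \<bullet> radial k (z - y) \<partial>lborel\<bar> \<le> (\<integral>\<^sup>+r. ennreal \<bar>k r * (indicator {0<..} r * sphere_flux F y r)\<bar> \<partial>lborel)"
    using integral_inner_radial[OF F Fm k(1,2), of y] 
      norm_integral_le_nn_integral[of lborel "\<lambda>r. k r * (indicator {0<..} r * sphere_flux F y r)"] by simp
  also have "\<dots> \<le> (\<integral>\<^sup>+r. c * ?J r \<partial>lborel)"
  proof (rule nn_integral_mono_AE)
    show "AE r in lborel. ennreal \<bar>k r * (indicator {0<..} r * sphere_flux F y r)\<bar> \<le> c * ?J r"
      using int
    proof eventually_elim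
      case (elim r)
      show ?case
      proof (cases "0 < r \<and> r < h")
        case True
        have "\<bar>k r * (indicator {0<..} r * sphere_flux F y r)\<bar> \<le> \<bar>sphere_flux F y r\<bar>"
          using k(2)[of r] True by (simp add: abs_mult mult_left_le_one_le)
        then have "ennreal \<bar>k r * (indicator {0<..} r * sphere_flux F y r)\<bar> \<le> ennreal \<bar>sphere_flux F y r\<bar>"
          by (rule ennreal_leI)
        also have "\<dots> \<le> ennreal (2 * (4 * pi\<^sup>2 * r\<^sup>2) powr (p - 1)) *
          (\<integral>\<^sup>+w. ennreal (r\<^sup>2 * sin (fst w)) * ennreal (norm (F (y + r *\<^sub>R sph (fst w) (snd w))) powr p) * indicator sph_dom w \<partial>lborel)"
          using elim True by (intro integer_flux_le Fm p) auto
        also have "\<dots> \<le> c * ?J r"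
        proof (rule mult_mono)
          have "(4 * pi\<^sup>2 * r\<^sup>2) powr (p - 1) \<le> (4 * pi\<^sup>2 * h\<^sup>2) powr (p - 1)"
            using True p by (intro powr_mono2 mult_left_mono power_mono) auto
          then show "ennreal (2 * (4 * pi\<^sup>2 * r\<^sup>2) powr (p - 1)) \<le> c"
            unfolding c_def by (intro ennreal_leI) simp
          have "y + r *\<^sub>R sph t s \<in> ball y h" for t s
            using True by (simp add: dist_norm)
          then show "(\<integral>\<^sup>+w. ennreal (r\<^sup>2 * sin (fst w)) * ennreal (norm (F (y + r *\<^sub>R sph (fst w) (snd w))) powr p) * indicator sph_dom w \<partial>lborel) \<le> ?J r"
            using True by simp
        qed auto
        finally show ?thesis .
      next
        case False
        then have z: "k r * (indicator {0<..} r * sphere_flux F y r) = 0"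
          using k(3)[of r] by (cases "0 < r") auto
        show ?thesis unfolding z by simp
      qed
    qed
  qed
  also have "\<dots> = c * (\<integral>\<^sup>+r. ?J r \<partial>lborel)"
  proof (rule nn_integral_cmult)
    note polar_integrand_borel[OF g, of y]
    then have "(\<lambda>r. \<integral>\<^sup>+w. (case (r, w) of (r, w) \<Rightarrow> ennreal (r\<^sup>2 * sin (fst w)) * ?g (y + r *\<^sub>R sph (fst w) (snd w)) * indicator sph_dom w) \<partial>lborel) \<in> borel_measurable lborel"
      by (rule lborel.borel_measurable_nn_integral_fst)
    then show "?J \<in> borel_measurable lborel"
      by (intro borel_measurable_times_ennreal) simp_all
  qed
  also have "(\<integral>\<^sup>+r. ?J r \<partial>lborel) = (\<integral>\<^sup>+z. ?g z \<partial>lborel)"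
    by (rule nn_integral_polar[OF g, symmetric])
  finally show ?thesis unfolding c_def .
qed

section \<open>Weak sequential compactness in Lp\<close>

text \<open>A diagonal argument handles only countably many sets, and a Dynkin induction passes from
  an intersection-stable generator to all Borel sets; finite intersections of basis elements serve
  both. The whole space is the empty intersection, and the complement step of the induction relies
  on it.\<close>

lemma ex_countable_Int_stable_generator:
  "\<exists>\<A> :: 'a::second_countable_topology set set. countable \<A> \<and> Int_stable \<A> \<and> sets borel = sigma_sets UNIV \<A> \<and> UNIV \<in> \<A>"
proof -
  obtain B :: "'a set set" where B: "countable B" "topological_basis B"
    using ex_countable_basis by auto
  define \<A> where "\<A> = Inter ` {F. finite F \<and> F \<subseteq> B}"
  have "countable \<A>"
    unfolding \<A>_def by (intro countable_image countable_Collect_finite_subset B)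
  moreover have "Int_stable \<A>"
  proof (rule Int_stableI)
    fix X Y assume "X \<in> \<A>" "Y \<in> \<A>"
    then obtain F G where FG: "finite F" "F \<subseteq> B" "X = \<Inter>F" "finite G" "G \<subseteq> B" "Y = \<Inter>G"
      by (auto simp: \<A>_def)
    then have "X \<inter> Y = \<Inter>(F \<union> G)" by auto
    with FG show "X \<inter> Y \<in> \<A>"
      unfolding \<A>_def by (intro image_eqI[of _ _ "F \<union> G"]) auto
  qed
  moreover have "sets borel = sigma_sets UNIV \<A>"
  proof
    have "B \<subseteq> \<A>"
    proof
      fix X assume "X \<in> B"
      then show "X \<in> \<A>" unfolding \<A>_def by (intro image_eqI[of _ _ "{X}"]) auto
    qed
    then show "sets borel \<subseteq> sigma_sets UNIV \<A>"
      unfolding borel_eq_countable_basis[OF B] by (simp add: sigma_sets_mono')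
    have "\<A> \<subseteq> sets borel"
    proof
      fix X assume "X \<in> \<A>"
      then obtain F where F: "finite F" "F \<subseteq> B" "X = \<Inter>F" by (auto simp: \<A>_def)
      then have "open X"
        using topological_basis_open[OF B(2)] by (auto intro!: open_Inter)
      then show "X \<in> sets borel" by simp
    qed
    then show "sigma_sets UNIV \<A> \<subseteq> sets borel"
      by (metis sets.sigma_sets_subset space_borel)
  qed
  moreover have "UNIV \<in> \<A>"
    unfolding \<A>_def by (intro image_eqI[of _ _ "{}"]) auto
  ultimately show ?thesis by blast
qed

text \<open>The graph of \<open>t powr p\<close> lies above its tangent at s. This is Young's
  inequality for a and \<open>s powr (p - 1)\<close> with the exponents p and p / (p - 1).\<close>

lemma powr_tangent_le:
  fixes a s p :: real
  assumes "0 \<le> a" "0 \<le> s" "1 < p"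
  shows "p * s powr (p - 1) * a \<le> a powr p + (p - 1) * s powr p"
proof -
  define q where "q = p / (p - 1)"
  have q: "1 < q" "1 / p + 1 / q = 1" "(p - 1) * q = p" "p / q = p - 1"
    using assms by (auto simp: q_def field_simps)
  have "a * s powr (p - 1) \<le> a powr p / p + (s powr (p - 1)) powr q / q"
    using assms q by (intro Youngs_inequality) auto
  then have "p * (a * s powr (p - 1)) \<le> p * (a powr p / p + s powr p / q)"
    using assms by (intro mult_left_mono) (auto simp: powr_powr q)
  also have "\<dots> = a powr p + p / q * s powr p"
    using assms by (simp add: field_simps)
  finally show ?thesis by (simp add: q mult_ac)
qed

text \<open>Young's inequality after scaling a by \<open>d powr (1 / p)\<close> and b by its
  inverse. It replaces Hoelder's inequality below: the factor that is merely bounded gets a small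
  weight, and the factor that can be made small may take a large one.\<close>

lemma Young_with_epsilon:
  fixes p d :: real
  assumes "1 < p" "0 < d"
  shows "\<exists>K\<ge>0. \<forall>a\<ge>0. \<forall>b\<ge>0. a * b \<le> d * a powr p + K * b powr (p / (p - 1))"
proof -
  define q where "q = p / (p - 1)"
  define e where "e = d powr (1 / p)"
  have q: "1 < q" "1 / p + 1 / q = 1"
    using assms by (auto simp: q_def field_simps)
  have e: "0 < e" "e powr p = d" using assms by (auto simp: e_def powr_powr)
  have "a * b \<le> d * a powr p + (1 / e) powr q * b powr q" if "0 \<le> a" "0 \<le> b" for a b
  proof -
    have "a * b = (e * a) * (1 / e * b)" using e by simp
    also have "\<dots> \<le> (e * a) powr p / p + (1 / e * b) powr q / q"
      using that e assms q by (intro Youngs_inequality) auto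
    also have "\<dots> \<le> (e * a) powr p + (1 / e * b) powr q"
      using assms q by (intro add_mono) (auto simp: divide_le_eq mult_le_cancel_left1)
    also have "\<dots> = d * a powr p + (1 / e) powr q * b powr q"
      using that e by (simp only: powr_mult e)
    finally show ?thesis .
  qed
  then show ?thesis
    unfolding q_def[symmetric] by (intro exI[of _ "(1 / e) powr q"]) auto
qed

text \<open>Nonnegativity is built in so that the limits of the set functions are measures, to which
  the Radon-Nikodym theorem applies; vector fields are reduced to this case by the positive and
  negative parts of their components.\<close>

locale Lp_bounded_seq = finite_measure M for M :: "'a::second_countable_topology measure" +
  fixes u :: "nat \<Rightarrow> 'a \<Rightarrow> real" and p C :: real
  assumes sets_M [measurable_cong]: "sets M = sets borel" and p: "1 < p" and C: "0 \<le> C"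
    and u_borel [measurable]: "\<And>n. u n \<in> borel_measurable borel"
    and nn: "\<And>n x. 0 \<le> u n x"
    and Lp: "\<And>n. (\<integral>\<^sup>+x. ennreal (u n x powr p) \<partial>M) \<le> ennreal C"
begin

lemma space_M [simp]: "space M = UNIV"
  using sets_eq_imp_space_eq[OF sets_M] by simp

text \<open>Equi-integrability in quantitative form, by truncation at height l: a large l makes the
  last term small uniformly in n, and then sets of small measure carry little mass.\<close>

lemma nn_integral_indicator_le:
  assumes E: "E \<in> sets borel" and l: "0 < l"
  shows "(\<integral>\<^sup>+x. ennreal (indicator E x * u n x) \<partial>M) \<le> ennreal (l * measure M E + l powr (1 - p) * C)"
proof -
  have [measurable]: "E \<in> sets borel" by fact
  have "(\<integral>\<^sup>+x. ennreal (indicator E x * u n x) \<partial>M) \<le>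
    (\<integral>\<^sup>+x. ennreal l * indicator E x + ennreal (l powr (1 - p)) * ennreal (u n x powr p) \<partial>M)"
  proof (rule nn_integral_mono)
    fix x
    have "indicator E x * u n x \<le> l * indicator E x + l powr (1 - p) * u n x powr p"
      using le_truncation_powr[OF nn l p, of n x] by (auto split: split_indicator)
    then have "ennreal (indicator E x * u n x) \<le> ennreal (l * indicator E x + l powr (1 - p) * u n x powr p)"
      by (rule ennreal_leI)
    then show "ennreal (indicator E x * u n x) \<le> ennreal l * indicator E x + ennreal (l powr (1 - p)) * ennreal (u n x powr p)"
      using l by (simp add: ennreal_plus ennreal_mult ennreal_indicator)
  qed
  also have "\<dots> = ennreal l * emeasure M E + ennreal (l powr (1 - p)) * (\<integral>\<^sup>+x. ennreal (u n x powr p) \<partial>M)"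
    by (subst nn_integral_add; simp add: nn_integral_cmult)
  also have "\<dots> \<le> ennreal l * ennreal (measure M E) + ennreal (l powr (1 - p)) * ennreal C"
    by (intro add_mono mult_left_mono Lp) (auto simp: emeasure_eq_measure)
  also have "\<dots> = ennreal (l * measure M E + l powr (1 - p) * C)"
    using l C by (simp add: ennreal_plus ennreal_mult)
  finally show ?thesis .
qed

lemma integrable_indicator_u:
  assumes E [measurable]: "E \<in> sets borel"
  shows "integrable M (\<lambda>x. indicator E x * u n x)"
proof (rule integrableI_nonneg)
  show "(\<integral>\<^sup>+x. ennreal (indicator E x * u n x) \<partial>M) < \<infinity>"
    using nn_integral_indicator_le[OF E, of 1 n] by (simp add: le_less_trans)
qed (auto simp: nn)

lemma integral_indicator_le:
  assumes E: "E \<in> sets borel" and l: "0 < l"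
  shows "(LINT x|M. indicator E x * u n x) \<le> l * measure M E + l powr (1 - p) * C"
proof -
  have "ennreal (LINT x|M. indicator E x * u n x) \<le> ennreal (l * measure M E + l powr (1 - p) * C)"
    using nn_integral_indicator_le[OF E l] 
    by (subst nn_integral_eq_integral[OF integrable_indicator_u[OF E], symmetric]) (simp_all add: nn)
  then show ?thesis
    using l C by (subst (asm) ennreal_le_iff) auto
qed

lemma integral_indicator_nonneg: "0 \<le> (LINT x|M. indicator E x * u n x)"
  by (rule Bochner_Integration.integral_nonneg) (simp add: nn)

lemma integral_indicator_Un:
  assumes "A \<in> sets borel" "B \<in> sets borel" "A \<inter> B = {}"
  shows "(LINT x|M. indicator (A \<union> B) x * u n x) = (LINT x|M. indicator A x * u n x) + (LINT x|M. indicator B x * u n x)"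
proof -
  have "(\<lambda>x. indicator (A \<union> B) x * u n x) = (\<lambda>x. indicator A x * u n x + indicator B x * u n x)"
    using assms(3) by (auto simp: fun_eq_iff split: split_indicator)
  then show ?thesis
    using assms by (simp add: integrable_indicator_u)
qed

lemma integral_indicator_finite_UN:
  fixes A :: "nat \<Rightarrow> 'a set"
  assumes "\<And>i. A i \<in> sets borel" "disjoint_family A"
  shows "(LINT x|M. indicator (\<Union>i<m. A i) x * u n x) = (\<Sum>i<m. LINT x|M. indicator (A i) x * u n x)"
proof (induction m)
  case (Suc m)
  have "A i \<inter> A m = {}" if "i < m" for i
    using assms(2) that by (auto simp: disjoint_family_on_def)
  then have "(\<Union>i<m. A i) \<inter> A m = {}" by auto
  then have "(LINT x|M. indicator ((\<Union>i<m. A i) \<union> A m) x * u n x) = (\<Sum>i<m. LINT x|M. indicator (A i) x * u n x) + (LINT x|M. indicator (A m) x * u n x)"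
    using assms(1) by (subst integral_indicator_Un) (auto simp: Suc)
  then show ?case
    by (simp add: lessThan_Suc Un_commute)
qed simp

text \<open>As 1 - p < 0, a large l brings the second term below e / 2; only then is d chosen,
  depending on l.\<close>

lemma ex_small_parameters:
  assumes "0 < e"
  shows "\<exists>l>0. \<exists>d>0. l * d + l powr (1 - p) * C < e"
proof -
  have "((\<lambda>l. l powr (1 - p) * C) \<longlongrightarrow> 0 * C) at_top"
    using p by (intro tendsto_mult tendsto_const tendsto_neg_powr) (auto simp: filterlim_ident)
  then have "eventually (\<lambda>l. l powr (1 - p) * C < e / 2) at_top"
    using assms by (intro order_tendstoD) auto
  then have "eventually (\<lambda>l. l powr (1 - p) * C < e / 2 \<and> 0 < l) at_top"
    using eventually_gt_at_top[of 0] by eventually_elim auto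
  then obtain l where l: "l powr (1 - p) * C < e / 2" "0 < l"
    using eventually_happens[of _ "at_top :: real filter"] by auto
  show ?thesis
    by (rule exI[of _ l], intro conjI l, rule exI[of _ "e / (2 * l)"]) (use l assms in auto)
qed

text \<open>The measures of the tails decrease to 0, and equi-integrability turns this into a bound
  that is the same for all n. This uniformity is what lets countable additivity survive the
  limit.\<close>

lemma tail_uniformly_small:
  fixes A :: "nat \<Rightarrow> 'a set"
  assumes A: "\<And>i. A i \<in> sets borel" and e: "0 < e"
  shows "\<exists>m0. \<forall>m\<ge>m0. \<forall>n. (LINT x|M. indicator ((\<Union>i. A i) - (\<Union>i<m. A i)) x * u n x) < e"
proof -
  obtain l d where ld: "0 < l" "0 < d" "l * d + l powr (1 - p) * C < e"
    using ex_small_parameters[OF e] by blast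
  let ?E = "\<lambda>m. (\<Union>i. A i) - (\<Union>i<m. A i)"
  have "(\<lambda>m. measure M (?E m)) \<longlonglongrightarrow> measure M (\<Inter>m. ?E m)"
  proof (rule finite_Lim_measure_decseq)
    show "range ?E \<subseteq> sets M" using A by (auto simp: sets_M)
    show "decseq ?E" unfolding decseq_def by (intro allI impI Diff_mono subset_refl UN_mono) auto
  qed
  also have "(\<Inter>m. ?E m) = {}" by auto
  finally have "eventually (\<lambda>m. measure M (?E m) < d) sequentially"
    using ld by (intro order_tendstoD) auto
  then obtain m0 where m0: "\<And>m. m0 \<le> m \<Longrightarrow> measure M (?E m) < d"
    by (auto simp: eventually_sequentially)
  show ?thesis
  proof (intro exI allI impI)
    fix m n assume "m0 \<le> m"
    have "?E m \<in> sets borel" using A by auto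
    then have "(LINT x|M. indicator (?E m) x * u n x) \<le> l * measure M (?E m) + l powr (1 - p) * C"
      using ld by (intro integral_indicator_le)
    also have "\<dots> \<le> l * d + l powr (1 - p) * C"
      using m0[OF \<open>m0 \<le> m\<close>] ld by simp
    finally show "(LINT x|M. indicator (?E m) x * u n x) < e" using ld by simp
  qed
qed

text \<open>Dynkin induction. The only step with content is the countable disjoint union: up to a
  tail that is small uniformly in n the integral is a finite sum of convergent sequences, hence
  Cauchy.\<close>

lemma convergent_on_borel:
  assumes G: "Int_stable G" "sets borel = sigma_sets UNIV G" "UNIV \<in> G"
    and conv: "\<And>A. A \<in> G \<Longrightarrow> convergent (\<lambda>n. LINT x|M. indicator A x * u n x)"
    and A: "A \<in> sets borel"
  shows "convergent (\<lambda>n. LINT x|M. indicator A x * u n x)"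
proof -
  have "A \<in> sigma_sets UNIV G" using A G(2) by simp
  with G(1) have "Int_stable G" "G \<subseteq> Pow UNIV" "A \<in> sigma_sets UNIV G" by auto
  then show ?thesis
  proof (induction rule: sigma_sets_induct_disjoint)
    case (basic A)
    then show ?case by (rule conv)
  next
    case empty
    then show ?case by (simp add: convergent_const)
  next
    case (compl A)
    then have A: "A \<in> sets borel" using G(2) by simp
    have "(LINT x|M. indicator (UNIV - A) x * u n x) = (LINT x|M. indicator UNIV x * u n x) - (LINT x|M. indicator A x * u n x)" for n
      using integral_indicator_Un[of A "UNIV - A" n] A by (simp add: Compl_eq_Diff_UNIV[symmetric])
    then show ?case
      using convergent_diff[OF conv[OF G(3)] compl(2)] by simp
  next
    case (union A)
    then have A: "A i \<in> sets borel" for i using G(2) by auto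
    let ?a = "\<lambda>n. LINT x|M. indicator (\<Union>i. A i) x * u n x"
    let ?b = "\<lambda>m n. LINT x|M. indicator (\<Union>i<m. A i) x * u n x"
    let ?E = "\<lambda>m. (\<Union>i. A i) - (\<Union>i<m. A i)"
    have ab: "?a n = ?b m n + (LINT x|M. indicator (?E m) x * u n x)" for m n
    proof -
      have U: "(\<Union>i<m. A i) \<union> ?E m = (\<Union>i. A i)" by blast
      have "(\<Union>i<m. A i) \<in> sets borel" "?E m \<in> sets borel" "(\<Union>i<m. A i) \<inter> ?E m = {}"
        using A by auto
      from integral_indicator_Un[OF this] show ?thesis unfolding U .
    qed
    have "Cauchy ?a"
    proof (rule metric_CauchyI)
      fix e :: real assume e: "0 < e"
      obtain m where m: "\<And>n. (LINT x|M. indicator (?E m) x * u n x) < e / 2"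
        using tail_uniformly_small[of A, OF A half_gt_zero[OF e]] by blast
      have "convergent (?b m)"
        using union A by (simp add: integral_indicator_finite_UN convergent_sum)
      then have "Cauchy (?b m)" by (rule convergent_Cauchy)
      then obtain N where N: "\<And>n n'. N \<le> n \<Longrightarrow> N \<le> n' \<Longrightarrow> dist (?b m n) (?b m n') < e / 2"
        using e half_gt_zero[OF e] unfolding Cauchy_def by blast
      \<comment> \<open>Both tails lie between 0 and e / 2, so by nonnegativity they differ by less
        than e / 2.\<close>
      have "dist (?a n) (?a n') < e" if "N \<le> n" "N \<le> n'" for n n'
        using N[OF that] m[of n] m[of n'] integral_indicator_nonneg[of "?E m" n] integral_indicator_nonneg[of "?E m" n']
        unfolding ab[of n m] ab[of n' m] dist_real_def by linarith
      then show "\<exists>N. \<forall>n\<ge>N. \<forall>n'\<ge>N. dist (?a n) (?a n') < e" by blast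
    qed
    then show ?case by (simp add: Cauchy_convergent_iff)
  qed
qed

text \<open>The setwise limit \<open>\<nu>\<close> is countably additive because the tails are
  uniformly small, and it vanishes on null sets because each integral does. Its Radon-Nikodym
  density is the weak limit.\<close>

lemma ex_limit_density:
  assumes conv: "\<And>A. A \<in> sets borel \<Longrightarrow> convergent (\<lambda>n. LINT x|M. indicator A x * u n x)"
  shows "\<exists>v. v \<in> borel_measurable borel \<and> (\<forall>x. 0 \<le> v x) \<and> integrable M v \<and>
    (\<forall>A\<in>sets borel. (\<lambda>n. LINT x|M. indicator A x * u n x) \<longlonglongrightarrow> (LINT x|M. indicator A x * v x))"
proof -
  define a where "a n A = (LINT x|M. indicator A x * u n x)" for n A
  define \<nu> where "\<nu> A = lim (\<lambda>n. a n A)" for A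
  have lim: "(\<lambda>n. a n A) \<longlonglongrightarrow> \<nu> A" if "A \<in> sets borel" for A
    using conv[OF that] unfolding \<nu>_def a_def by (simp add: convergent_LIMSEQ_iff)
  have \<nu>0: "0 \<le> \<nu> A" if "A \<in> sets borel" for A
    using lim[OF that] by (rule LIMSEQ_le_const) (auto simp: a_def integral_indicator_nonneg)
  have sums: "(\<lambda>i. \<nu> (A i)) sums \<nu> (\<Union>i. A i)" if A: "\<And>i. A i \<in> sets borel" "disjoint_family A" for A :: "nat \<Rightarrow> 'a set"
    unfolding sums_def
  proof (rule metric_LIMSEQ_I)
    fix e :: real assume e: "0 < e"
    let ?E = "\<lambda>m. (\<Union>i. A i) - (\<Union>i<m. A i)"
    obtain m0 where m0: "\<And>m n. m0 \<le> m \<Longrightarrow> (LINT x|M. indicator (?E m) x * u n x) < e / 2"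
      using tail_uniformly_small[of A, OF A(1) half_gt_zero[OF e]] by blast
    have "dist (\<Sum>i<m. \<nu> (A i)) (\<nu> (\<Union>i. A i)) < e" if m: "m0 \<le> m" for m
    proof -
      have split: "a n (\<Union>i. A i) = (\<Sum>i<m. a n (A i)) + a n (?E m)" for n
      proof -
        have U: "(\<Union>i<m. A i) \<union> ?E m = (\<Union>i. A i)" by blast
        have "(\<Union>i<m. A i) \<in> sets borel" "?E m \<in> sets borel" "(\<Union>i<m. A i) \<inter> ?E m = {}"
          using A(1) by auto
        from integral_indicator_Un[OF this] show ?thesis
          unfolding U a_def integral_indicator_finite_UN[OF A] .
      qed
      have "(\<lambda>n. a n (\<Union>i. A i) - (\<Sum>i<m. a n (A i))) \<longlonglongrightarrow> \<nu> (\<Union>i. A i) - (\<Sum>i<m. \<nu> (A i))"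
        using A(1) by (intro tendsto_diff tendsto_sum lim) auto
      then have l: "(\<lambda>n. a n (?E m)) \<longlonglongrightarrow> \<nu> (\<Union>i. A i) - (\<Sum>i<m. \<nu> (A i))"
        by (simp add: split)
      have "\<nu> (\<Union>i. A i) - (\<Sum>i<m. \<nu> (A i)) \<le> e / 2"
      proof (rule LIMSEQ_le_const2[OF l], intro exI allI impI)
        fix n show "a n (?E m) \<le> e / 2"
          using m0[OF m, of n] unfolding a_def by (rule less_imp_le)
      qed
      moreover have "0 \<le> \<nu> (\<Union>i. A i) - (\<Sum>i<m. \<nu> (A i))"
        using l by (rule LIMSEQ_le_const) (auto simp: a_def integral_indicator_nonneg)
      ultimately show ?thesis
        using e unfolding dist_real_def by linarith
    qed
    then show "\<exists>m0. \<forall>m\<ge>m0. dist (\<Sum>i<m. \<nu> (A i)) (\<nu> (\<Union>i. A i)) < e" by blast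
  qed
  define N where "N = measure_of UNIV (sets borel) (\<lambda>A. ennreal (\<nu> A))"
  have setsN: "sets N = sets borel"
    unfolding N_def by (subst sets_measure_of) (auto simp: sets.sigma_sets_eq[of borel, simplified])
  have emN: "emeasure N A = ennreal (\<nu> A)" if "A \<in> sets borel" for A
  proof (rule emeasure_measure_of[OF N_def])
    show "positive (sets N) (\<lambda>A. ennreal (\<nu> A))"
      using lim[of "{}"] by (simp add: positive_def a_def LIMSEQ_const_iff)
    show "countably_additive (sets N) (\<lambda>A. ennreal (\<nu> A))"
      unfolding countably_additive_def setsN
      by (intro allI impI suminf_ennreal_eq sums \<nu>0) auto
  qed (use that setsN in auto)
  have "absolutely_continuous M N"
    unfolding absolutely_continuous_def
  proof
    fix A assume "A \<in> null_sets M"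
    then have A: "A \<in> sets borel" "measure M A = 0"
      by (auto simp: sets_M measure_eq_0_null_sets)
    have "a n A = 0" for n
    proof -
      have "AE x in M. indicator A x * u n x = 0"
        using AE_not_in[OF \<open>A \<in> null_sets M\<close>] by eventually_elim simp
      then show ?thesis unfolding a_def by (rule integral_eq_zero_AE)
    qed
    then have "\<nu> A = 0" using lim[OF A(1)] by (simp add: LIMSEQ_const_iff)
    then show "A \<in> null_sets N" using A setsN emN by (simp add: null_sets_def)
  qed
  then obtain f where f: "f \<in> borel_measurable M" "density M f = N"
    using Radon_Nikodym[of N] setsN sets_M by auto
  have [measurable]: "f \<in> borel_measurable borel"
    using f(1) sets_M by (simp cong: measurable_cong_sets)
  have fN: "(\<integral>\<^sup>+x. f x * indicator A x \<partial>M) = ennreal (\<nu> A)" if "A \<in> sets borel" for A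
    using emeasure_density[OF f(1), of A] that emN f(2) sets_M by simp
  have fin: "(\<integral>\<^sup>+x. f x \<partial>M) \<noteq> \<infinity>"
    using fN[of UNIV] by simp
  \<comment> \<open>The total mass of \<open>\<nu>\<close> is finite, so f is finite almost
    everywhere; where it is infinite, \<open>enn2real\<close> sets v to 0, which keeps v real and
    nonnegative everywhere.\<close>
  define v where "v x = enn2real (f x)" for x
  have [measurable]: "v \<in> borel_measurable borel"
    unfolding v_def by measurable
  have AEv: "AE x in M. ennreal (v x) = f x"
    using nn_integral_PInf_AE[OF f(1) fin] by eventually_elim (simp add: v_def less_top)
  have "(\<integral>\<^sup>+x. ennreal (v x) \<partial>M) = (\<integral>\<^sup>+x. f x \<partial>M)"
    by (rule nn_integral_cong_AE[OF AEv])
  then have iv: "integrable M v"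
    using fin by (intro integrableI_nonneg) (auto simp: v_def less_top)
  have "(LINT x|M. indicator A x * v x) = \<nu> A" if A: "A \<in> sets borel" for A
  proof (rule integral_eq_nn_integral[THEN trans])
    have "(\<integral>\<^sup>+x. ennreal (indicator A x * v x) \<partial>M) = (\<integral>\<^sup>+x. f x * indicator A x \<partial>M)"
    proof (rule nn_integral_cong_AE)
      show "AE x in M. ennreal (indicator A x * v x) = f x * indicator A x"
        using AEv by eventually_elim (auto split: split_indicator)
    qed
    then show "enn2real (\<integral>\<^sup>+x. ennreal (indicator A x * v x) \<partial>M) = \<nu> A"
      using fN[OF A] \<nu>0[OF A] by simp
  qed (use A in \<open>auto simp: v_def\<close>)
  then show ?thesis
    using iv lim by (intro exI[of _ v]) (auto simp: v_def a_def)
qed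

lemma integrable_bounded_mult:
  assumes f: "integrable M f" and g [measurable]: "g \<in> borel_measurable borel" and B: "\<And>x. \<bar>g x\<bar> \<le> B"
  shows "integrable M (\<lambda>x. g x * f x :: real)"
proof (rule Bochner_Integration.integrable_bound)
  show "integrable M (\<lambda>x. B * f x)" using f by simp
  show "(\<lambda>x. g x * f x) \<in> borel_measurable M"
    using f by (intro borel_measurable_times) (auto simp: measurable_cong_sets[OF sets_M])
  show "AE x in M. norm (g x * f x) \<le> norm (B * f x)"
    using order_trans[OF B abs_ge_self] by (auto simp: abs_mult intro!: mult_right_mono)
qed

lemma simple_function_limit:
  assumes v: "integrable M v"
    and lim: "\<And>A. A \<in> sets borel \<Longrightarrow> (\<lambda>n. LINT x|M. indicator A x * u n x) \<longlonglongrightarrow> (LINT x|M. indicator A x * v x)"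
    and g: "simple_function M (g :: 'a \<Rightarrow> real)"
  shows "(\<lambda>n. LINT x|M. g x * u n x) \<longlonglongrightarrow> (LINT x|M. g x * v x)"
proof -
  let ?A = "\<lambda>y. g -` {y}"
  have fin: "finite (range g)" using simple_functionD(1)[OF g] by simp
  have A: "?A y \<in> sets borel" for y
    using simple_functionD(2)[OF g, of "{y}"] sets_M by simp
  have rep: "g x = (\<Sum>y\<in>range g. y * indicator (?A y) x)" for x
    using simple_function_indicator_representation_banach[OF g, of x]
    by (simp only: space_M UNIV_I Int_UNIV_right real_scaleR_def mult.commute[of "indicator _ _"])
  have rep_mult: "g x * w = (\<Sum>y\<in>range g. y * (indicator (?A y) x * w))" for x w
    by (subst rep) (simp only: sum_distrib_right mult.assoc)
  have iv: "integrable M (\<lambda>x. indicator (?A y) x * v x)" for y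
    using A by (intro integrable_bounded_mult[OF v, of _ 1]) (auto split: split_indicator)
  have u: "(LINT x|M. g x * u n x) = (\<Sum>y\<in>range g. y * (LINT x|M. indicator (?A y) x * u n x))" for n
    unfolding rep_mult by (simp add: integrable_indicator_u A)
  have v: "(LINT x|M. g x * v x) = (\<Sum>y\<in>range g. y * (LINT x|M. indicator (?A y) x * v x))"
    unfolding rep_mult by (simp add: iv)
  show ?thesis
    unfolding u v by (intro tendsto_sum tendsto_mult tendsto_const lim A)
qed

lemma integrable_u_powr: "integrable M (\<lambda>x. u n x powr p)"
  by (rule integrableI_nonneg) (auto intro: le_less_trans[OF Lp])

lemma integral_u_powr_le: "(LINT x|M. u n x powr p) \<le> C"
  using Lp[of n] C by (subst (asm) nn_integral_eq_integral[OF integrable_u_powr]) (auto simp: ennreal_le_iff)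

text \<open>Instead of testing against the dual space, integrate the tangent inequality of the convex function
  t powr p at simple functions below the limit.\<close>

lemma limit_in_Lp:
  assumes v: "integrable M v" and vm [measurable]: "v \<in> borel_measurable borel" and v0: "\<And>x. 0 \<le> v x"
    and lim: "\<And>A. A \<in> sets borel \<Longrightarrow> (\<lambda>n. LINT x|M. indicator A x * u n x) \<longlonglongrightarrow> (LINT x|M. indicator A x * v x)"
  shows "(\<integral>\<^sup>+x. ennreal (v x powr p) \<partial>M) \<le> ennreal C"
proof -
  obtain s where s: "incseq s" "\<And>i. simple_function M (s i)" "\<And>x. bdd_above (range (\<lambda>i. s i x))"
      "\<And>i x. 0 \<le> s i x" "v = (SUP i. s i)"
    using borel_measurable_implies_simple_function_sequence_real[of v M] v0 vm
    by (auto simp: measurable_cong_sets[OF sets_M])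
  have vs: "v x = (SUP i. s i x)" for x
    using s(5) by (simp add: image_comp)
  have inc: "incseq (\<lambda>i. s i x)" for x
    using s(1) by (auto simp: incseq_def le_fun_def)
  have sv: "s i x \<le> v x" for i x
    unfolding vs by (rule cSUP_upper[OF _ s(3)]) simp
  have slim: "(\<lambda>i. s i x) \<longlonglongrightarrow> v x" for x
    unfolding vs by (rule LIMSEQ_incseq_SUP[OF s(3) inc])
  have bound: "(\<integral>\<^sup>+x. ennreal (s i x powr p) \<partial>M) \<le> ennreal C" for i
  proof -
    have sf: "simple_function M (\<lambda>x. s i x powr (p - 1))" "simple_function M (\<lambda>x. s i x powr p)"
      using s(2)[of i] by (auto intro: simple_function_compose1[where g="\<lambda>t. t powr _"])
    have sm [measurable]: "s i \<in> borel_measurable borel"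
      using borel_measurable_simple_function[OF s(2)] by (simp add: measurable_cong_sets[OF sets_M])
    obtain B where B: "\<And>x. s i x \<le> B"
    proof -
      have "finite (range (s i))" using simple_functionD(1)[OF s(2)[of i]] by simp
      then have "s i x \<le> Max (range (s i))" for x by simp
      then show ?thesis using that by blast
    qed
    have B0: "0 \<le> B" using B s(4) order_trans by blast
    have isp: "integrable M (\<lambda>x. s i x powr p)"
      by (rule integrable_const_bound[where B="B powr p"])
         (use B s(4) p in \<open>auto simp: measurable_cong_sets[OF sets_M] intro!: powr_mono2\<close>)
    have pw: "\<bar>s i x powr (p - 1)\<bar> \<le> B powr (p - 1)" for x
      using B s(4) p by (auto intro!: powr_mono2)
    have iu: "integrable M (\<lambda>x. s i x powr (p - 1) * u n x)" for n
      using integrable_bounded_mult[of "u n", OF _ _ pw] integrable_indicator_u[of UNIV n] by simp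
    have iv: "integrable M (\<lambda>x. s i x powr (p - 1) * v x)"
      using integrable_bounded_mult[OF v _ pw] by simp
    have "p * (LINT x|M. s i x powr (p - 1) * u n x) \<le> C + (p - 1) * (LINT x|M. s i x powr p)" for n
    proof -
      have "p * (LINT x|M. s i x powr (p - 1) * u n x) = (LINT x|M. p * s i x powr (p - 1) * u n x)"
        by (simp add: mult.assoc)
      also have "\<dots> \<le> (LINT x|M. u n x powr p + (p - 1) * s i x powr p)"
        using iu isp integrable_u_powr p by (intro integral_mono powr_tangent_le nn s) (auto simp: mult.assoc)
      also have "\<dots> \<le> C + (p - 1) * (LINT x|M. s i x powr p)"
        using isp integrable_u_powr integral_u_powr_le by simp
      finally show ?thesis .
    qed
    then have "p * (LINT x|M. s i x powr (p - 1) * v x) \<le> C + (p - 1) * (LINT x|M. s i x powr p)"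
      by (intro LIMSEQ_le_const2[OF tendsto_mult[OF tendsto_const simple_function_limit[OF v lim sf(1)]]]) auto
    moreover have "p * (LINT x|M. s i x powr p) \<le> p * (LINT x|M. s i x powr (p - 1) * v x)"
    proof (intro mult_left_mono integral_mono isp iv)
      fix x
      have "s i x powr p = s i x powr (p - 1) * s i x"
        using s(4)[of i x] powr_add[of "s i x" "p - 1" 1] by (cases "s i x = 0") auto
      also have "\<dots> \<le> s i x powr (p - 1) * v x"
        by (intro mult_left_mono sv) simp
      finally show "s i x powr p \<le> s i x powr (p - 1) * v x" .
    qed (use p in simp)
    \<comment> \<open>With X for the integral of \<open>s i x powr p\<close>, the two bounds combine
      to p X <= C + (p - 1) X. Cancelling is legitimate because s i is bounded and the measure
      finite, so X is an honest real integral.\<close>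
    ultimately have "(LINT x|M. s i x powr p) \<le> C" by (simp add: algebra_simps)
    then show ?thesis
      by (subst nn_integral_eq_integral[OF isp]) (auto intro: ennreal_leI)
  qed
  have "(\<integral>\<^sup>+x. ennreal (v x powr p) \<partial>M) \<le> (\<integral>\<^sup>+x. liminf (\<lambda>i. ennreal (s i x powr p)) \<partial>M)"
  proof (rule nn_integral_mono)
    fix x
    have "(\<lambda>i. ennreal (s i x powr p)) \<longlonglongrightarrow> ennreal (v x powr p)"
      using p by (intro tendsto_ennrealI tendsto_powr2 slim tendsto_const) (auto simp: s)
    from lim_imp_Liminf[OF sequentially_bot this]
    show "ennreal (v x powr p) \<le> liminf (\<lambda>i. ennreal (s i x powr p))"
      by (simp only: order_refl)
  qed
  also have "\<dots> \<le> liminf (\<lambda>i. \<integral>\<^sup>+x. ennreal (s i x powr p) \<partial>M)"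
    using borel_measurable_simple_function[OF s(2)]
    by (intro nn_integral_liminf) simp
  also have "\<dots> \<le> liminf (\<lambda>i. ennreal C)"
    by (intro Liminf_mono always_eventually allI bound)
  also have "\<dots> = ennreal C" by (simp add: Liminf_const)
  finally show ?thesis .
qed

lemma integrable_mult_Lq:
  assumes f [measurable]: "f \<in> borel_measurable borel" "\<And>x. 0 \<le> f x" "integrable M (\<lambda>x. f x powr p)"
    and g [measurable]: "g \<in> borel_measurable borel" "integrable M (\<lambda>x. \<bar>g x\<bar> powr (p / (p - 1)))"
  shows "integrable M (\<lambda>x. f x * g x)"
proof -
  obtain K where K: "0 \<le> K" "\<And>a b. 0 \<le> a \<Longrightarrow> 0 \<le> b \<Longrightarrow> a * b \<le> 1 * a powr p + K * b powr (p / (p - 1))"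
    using Young_with_epsilon[OF p, of 1] by auto
  show ?thesis
  proof (rule Bochner_Integration.integrable_bound)
    show "integrable M (\<lambda>x. f x powr p + K * \<bar>g x\<bar> powr (p / (p - 1)))"
      using f(3) g(2) by simp
    show "(\<lambda>x. f x * g x) \<in> borel_measurable M"
      by (simp add: measurable_cong_sets[OF sets_M])
    have "\<bar>f x * g x\<bar> \<le> f x powr p + K * \<bar>g x\<bar> powr (p / (p - 1))" for x
      using K(2)[OF f(2)[of x] abs_ge_zero[of "g x"]] f(2)[of x] by (simp add: abs_mult)
    then show "AE x in M. norm (f x * g x) \<le> norm (f x powr p + K * \<bar>g x\<bar> powr (p / (p - 1)))"
      using abs_ge_self order_trans by fastforce
  qed
qed

text \<open>The bound depends on f only through C, so one approximation s of g serves the whole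
  sequence and its limit at once.\<close>

lemma abs_integral_mult_diff_le:
  assumes f [measurable]: "f \<in> borel_measurable borel" "\<And>x. 0 \<le> f x" "integrable M (\<lambda>x. f x powr p)" "(LINT x|M. f x powr p) \<le> C"
    and g: "g \<in> borel_measurable borel" "integrable M (\<lambda>x. \<bar>g x\<bar> powr (p / (p - 1)))"
    and s: "s \<in> borel_measurable borel" "integrable M (\<lambda>x. \<bar>s x\<bar> powr (p / (p - 1)))"
    and gs: "integrable M (\<lambda>x. \<bar>g x - s x\<bar> powr (p / (p - 1)))"
    and d: "0 \<le> d" and K: "\<And>a b. 0 \<le> a \<Longrightarrow> 0 \<le> b \<Longrightarrow> a * b \<le> d * a powr p + K * b powr (p / (p - 1))"
  shows "\<bar>(LINT x|M. f x * g x) - (LINT x|M. f x * s x)\<bar> \<le> d * C + K * (LINT x|M. \<bar>g x - s x\<bar> powr (p / (p - 1)))"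
proof -
  have i: "integrable M (\<lambda>x. f x * (g x - s x))"
    using g s by (intro integrable_mult_Lq f gs) auto
  have "(LINT x|M. f x * g x) - (LINT x|M. f x * s x) = (LINT x|M. f x * (g x - s x))"
    by (subst Bochner_Integration.integral_diff[symmetric])
      (use integrable_mult_Lq[OF f(1-3) g] integrable_mult_Lq[OF f(1-3) s] in \<open>auto simp: algebra_simps\<close>)
  then have "\<bar>(LINT x|M. f x * g x) - (LINT x|M. f x * s x)\<bar> \<le> (LINT x|M. \<bar>f x * (g x - s x)\<bar>)"
    using integral_norm_bound[of M "\<lambda>x. f x * (g x - s x)"] by simp
  also have "\<dots> \<le> (LINT x|M. d * f x powr p + K * \<bar>g x - s x\<bar> powr (p / (p - 1)))"
  proof (rule integral_mono)
    show "integrable M (\<lambda>x. d * f x powr p + K * \<bar>g x - s x\<bar> powr (p / (p - 1)))"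
      using f(3) gs by simp
    show "\<bar>f x * (g x - s x)\<bar> \<le> d * f x powr p + K * \<bar>g x - s x\<bar> powr (p / (p - 1))" for x
      using K[OF f(2)[of x] abs_ge_zero[of "g x - s x"]] f(2)[of x] by (simp add: abs_mult)
  qed (use i in simp)
  also have "\<dots> = d * (LINT x|M. f x powr p) + K * (LINT x|M. \<bar>g x - s x\<bar> powr (p / (p - 1)))"
    using f(3) gs by simp
  also have "\<dots> \<le> d * C + K * (LINT x|M. \<bar>g x - s x\<bar> powr (p / (p - 1)))"
    using mult_left_mono[OF f(4) d] by simp
  finally show ?thesis .
qed

lemma Lq_limit:
  assumes v: "integrable M v" and vm [measurable]: "v \<in> borel_measurable borel" and v0: "\<And>x. 0 \<le> v x"
    and lim: "\<And>A. A \<in> sets borel \<Longrightarrow> (\<lambda>n. LINT x|M. indicator A x * u n x) \<longlonglongrightarrow> (LINT x|M. indicator A x * v x)"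
    and g [measurable]: "g \<in> borel_measurable borel" "integrable M (\<lambda>x. \<bar>g x\<bar> powr (p / (p - 1)))"
  shows "(\<lambda>n. LINT x|M. u n x * g x) \<longlonglongrightarrow> (LINT x|M. v x * g x)"
proof (rule metric_LIMSEQ_I)
  fix e :: real assume e: "0 < e"
  define q where "q = p / (p - 1)"
  have q: "0 < q" using p by (simp add: q_def)
  have Lpv: "(\<integral>\<^sup>+x. ennreal (v x powr p) \<partial>M) \<le> ennreal C"
    by (rule limit_in_Lp[OF v vm v0 lim])
  have ivp: "integrable M (\<lambda>x. v x powr p)"
    by (rule integrableI_nonneg) (auto intro: le_less_trans[OF Lpv])
  have vC: "(LINT x|M. v x powr p) \<le> C"
    using Lpv C by (subst (asm) nn_integral_eq_integral[OF ivp]) (auto simp: ennreal_le_iff)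
  \<comment> \<open>This makes d * C smaller than e / 6; the other e / 6 of the allowance e / 3 is
    left to the approximation of g by a simple function.\<close>
  define d where "d = e / (6 * (C + 1))"
  have d: "0 < d" "d * C < e / 3 / 2 + 0" using e C by (auto simp: d_def field_simps)
  obtain K where K: "0 \<le> K" "\<And>a b. 0 \<le> a \<Longrightarrow> 0 \<le> b \<Longrightarrow> a * b \<le> d * a powr p + K * b powr q"
    using Young_with_epsilon[OF p d(1)] by (auto simp: q_def)
  obtain s where s: "\<And>i. simple_function M (s i)" "\<And>x. (\<lambda>i. s i x) \<longlonglongrightarrow> g x" "\<And>i x. \<bar>s i x\<bar> \<le> 2 * \<bar>g x\<bar>"
    using borel_measurable_implies_sequence_metric[of g M 0] g(1) by (auto simp: measurable_cong_sets[OF sets_M])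
  have sm [measurable]: "s i \<in> borel_measurable borel" for i
    using borel_measurable_simple_function[OF s(1)] by (simp add: measurable_cong_sets[OF sets_M])
  \<comment> \<open>The approximants satisfy |s| <= 2 |g|, hence |g - s| <= 3 |g|; a single majorant
    with the constant 3 covers both s and g - s.\<close>
  have gq: "integrable M (\<lambda>x. 3 powr q * \<bar>g x\<bar> powr q)"
    using g(2) by (simp add: q_def)
  have gsb: "\<bar>g x - s i x\<bar> powr q \<le> 3 powr q * \<bar>g x\<bar> powr q" for i x
  proof -
    have "\<bar>g x - s i x\<bar> \<le> 3 * \<bar>g x\<bar>" using s(3)[of i x] by linarith
    then have "\<bar>g x - s i x\<bar> powr q \<le> (3 * \<bar>g x\<bar>) powr q" using q by (intro powr_mono2) auto
    then show ?thesis by (simp add: powr_mult)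
  qed
  have sb: "\<bar>s i x\<bar> powr q \<le> 3 powr q * \<bar>g x\<bar> powr q" for i x
  proof -
    have "\<bar>s i x\<bar> \<le> 3 * \<bar>g x\<bar>" using s(3)[of i x] by linarith
    then have "\<bar>s i x\<bar> powr q \<le> (3 * \<bar>g x\<bar>) powr q" using q by (intro powr_mono2) auto
    then show ?thesis by (simp add: powr_mult)
  qed
  have gsi: "integrable M (\<lambda>x. \<bar>g x - s i x\<bar> powr q)" for i
    by (rule Bochner_Integration.integrable_bound[OF gq]) (use gsb in \<open>auto simp: measurable_cong_sets[OF sets_M]\<close>)
  have si: "integrable M (\<lambda>x. \<bar>s i x\<bar> powr q)" for i
    by (rule Bochner_Integration.integrable_bound[OF gq]) (use sb in \<open>auto simp: measurable_cong_sets[OF sets_M]\<close>)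
  have "(\<lambda>i. LINT x|M. \<bar>g x - s i x\<bar> powr q) \<longlonglongrightarrow> (LINT x|M. 0)"
  proof (rule integral_dominated_convergence[OF _ _ gq])
    show "AE x in M. (\<lambda>i. \<bar>g x - s i x\<bar> powr q) \<longlonglongrightarrow> 0"
    proof (rule AE_I2)
      fix x
      have "(\<lambda>i. \<bar>g x - s i x\<bar>) \<longlonglongrightarrow> \<bar>g x - g x\<bar>"
        by (intro tendsto_rabs tendsto_diff tendsto_const s)
      then have "(\<lambda>i. \<bar>g x - s i x\<bar> powr q) \<longlonglongrightarrow> 0 powr q"
        using q by (intro tendsto_powr2[where b=q]) auto
      then show "(\<lambda>i. \<bar>g x - s i x\<bar> powr q) \<longlonglongrightarrow> 0" by simp
    qed
  qed (use gsb in \<open>auto simp: measurable_cong_sets[OF sets_M]\<close>)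
  then have "(\<lambda>i. K * (LINT x|M. \<bar>g x - s i x\<bar> powr q)) \<longlonglongrightarrow> K * 0"
    by (intro tendsto_mult tendsto_const) simp
  then have "eventually (\<lambda>i. K * (LINT x|M. \<bar>g x - s i x\<bar> powr q) < e / 6) sequentially"
    using e by (intro order_tendstoD) auto
  then obtain i where i: "K * (LINT x|M. \<bar>g x - s i x\<bar> powr q) < e / 6"
    by (auto simp: eventually_sequentially)
  have near: "\<bar>(LINT x|M. f x * g x) - (LINT x|M. f x * s i x)\<bar> < e / 3"
    if "f \<in> borel_measurable borel" "\<And>x. 0 \<le> f x" "integrable M (\<lambda>x. f x powr p)" "(LINT x|M. f x powr p) \<le> C" for f
  proof -
    have "\<bar>(LINT x|M. f x * g x) - (LINT x|M. f x * s i x)\<bar> \<le> d * C + K * (LINT x|M. \<bar>g x - s i x\<bar> powr q)"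
      unfolding q_def
      by (rule abs_integral_mult_diff_le[OF that g sm si[unfolded q_def] gsi[unfolded q_def] less_imp_le[OF d(1)]])
        (rule K(2)[unfolded q_def])
    then show ?thesis using i d(2) by linarith
  qed
  have "(\<lambda>n. LINT x|M. u n x * s i x) \<longlonglongrightarrow> (LINT x|M. v x * s i x)"
    by (subst (1 2) mult.commute) (rule simple_function_limit[OF v lim s(1)])
  from metric_LIMSEQ_D[OF this, of "e / 3"]
  obtain N where N: "\<And>n. N \<le> n \<Longrightarrow> dist (LINT x|M. u n x * s i x) (LINT x|M. v x * s i x) < e / 3"
    using e by auto
  have "dist (LINT x|M. u n x * g x) (LINT x|M. v x * g x) < e" if "N \<le> n" for n
    using N[OF that] near[OF u_borel nn integrable_u_powr integral_u_powr_le, of n] near[OF vm v0 ivp vC]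
    unfolding dist_real_def by linarith
  then show "\<exists>N. \<forall>n\<ge>N. dist (LINT x|M. u n x * g x) (LINT x|M. v x * g x) < e" by blast
qed

end

section \<open>Weak compactness for vector-valued sequences\<close>

lemma powr_sum_le:
  fixes a :: "'i \<Rightarrow> real"
  assumes "finite I" "\<And>i. i \<in> I \<Longrightarrow> 0 \<le> a i" "0 \<le> p"
  shows "(\<Sum>i\<in>I. a i) powr p \<le> real (card I) powr p * (\<Sum>i\<in>I. a i powr p)"
proof (cases "I = {}")
  case False
  define m where "m = Max (a ` I)"
  have "m \<in> a ` I" using False assms(1) by (simp add: m_def)
  then obtain j where j: "j \<in> I" "m = a j" by auto
  have "(\<Sum>i\<in>I. a i) \<le> (\<Sum>i\<in>I. m)"
    using assms(1) by (intro sum_mono) (simp add: m_def)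
  then have "(\<Sum>i\<in>I. a i) powr p \<le> (real (card I) * m) powr p"
    using assms by (intro powr_mono2 sum_nonneg) auto
  also have "\<dots> = real (card I) powr p * a j powr p"
    using j assms by (simp add: powr_mult)
  also have "\<dots> \<le> real (card I) powr p * (\<Sum>i\<in>I. a i powr p)"
    using j assms by (intro mult_left_mono member_le_sum) auto
  finally show ?thesis .
qed simp

lemma borel_measurable_vec_nth [measurable]:
  fixes f :: "'a \<Rightarrow> real^'m"
  assumes "f \<in> borel_measurable M"
  shows "(\<lambda>x. f x $ i) \<in> borel_measurable M"
proof -
  have "(\<lambda>x. f x \<bullet> axis i 1) \<in> borel_measurable M"
    using assms by simp
  then show ?thesis by (simp add: inner_axis)
qed

lemma borel_measurable_vec_lambda:
  fixes f :: "'m::finite \<Rightarrow> 'a \<Rightarrow> real"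
  assumes "\<And>i. f i \<in> borel_measurable M"
  shows "(\<lambda>x. \<chi> i. f i x) \<in> borel_measurable M"
  unfolding borel_measurable_euclidean_space[where 'c="real^'m"]
  using assms by (auto simp: Basis_vec_def inner_axis)

text \<open>Each component is split into its positive and negative part, which gives finitely many
  nonnegative scalar sequences. A common subsequence is extracted for all of them before any limit
  density is formed, and the limit field is assembled from differences of the densities.\<close>

theorem weakly_convergent_subsequence:
  fixes M :: "'a::second_countable_topology measure" and F :: "nat \<Rightarrow> 'a \<Rightarrow> real^'m"
  assumes M: "finite_measure M" "sets M = sets borel" and p: "1 < p" and C: "0 \<le> C"
    and F [measurable]: "\<And>n. F n \<in> borel_measurable borel"
    and Lp: "\<And>n. (\<integral>\<^sup>+x. ennreal (norm (F n x) powr p) \<partial>M) \<le> ennreal C"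
  shows "\<exists>r G. strict_mono r \<and> G \<in> borel_measurable borel \<and> integrable M (\<lambda>x. norm (G x) powr p) \<and>
    (\<forall>g. g \<in> borel_measurable borel \<and> integrable M (\<lambda>x. norm (g x) powr (p / (p - 1))) \<longrightarrow>
      (\<lambda>n. LINT x|M. F (r n) x \<bullet> g x) \<longlonglongrightarrow> (LINT x|M. G x \<bullet> g x))"
proof -
  define sg :: "bool \<Rightarrow> real" where "sg b = (if b then 1 else - 1)" for b
  define u where "u = (\<lambda>(i, b) n x. max 0 (sg b * F n x $ i))"
  have bl: "Lp_bounded_seq M (\<lambda>n. u c (r n)) p C" for c :: "'m \<times> bool" and r
  proof -
    obtain i b where c: "c = (i, b)" by (cases c)
    have le: "u c n x \<le> norm (F n x)" for n x
      using component_le_norm_cart[of "F n x" i] by (auto simp: u_def c sg_def)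
    have "Lp_bounded_seq_axioms M (\<lambda>n. u c (r n)) p C"
    proof
      show "u c (r n) \<in> borel_measurable borel" for n
        unfolding u_def c by simp
      show "0 \<le> u c (r n) x" for n x
        by (simp add: u_def c)
      have "(\<integral>\<^sup>+x. ennreal (u c (r n) x powr p) \<partial>M) \<le> (\<integral>\<^sup>+x. ennreal (norm (F (r n) x) powr p) \<partial>M)" for n
        using p le \<open>\<And>x n. 0 \<le> u c (r n) x\<close> by (intro nn_integral_mono ennreal_leI powr_mono2) auto
      then show "(\<integral>\<^sup>+x. ennreal (u c (r n) x powr p) \<partial>M) \<le> ennreal C" for n
        by (rule order_trans[OF _ Lp])
    qed (use M p C in auto)
    then show ?thesis
      using M(1) by (simp add: Lp_bounded_seq_def)
  qed
  obtain \<A> :: "'a set set" where A: "countable \<A>" "Int_stable \<A>" "sets borel = sigma_sets UNIV \<A>" "UNIV \<in> \<A>"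
    using ex_countable_Int_stable_generator by blast
  have \<A>b: "X \<in> sets borel" if "X \<in> \<A>" for X
    unfolding A(3) using that by (rule sigma_sets.Basic)
  \<comment> \<open>The equi-integrability bound at height l = 1, with the set enlarged to the whole
    space.\<close>
  define B where "B = measure M UNIV + 1 powr (1 - p) * C"
  have bound: "norm (LINT x|M. indicator (snd cX) x * u (fst cX) n x) \<le> B" if "cX \<in> UNIV \<times> \<A>" for cX n
  proof -
    interpret Lp_bounded_seq M "\<lambda>n. u (fst cX) (id n)" p C by (rule bl)
    have X: "snd cX \<in> sets borel" using that \<A>b by auto
    have "measure M (snd cX) \<le> measure M UNIV"
      using X M(2) by (intro finite_measure_mono) auto
    then show ?thesis
      using integral_indicator_le[OF X zero_less_one, of n] integral_indicator_nonneg[of "snd cX" n] by (simp add: B_def)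
  qed
  \<comment> \<open>Cantor's diagonal argument over the countable set of pairs of a signed component
    and a generating set; boundedness by B is all it asks of the numerical sequences.\<close>
  obtain r where r: "strict_mono (r :: nat \<Rightarrow> nat)"
    "\<And>cX. cX \<in> UNIV \<times> \<A> \<Longrightarrow> \<exists>l. (\<lambda>n. LINT x|M. indicator (snd cX) x * u (fst cX) (r n) x) \<longlonglongrightarrow> l"
  proof (rule function_convergent_subsequence[of "UNIV \<times> \<A>" "\<lambda>n cX. LINT x|M. indicator (snd cX) x * u (fst cX) n x" B])
    show "countable ((UNIV :: ('m \<times> bool) set) \<times> \<A>)"
      using A(1) by (intro countable_SIGMA) auto
  next
    fix k assume k: "strict_mono (k :: nat \<Rightarrow> nat)" "\<And>x. x \<in> UNIV \<times> \<A> \<Longrightarrow> \<exists>l. (\<lambda>n. LINT xa|M. indicator (snd x) xa * u (fst x) (k n) xa) \<longlonglongrightarrow> l"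
    show thesis by (rule that[OF k])
  qed (rule bound)
  have "\<exists>v. v \<in> borel_measurable borel \<and> (\<forall>x. 0 \<le> v x) \<and> integrable M v \<and>
    (\<forall>X\<in>sets borel. (\<lambda>n. LINT x|M. indicator X x * u c (r n) x) \<longlonglongrightarrow> (LINT x|M. indicator X x * v x))" for c
  proof -
    interpret Lp_bounded_seq M "\<lambda>n. u c (r n)" p C by (rule bl)
    have "convergent (\<lambda>n. LINT x|M. indicator X x * u c (r n) x)" if "X \<in> sets borel" for X
    proof (rule convergent_on_borel[OF A(2-4) _ that])
      fix Y assume "Y \<in> \<A>"
      then show "convergent (\<lambda>n. LINT x|M. indicator Y x * u c (r n) x)"
        using r(2)[of "(c, Y)"] by (simp add: convergent_def)
    qed
    then show ?thesis by (rule ex_limit_density)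
  qed
  then have "\<forall>c. \<exists>v. v \<in> borel_measurable borel \<and> (\<forall>x. 0 \<le> v x) \<and> integrable M v \<and>
    (\<forall>X\<in>sets borel. (\<lambda>n. LINT x|M. indicator X x * u c (r n) x) \<longlonglongrightarrow> (LINT x|M. indicator X x * v x))"
    by (rule allI)
  from choice[OF this] obtain v where v0: "\<forall>c. v c \<in> borel_measurable borel \<and> (\<forall>x. 0 \<le> v c x) \<and> integrable M (v c) \<and>
    (\<forall>X\<in>sets borel. (\<lambda>n. LINT x|M. indicator X x * u c (r n) x) \<longlonglongrightarrow> (LINT x|M. indicator X x * v c x))"
    by (rule exE)
  have v: "\<And>c. v c \<in> borel_measurable borel" "\<And>c x. 0 \<le> v c x" "\<And>c. integrable M (v c)"
    "\<And>c X. X \<in> sets borel \<Longrightarrow> (\<lambda>n. LINT x|M. indicator X x * u c (r n) x) \<longlonglongrightarrow> (LINT x|M. indicator X x * v c x)"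
    using spec[OF v0] by blast+
  have vp: "integrable M (\<lambda>x. v c x powr p)" for c
  proof -
    interpret Lp_bounded_seq M "\<lambda>n. u c (r n)" p C by (rule bl)
    have "(\<integral>\<^sup>+x. ennreal (v c x powr p) \<partial>M) \<le> ennreal C"
      by (rule limit_in_Lp[OF v(3,1,2,4)])
    then show ?thesis
      using v(1) by (intro integrableI_nonneg) (auto intro: le_less_trans)
  qed
  define G :: "'a \<Rightarrow> real^'m" where "G x = (\<chi> i. v (i, True) x - v (i, False) x)" for x
  have Gm: "G \<in> borel_measurable borel"
    unfolding G_def using v(1) by (intro borel_measurable_vec_lambda) simp
  have "integrable M (\<lambda>x. norm (G x) powr p)"
  proof (rule Bochner_Integration.integrable_bound)
    let ?K = "real (card (UNIV :: ('m \<times> bool) set)) powr p"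
    show "integrable M (\<lambda>x. ?K * (\<Sum>c\<in>UNIV. v c x powr p))"
      using vp by simp
    show "(\<lambda>x. norm (G x) powr p) \<in> borel_measurable M"
      using Gm by (simp add: measurable_cong_sets[OF M(2)])
    show "AE x in M. norm (norm (G x) powr p) \<le> norm (?K * (\<Sum>c\<in>UNIV. v c x powr p))"
    proof (rule AE_I2)
      fix x
      have "norm (G x) \<le> (\<Sum>i\<in>UNIV. \<bar>G x $ i\<bar>)" by (rule norm_le_l1_cart)
      also have "\<dots> \<le> (\<Sum>i\<in>UNIV. \<Sum>b\<in>UNIV. v (i, b) x)"
        using v(2) by (intro sum_mono) (simp add: G_def UNIV_bool abs_le_iff add_increasing2)
      also have "\<dots> = (\<Sum>c\<in>UNIV. v c x)"
        by (simp add: sum.cartesian_product)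
      finally have "norm (G x) powr p \<le> (\<Sum>c\<in>UNIV. v c x) powr p"
        using p by (intro powr_mono2) auto
      also have "\<dots> \<le> ?K * (\<Sum>c\<in>UNIV. v c x powr p)"
        using p v(2) by (intro powr_sum_le) auto
      finally show "norm (norm (G x) powr p) \<le> norm (?K * (\<Sum>c\<in>UNIV. v c x powr p))"
        by simp
    qed
  qed
  moreover have "(\<lambda>n. LINT x|M. F (r n) x \<bullet> g x) \<longlonglongrightarrow> (LINT x|M. G x \<bullet> g x)"
    if g [measurable]: "g \<in> borel_measurable borel" "integrable M (\<lambda>x. norm (g x) powr (p / (p - 1)))" for g
  proof -
    have q: "0 < p / (p - 1)" using p by simp
    have gi: "(\<lambda>x. g x $ i) \<in> borel_measurable borel" for i by measurable
    have giq: "integrable M (\<lambda>x. \<bar>g x $ i\<bar> powr (p / (p - 1)))" for i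
    proof (rule Bochner_Integration.integrable_bound[OF g(2)])
      show "(\<lambda>x. \<bar>g x $ i\<bar> powr (p / (p - 1))) \<in> borel_measurable M"
        using gi by (simp add: measurable_cong_sets[OF M(2)])
      show "AE x in M. norm (\<bar>g x $ i\<bar> powr (p / (p - 1))) \<le> norm (norm (g x) powr (p / (p - 1)))"
        using q by (auto intro!: powr_mono2 component_le_norm_cart)
    qed
    have iu: "integrable M (\<lambda>x. u c (r n) x * g x $ i)" for c n i
    proof -
      interpret Lp_bounded_seq M "\<lambda>n. u c (r n)" p C by (rule bl)
      show ?thesis by (rule integrable_mult_Lq[OF u_borel nn integrable_u_powr gi giq])
    qed
    have iv: "integrable M (\<lambda>x. v c x * g x $ i)" for c i
    proof -
      interpret Lp_bounded_seq M "\<lambda>n. u c (r n)" p C by (rule bl)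
      show ?thesis by (rule integrable_mult_Lq[OF v(1,2) vp gi giq])
    qed
    have lim: "(\<lambda>n. LINT x|M. u c (r n) x * g x $ i) \<longlonglongrightarrow> (LINT x|M. v c x * g x $ i)" for c i
    proof -
      interpret Lp_bounded_seq M "\<lambda>n. u c (r n)" p C by (rule bl)
      show ?thesis by (rule Lq_limit[OF v(3,1,2,4) gi giq])
    qed
    have "F (r n) x $ i * y = u (i, True) (r n) x * y - u (i, False) (r n) x * y" for n x i y
      by (auto simp: u_def sg_def max_def algebra_simps)
    then have Fe: "F (r n) x \<bullet> g x = (\<Sum>i\<in>UNIV. u (i, True) (r n) x * g x $ i - u (i, False) (r n) x * g x $ i)" for n x
      by (simp add: inner_vec_def)
    have Ge: "G x \<bullet> g x = (\<Sum>i\<in>UNIV. v (i, True) x * g x $ i - v (i, False) x * g x $ i)" for x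
      by (simp add: inner_vec_def G_def left_diff_distrib)
    have "(LINT x|M. F (r n) x \<bullet> g x) = (\<Sum>i\<in>UNIV. (LINT x|M. u (i, True) (r n) x * g x $ i) - (LINT x|M. u (i, False) (r n) x * g x $ i))" for n
      unfolding Fe by (simp add: iu)
    moreover have "(LINT x|M. G x \<bullet> g x) = (\<Sum>i\<in>UNIV. (LINT x|M. v (i, True) x * g x $ i) - (LINT x|M. v (i, False) x * g x $ i))"
      unfolding Ge by (simp add: iv)
    ultimately show ?thesis
      by (simp only:) (intro tendsto_sum tendsto_diff lim)
  qed
  ultimately show ?thesis
    using r(1) Gm by blast
qed

section \<open>Convolution\<close>

text \<open>Boundedness and integrability together make convolutions exist at every point instead of
  almost every one. The class is closed under convolution, and associativity holds in it by
  Fubini.\<close>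

definition bdd_integrable :: "('a::euclidean_space \<Rightarrow> 'b::euclidean_space) \<Rightarrow> bool" where
  "bdd_integrable f \<longleftrightarrow> f \<in> borel_measurable borel \<and> integrable lborel f \<and> (\<exists>M. \<forall>z. norm (f z) \<le> M)"

definition conv :: "('a::euclidean_space \<Rightarrow> real) \<Rightarrow> ('a \<Rightarrow> 'b::euclidean_space) \<Rightarrow> 'a \<Rightarrow> 'b" where
  "conv k f z = (LBINT u. k u *\<^sub>R f (z - u))"

lemma bdd_integrableD:
  assumes "bdd_integrable f"
  shows "f \<in> borel_measurable borel" "integrable lborel f" "\<exists>M\<ge>0. \<forall>z. norm (f z) \<le> M"
proof -
  show "f \<in> borel_measurable borel" "integrable lborel f" using assms by (auto simp: bdd_integrable_def)
  obtain M where "\<And>z. norm (f z) \<le> M" using assms by (auto simp: bdd_integrable_def)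
  then show "\<exists>M\<ge>0. \<forall>z. norm (f z) \<le> M"
    using norm_ge_zero order_trans by blast
qed

lemma lborel_reflect: "(lborel :: 'a::euclidean_space measure) = distr lborel borel (\<lambda>u. z - u)"
  using lborel_affine[of "-1 :: real" z] by (simp add: density_1)

lemma
  fixes f :: "'a::euclidean_space \<Rightarrow> 'b::euclidean_space"
  assumes f [measurable]: "f \<in> borel_measurable borel"
  shows integrable_reflect: "integrable lborel (\<lambda>u. f (z - u)) \<longleftrightarrow> integrable lborel f"
    and integral_reflect: "(LBINT u. f (z - u)) = (LBINT u. f u)"
  by (subst (2) lborel_reflect[of z], simp add: integrable_distr_eq integral_distr)+

lemma conv_alt:
  assumes "bdd_integrable k" "bdd_integrable f"
  shows "conv k f z = (LBINT y. k (z - y) *\<^sub>R f y)"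
proof -
  note bdd_integrableD(1)[OF assms(1), measurable] bdd_integrableD(1)[OF assms(2), measurable]
  show ?thesis
    unfolding conv_def
    using integral_reflect[of "\<lambda>u. k (z - u) *\<^sub>R f u" z] by simp
qed

lemma conv_commute:
  assumes "bdd_integrable k" "bdd_integrable f"
  shows "conv k f z = conv f k z"
  unfolding conv_alt[OF assms] unfolding conv_def by (simp add: mult.commute)

lemma bdd_integrable_reflect: "bdd_integrable f \<Longrightarrow> bdd_integrable (\<lambda>u. f (z - u))"
proof -
  assume f: "bdd_integrable f"
  note bdd_integrableD(1)[OF f, measurable]
  show ?thesis
    using f bdd_integrableD(1)[OF f] unfolding bdd_integrable_def by (auto simp: integrable_reflect)
qed

lemma integrable_bounded_scaleR:
  fixes k :: "'a::euclidean_space \<Rightarrow> real" and f :: "'a \<Rightarrow> 'b::euclidean_space"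
  assumes k: "integrable lborel k" and f: "f \<in> borel_measurable borel" and M: "\<And>z. norm (f z) \<le> M"
  shows "integrable lborel (\<lambda>u. k u *\<^sub>R f u)"
proof (rule Bochner_Integration.integrable_bound)
  show "integrable lborel (\<lambda>u. M * k u)" using k by simp
  show "(\<lambda>u. k u *\<^sub>R f u) \<in> borel_measurable lborel" using k f by simp
  have "norm (k u *\<^sub>R f u) \<le> norm (M * k u)" for u
  proof -
    have "norm (k u *\<^sub>R f u) = \<bar>k u\<bar> * norm (f u)" by simp
    also have "\<dots> \<le> \<bar>k u\<bar> * M" by (intro mult_left_mono M) simp
    also have "\<dots> \<le> \<bar>k u\<bar> * \<bar>M\<bar>" by (intro mult_left_mono) auto
    finally show ?thesis by (simp add: abs_mult mult.commute)
  qed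
  then show "AE u in lborel. norm (k u *\<^sub>R f u) \<le> norm (M * k u)" by simp
qed

lemma integrable_conv_kernel:
  assumes "bdd_integrable k" "bdd_integrable f"
  shows "integrable lborel (\<lambda>u. k u *\<^sub>R f (z - u))"
proof -
  obtain M where "\<And>z. norm (f z) \<le> M" using bdd_integrableD(3)[OF assms(2)] by blast
  then show ?thesis
    using bdd_integrableD(1)[OF bdd_integrable_reflect[OF assms(2)]]
    by (intro integrable_bounded_scaleR[OF bdd_integrableD(2)[OF assms(1)]])
qed

lemma norm_conv_le:
  assumes k: "bdd_integrable k" and M: "\<And>z. norm (f z) \<le> M"
  shows "norm (conv k f z) \<le> M * (LBINT u. \<bar>k u\<bar>)"
proof (cases "integrable lborel (\<lambda>u. k u *\<^sub>R f (z - u))")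
  case True
  have "norm (conv k f z) \<le> (LBINT u. norm (k u *\<^sub>R f (z - u)))"
    unfolding conv_def by (rule integral_norm_bound)
  also have "\<dots> \<le> (LBINT u. M * \<bar>k u\<bar>)"
    using bdd_integrableD(2)[OF k] integrable_norm[OF True] M
    by (intro integral_mono) (auto simp: mult.commute[of M] intro!: mult_left_mono)
  finally show ?thesis by simp
next
  case False
  have "0 \<le> M" using M norm_ge_zero order_trans by blast
  then show ?thesis
    using False by (simp add: conv_def not_integrable_integral_eq)
qed

lemma integrable_pair_product:
  fixes f g :: "'a::euclidean_space \<Rightarrow> real"
  assumes "integrable lborel f" "integrable lborel g" "f \<in> borel_measurable borel" "g \<in> borel_measurable borel"
  shows "integrable (lborel \<Otimes>\<^sub>M lborel) (\<lambda>(x, y). f x * g y)"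
proof (rule lborel_pair.Fubini_integrable)
  note assms(3,4)[measurable]
  show "(\<lambda>(x, y). f x * g y) \<in> borel_measurable (lborel \<Otimes>\<^sub>M lborel)" by measurable
  show "integrable lborel (\<lambda>x. LBINT y. norm (case (x, y) of (x, y) \<Rightarrow> f x * g y))"
    using assms by (simp add: abs_mult)
  show "AE x in lborel. integrable lborel (\<lambda>y. case (x, y) of (x, y) \<Rightarrow> f x * g y)"
    using assms by simp
qed

lemma integrable_pair_bound:
  fixes f g :: "'a::euclidean_space \<Rightarrow> real" and H :: "'a \<times> 'a \<Rightarrow> 'b::euclidean_space"
  assumes "integrable lborel f" "integrable lborel g" "f \<in> borel_measurable borel" "g \<in> borel_measurable borel"
    and H: "H \<in> borel_measurable (borel \<Otimes>\<^sub>M borel)" and le: "\<And>x y. norm (H (x, y)) \<le> f x * g y"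
  shows "integrable (lborel \<Otimes>\<^sub>M lborel) H"
proof (rule Bochner_Integration.integrable_bound[OF integrable_pair_product[OF assms(1-4)]])
  show "H \<in> borel_measurable (lborel \<Otimes>\<^sub>M lborel)"
    using H by (simp cong: measurable_cong_sets)
  show "AE p in lborel \<Otimes>\<^sub>M lborel. norm (H p) \<le> norm (case p of (x, y) \<Rightarrow> f x * g y)"
    using le order_trans[OF le abs_ge_self] by (auto simp: split_beta')
qed

lemma conv_borel:
  assumes "bdd_integrable k" "bdd_integrable f"
  shows "conv k f \<in> borel_measurable borel"
proof -
  note bdd_integrableD(1)[OF assms(1), measurable] bdd_integrableD(1)[OF assms(2), measurable]
  have "(\<lambda>(z, u). k u *\<^sub>R f (z - u)) \<in> borel_measurable (borel \<Otimes>\<^sub>M lborel)" by measurable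
  then have "(\<lambda>z. LBINT u. k u *\<^sub>R f (z - u)) \<in> borel_measurable borel"
    by (rule lborel.borel_measurable_lebesgue_integral)
  then show ?thesis by (simp add: conv_def[abs_def])
qed

lemma lborel_shift: "(lborel :: 'a::euclidean_space measure) = distr lborel borel (\<lambda>z. z - u)"
  using lborel_affine[of "1 :: real" "- u"] by (simp add: density_1)

lemma
  fixes f :: "'a::euclidean_space \<Rightarrow> 'b::euclidean_space"
  assumes f [measurable]: "f \<in> borel_measurable borel"
  shows integrable_shift: "integrable lborel (\<lambda>z. f (z - u)) \<longleftrightarrow> integrable lborel f"
    and integral_shift: "(LBINT z. f (z - u)) = (LBINT z. f z)"
  by (subst (2) lborel_shift[of u], simp add: integrable_distr_eq integral_distr)+

text \<open>In the variables u and z - u the majorant is a product of integrable functions, and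
  Lebesgue measure is translation invariant. This justifies Fubini for the integrability and the
  associativity of convolutions.\<close>

lemma integrable_pair_shift_bound:
  fixes f g :: "'a::euclidean_space \<Rightarrow> real" and H :: "'a \<times> 'a \<Rightarrow> 'b::euclidean_space"
  assumes f: "integrable lborel f" "f \<in> borel_measurable borel"
    and g: "integrable lborel g" "g \<in> borel_measurable borel"
    and H: "H \<in> borel_measurable (borel \<Otimes>\<^sub>M borel)" and le: "\<And>u z. norm (H (u, z)) \<le> f u * g (z - u)"
  shows "integrable (lborel \<Otimes>\<^sub>M lborel) H"
proof -
  note f(2)[measurable] g(2)[measurable]
  have "integrable (lborel \<Otimes>\<^sub>M lborel) (\<lambda>(u, z). f u * g (z - u))"
  proof (rule lborel_pair.Fubini_integrable)
    show "(\<lambda>(u, z). f u * g (z - u)) \<in> borel_measurable (lborel \<Otimes>\<^sub>M lborel)" by measurable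
    show "AE u in lborel. integrable lborel (\<lambda>z. case (u, z) of (u, z) \<Rightarrow> f u * g (z - u))"
      using g by (simp add: integrable_shift)
    have "(LBINT z. norm (case (u, z) of (u, z) \<Rightarrow> f u * g (z - u))) = \<bar>f u\<bar> * (LBINT z. \<bar>g z\<bar>)" for u
      using integral_shift[of "\<lambda>z. \<bar>g z\<bar>" u] by (simp add: abs_mult)
    then show "integrable lborel (\<lambda>u. LBINT z. norm (case (u, z) of (u, z) \<Rightarrow> f u * g (z - u)))"
      using f by simp
  qed
  then show ?thesis
  proof (rule Bochner_Integration.integrable_bound)
    show "H \<in> borel_measurable (lborel \<Otimes>\<^sub>M lborel)"
      using H by (simp cong: measurable_cong_sets)
    show "AE p in lborel \<Otimes>\<^sub>M lborel. norm (H p) \<le> norm (case p of (u, z) \<Rightarrow> f u * g (z - u))"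
      using order_trans[OF le abs_ge_self] by (auto simp: split_beta')
  qed
qed

lemma bdd_integrable_conv:
  assumes "bdd_integrable k" "bdd_integrable f"
  shows "bdd_integrable (conv k f)"
proof -
  note bdd_integrableD(1)[OF assms(1), measurable] bdd_integrableD(1)[OF assms(2), measurable]
  have "integrable (lborel \<Otimes>\<^sub>M lborel) (\<lambda>(u, z). k u *\<^sub>R f (z - u))"
  proof (rule integrable_pair_shift_bound[where f="\<lambda>u. \<bar>k u\<bar>" and g="\<lambda>z. norm (f z)"])
    show "(\<lambda>(u, z). k u *\<^sub>R f (z - u)) \<in> borel_measurable (borel \<Otimes>\<^sub>M borel)" by measurable
  qed (use bdd_integrableD(2)[OF assms(1)] bdd_integrableD(2)[OF assms(2)] in auto)
  then have "integrable lborel (\<lambda>z. LBINT u. k u *\<^sub>R f (z - u))"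
    by (rule lborel_pair.integrable_snd)
  then have "integrable lborel (conv k f)" by (simp add: conv_def[abs_def])
  moreover obtain M where "\<And>z. norm (f z) \<le> M" using bdd_integrableD(3)[OF assms(2)] by blast
  ultimately show ?thesis
    using conv_borel[OF assms] norm_conv_le[OF assms(1)] unfolding bdd_integrable_def by blast
qed

lemma conv_assoc:
  assumes a: "bdd_integrable a" and b: "bdd_integrable b" and f: "bdd_integrable f"
  shows "conv a (conv b f) z = conv (conv a b) f z"
proof -
  note bdd_integrableD(1)[OF a, measurable] bdd_integrableD(1)[OF b, measurable] bdd_integrableD(1)[OF f, measurable]
  obtain M where M: "\<And>z. norm (f z) \<le> M" using bdd_integrableD(3)[OF f] by blast
  have "conv b f (z - u) = (LBINT v. b (v - u) *\<^sub>R f (z - v))" for u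
    using integral_shift[of "\<lambda>v. b v *\<^sub>R f (z - u - v)" u] by (simp add: conv_def)
  then have "conv a (conv b f) z = (LBINT u. LBINT v. (a u * b (v - u)) *\<^sub>R f (z - v))"
    by (simp add: conv_def[of a] flip: scaleR_scaleR)
  also have "\<dots> = (LBINT v. LBINT u. (a u * b (v - u)) *\<^sub>R f (z - v))"
  proof (rule lborel_pair.Fubini_integral[symmetric], rule integrable_pair_shift_bound[where f="\<lambda>u. \<bar>a u\<bar>" and g="\<lambda>v. \<bar>b v\<bar> * M"])
    show "(\<lambda>(u, v). (a u * b (v - u)) *\<^sub>R f (z - v)) \<in> borel_measurable (borel \<Otimes>\<^sub>M borel)" by measurable
    show "norm (case (u, v) of (u, v) \<Rightarrow> (a u * b (v - u)) *\<^sub>R f (z - v)) \<le> \<bar>a u\<bar> * (\<bar>b (v - u)\<bar> * M)" for u v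
      using M by (auto simp: abs_mult mult.assoc intro!: mult_left_mono)
  qed (use bdd_integrableD(2)[OF a] bdd_integrableD(2)[OF b] in auto)
  also have "\<dots> = conv (conv a b) f z"
    using integrable_conv_kernel[OF a b]
    by (simp add: conv_def[of "conv a b"] conv_def[of a b])
  finally show ?thesis .
qed

lemma conv_left_commute:
  assumes "bdd_integrable a" "bdd_integrable b" "bdd_integrable f"
  shows "conv a (conv b f) = conv b (conv a f)"
proof -
  have ab: "conv a b = conv b a" using conv_commute[OF assms(1,2)] by auto
  show ?thesis
  proof
    fix z
    show "conv a (conv b f) z = conv b (conv a f) z"
      unfolding conv_assoc[OF assms] conv_assoc[OF assms(2,1,3)] ab ..
  qed
qed

lemma bdd_integrable_diff: "bdd_integrable f \<Longrightarrow> bdd_integrable g \<Longrightarrow> bdd_integrable (\<lambda>z. f z - g z)"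
proof -
  assume f: "bdd_integrable f" and g: "bdd_integrable g"
  obtain M N where "\<And>z. norm (f z) \<le> M" "\<And>z. norm (g z) \<le> N"
    using bdd_integrableD(3)[OF f] bdd_integrableD(3)[OF g] by blast
  then have "norm (f z - g z) \<le> M + N" for z
    using norm_triangle_ineq4[of "f z" "g z"] add_mono order_trans by blast
  then show ?thesis
    using bdd_integrableD(1,2)[OF f] bdd_integrableD(1,2)[OF g] unfolding bdd_integrable_def by auto
qed

text \<open>Fubini in two directions. The first form averages pairings with translates of f, which
  makes the centres y of the flux estimate visible. The second moves the kernel from f to G, so that
  the smoothing acts on the merely integrable field.\<close>

lemma conv_pairing:
  fixes G :: "'a::euclidean_space \<Rightarrow> 'b::euclidean_space"
  assumes G: "integrable lborel G" "G \<in> borel_measurable borel" and k: "bdd_integrable k" and f: "bdd_integrable f"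
  shows "(LBINT z. G z \<bullet> conv k f z) = (LBINT y. k y * (LBINT z. G z \<bullet> f (z - y)))"
    and "(LBINT z. G z \<bullet> conv k f z) = (LBINT y. (LBINT z. k (z - y) *\<^sub>R G z) \<bullet> f y)"
proof -
  note bdd_integrableD(1)[OF k, measurable] bdd_integrableD(1)[OF f, measurable] G(2)[measurable]
  obtain M where M: "\<And>z. norm (f z) \<le> M" using bdd_integrableD(3)[OF f] by blast
  obtain N where N: "\<And>z. norm (k z) \<le> N" using bdd_integrableD(3)[OF k] by blast
  have "(LBINT z. G z \<bullet> conv k f z) = (LBINT z. LBINT y. k y * (G z \<bullet> f (z - y)))"
    unfolding conv_def
    by (rule Bochner_Integration.integral_cong[OF refl])
      (subst integral_inner_right[symmetric, OF integrable_conv_kernel[OF k f]], simp)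
  also have "\<dots> = (LBINT y. LBINT z. k y * (G z \<bullet> f (z - y)))"
  proof (rule lborel_pair.Fubini_integral[symmetric], rule integrable_pair_bound[where f="\<lambda>z. norm (G z)" and g="\<lambda>y. \<bar>k y\<bar> * M"])
    show "(\<lambda>(z, y). k y * (G z \<bullet> f (z - y))) \<in> borel_measurable (borel \<Otimes>\<^sub>M borel)" by measurable
    fix z y
    have "\<bar>G z \<bullet> f (z - y)\<bar> \<le> norm (G z) * M"
      using Cauchy_Schwarz_ineq2 M mult_left_mono norm_ge_zero order_trans by metis
    then show "norm (case (z, y) of (z, y) \<Rightarrow> k y * (G z \<bullet> f (z - y))) \<le> norm (G z) * (\<bar>k y\<bar> * M)"
      using mult_left_mono[of _ _ "\<bar>k y\<bar>"] by (fastforce simp: abs_mult mult_ac)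
  qed (use G bdd_integrableD(2)[OF k] in auto)
  finally show "(LBINT z. G z \<bullet> conv k f z) = (LBINT y. k y * (LBINT z. G z \<bullet> f (z - y)))"
    by simp
  have ky: "integrable lborel (\<lambda>y. k (z - y) *\<^sub>R f y)" for z
    using bdd_integrableD(1,2)[OF bdd_integrable_reflect[OF k]] M by (intro integrable_bounded_scaleR) auto
  have "(LBINT z. G z \<bullet> conv k f z) = (LBINT z. LBINT y. k (z - y) * (G z \<bullet> f y))"
    unfolding conv_alt[OF k f]
    by (rule Bochner_Integration.integral_cong[OF refl])
      (subst integral_inner_right[symmetric, OF ky], simp)
  also have "\<dots> = (LBINT y. LBINT z. k (z - y) * (G z \<bullet> f y))"
  proof (rule lborel_pair.Fubini_integral[symmetric], rule integrable_pair_bound[where f="\<lambda>z. norm (G z)" and g="\<lambda>y. N * norm (f y)"])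
    show "(\<lambda>(z, y). k (z - y) * (G z \<bullet> f y)) \<in> borel_measurable (borel \<Otimes>\<^sub>M borel)" by measurable
    fix z y
    have "\<bar>k (z - y)\<bar> * \<bar>G z \<bullet> f y\<bar> \<le> N * (norm (G z) * norm (f y))"
      using N[of "z - y"] Cauchy_Schwarz_ineq2[of "G z" "f y"] by (intro mult_mono) auto
    then show "norm (case (z, y) of (z, y) \<Rightarrow> k (z - y) * (G z \<bullet> f y)) \<le> norm (G z) * (N * norm (f y))"
      by (simp add: abs_mult mult_ac)
  qed (use G bdd_integrableD(2)[OF f] in auto)
  also have "\<dots> = (LBINT y. (LBINT z. k (z - y) *\<^sub>R G z) \<bullet> f y)"
  proof (rule Bochner_Integration.integral_cong[OF refl])
    fix y
    have "integrable lborel (\<lambda>z. k (z - y) *\<^sub>R G z)"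
    proof (rule Bochner_Integration.integrable_bound)
      show "integrable lborel (\<lambda>z. N * norm (G z))" using G by simp
      show "AE z in lborel. norm (k (z - y) *\<^sub>R G z) \<le> norm (N * norm (G z))"
        using order_trans[OF N abs_ge_self] by (auto simp: abs_mult intro!: mult_right_mono)
    qed simp
    from integral_inner_left[OF this, of "f y"]
    show "(LBINT z. k (z - y) * (G z \<bullet> f y)) = (LBINT z. k (z - y) *\<^sub>R G z) \<bullet> f y" by simp
  qed
  finally show "(LBINT z. G z \<bullet> conv k f z) = (LBINT y. (LBINT z. k (z - y) *\<^sub>R G z) \<bullet> f y)" .
qed

section \<open>Gradients of convolutions\<close>

lemma gradient_bound_lipschitz:
  fixes f :: "'a::euclidean_space \<Rightarrow> real" and f' :: "'a \<Rightarrow> 'a"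
  assumes der: "\<And>z. (f has_derivative (\<lambda>h. f' z \<bullet> h)) (at z)" and L: "\<And>z. norm (f' z) \<le> L"
  shows "\<bar>f x - f y\<bar> \<le> L * dist x y"
proof -
  have "norm (f x - f y) \<le> L * norm (x - y)"
  proof (rule differentiable_bound[of UNIV f "\<lambda>z h. f' z \<bullet> h"])
    show "onorm (\<lambda>h. f' z \<bullet> h) \<le> L" for z
    proof (rule onorm_le)
      fix h
      have "norm (f' z \<bullet> h) \<le> norm (f' z) * norm h"
        using Cauchy_Schwarz_ineq2[of "f' z" h] by simp
      also have "\<dots> \<le> L * norm h" by (intro mult_right_mono L) simp
      finally show "norm (f' z \<bullet> h) \<le> L * norm h" .
    qed
  qed (use der in auto)
  then show ?thesis by (simp add: dist_norm)
qed

text \<open>Differentiation under the integral sign, dominated by means of the Lipschitz bound for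
  f. Increments 1 / (n + 1) are enough, because the limit only has to be identified, not shown to be
  a full derivative.\<close>

lemma conv_difference_quotient:
  fixes f :: "'a::euclidean_space \<Rightarrow> real" and f' :: "'a \<Rightarrow> 'a"
  assumes k: "bdd_integrable k" and f: "bdd_integrable f" and f': "bdd_integrable f'"
    and der: "\<And>z. (f has_derivative (\<lambda>h. f' z \<bullet> h)) (at z)"
  shows "(\<lambda>n. real (Suc n) * (conv k f (z + e /\<^sub>R real (Suc n)) - conv k f z)) \<longlonglongrightarrow> conv k f' z \<bullet> e"
proof -
  note bdd_integrableD(1)[OF k, measurable] bdd_integrableD(1)[OF f, measurable] bdd_integrableD(1)[OF f', measurable]
  obtain L where L: "0 \<le> L" "\<And>z. norm (f' z) \<le> L" using bdd_integrableD(3)[OF f'] by blast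
  have lip: "\<bar>f x - f y\<bar> \<le> L * norm (x - y)" for x y
    using gradient_bound_lipschitz[OF der L(2)] by (simp add: dist_norm)
  let ?t = "\<lambda>n. e /\<^sub>R real (Suc n)"
  let ?q = "\<lambda>n u. k u * (real (Suc n) * (f (z + ?t n - u) - f (z - u)))"
  have eq: "real (Suc n) * (conv k f (z + ?t n) - conv k f z) = (LBINT u. ?q n u)" for n
  proof -
    have "conv k f (z + ?t n) - conv k f z = (LBINT u. k u * f (z + ?t n - u) - k u * f (z - u))"
      using integrable_conv_kernel[OF k f, of "z + ?t n"] integrable_conv_kernel[OF k f, of z]
      unfolding conv_def by simp
    then show ?thesis
      by (simp add: algebra_simps flip: Bochner_Integration.integral_mult_right_zero)
  qed
  have "(\<lambda>n. LBINT u. ?q n u) \<longlonglongrightarrow> (LBINT u. k u * (f' (z - u) \<bullet> e))"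
  proof (rule integral_dominated_convergence[where w="\<lambda>u. \<bar>k u\<bar> * (L * norm e)"])
    show "integrable lborel (\<lambda>u. \<bar>k u\<bar> * (L * norm e))"
      using bdd_integrableD(2)[OF k] by simp
    show "AE u in lborel. norm (?q n u) \<le> \<bar>k u\<bar> * (L * norm e)" for n
    proof (rule AE_I2)
      fix u
      have "\<bar>real (Suc n) * (f (z + ?t n - u) - f (z - u))\<bar> \<le> real (Suc n) * (L * norm (?t n))"
        using lip[of "z + ?t n - u" "z - u"] by (simp add: abs_mult)
      also have "\<dots> = L * norm e" by (simp add: field_simps)
      finally show "norm (?q n u) \<le> \<bar>k u\<bar> * (L * norm e)"
        using mult_left_mono[of _ _ "\<bar>k u\<bar>"] by (simp add: abs_mult)
    qed
    show "AE u in lborel. (\<lambda>n. ?q n u) \<longlonglongrightarrow> k u * (f' (z - u) \<bullet> e)"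
    proof (rule AE_I2)
      fix u
      have "((\<lambda>t. f (z - u + t *\<^sub>R e)) has_real_derivative (f' (z - u) \<bullet> e)) (at 0)"
      proof -
        have "((\<lambda>t. f (z - u + t *\<^sub>R e)) has_derivative (\<lambda>t. f' (z - u) \<bullet> (t *\<^sub>R e))) (at 0)"
        proof (rule has_derivative_compose[of "\<lambda>t. z - u + t *\<^sub>R e" _ 0 UNIV f, simplified])
          show "((\<lambda>t. z - u + t *\<^sub>R e) has_derivative (\<lambda>t. t *\<^sub>R e)) (at 0)"
            by (auto intro!: derivative_eq_intros)
          show "(f has_derivative (\<lambda>h. f' (z - u) \<bullet> h)) (at (z - u))" by (rule der)
        qed
        then show ?thesis
          by (simp add: has_field_derivative_def mult.commute[of _ "f' (z - u) \<bullet> e"])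
      qed
      then have lim: "((\<lambda>t. (f (z - u + t *\<^sub>R e) - f (z - u)) / t) \<longlongrightarrow> f' (z - u) \<bullet> e) (at 0)"
        by (simp add: DERIV_def)
      have "(\<lambda>n. (f (z - u + inverse (real (Suc n)) *\<^sub>R e) - f (z - u)) / inverse (real (Suc n))) \<longlonglongrightarrow> f' (z - u) \<bullet> e"
        by (rule filterlim_compose[OF lim]) (rule filterlim_atI[OF LIMSEQ_inverse_real_of_nat], simp)
      then have "(\<lambda>n. real (Suc n) * (f (z + ?t n - u) - f (z - u))) \<longlonglongrightarrow> f' (z - u) \<bullet> e"
        by (simp add: divide_inverse mult.commute algebra_simps)
      then show "(\<lambda>n. ?q n u) \<longlonglongrightarrow> k u * (f' (z - u) \<bullet> e)"
        by (intro tendsto_mult tendsto_const)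
    qed
  qed simp_all
  also have "(LBINT u. k u * (f' (z - u) \<bullet> e)) = conv k f' z \<bullet> e"
    unfolding conv_def by (subst integral_inner_left[symmetric, OF integrable_conv_kernel[OF k f']]) simp
  finally show ?thesis unfolding eq .
qed

text \<open>By commutativity of the convolution, the difference quotients with the derivative on
  either factor are the same sequence, so their limits coincide in every direction e.\<close>

lemma conv_gradient:
  fixes f g :: "'a::euclidean_space \<Rightarrow> real"
  assumes "bdd_integrable f" "bdd_integrable f'" "\<And>z. (f has_derivative (\<lambda>h. f' z \<bullet> h)) (at z)"
    and "bdd_integrable g" "bdd_integrable g'" "\<And>z. (g has_derivative (\<lambda>h. g' z \<bullet> h)) (at z)"
  shows "conv g f' = conv f g'"
proof
  fix z
  have "conv g f = conv f g" using conv_commute[OF assms(4,1)] by auto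
  then have "conv g f' z \<bullet> e = conv f g' z \<bullet> e" for e
    using conv_difference_quotient[OF assms(4,1,2,3), of z e] conv_difference_quotient[OF assms(1,4,5,6), of z e]
    by (simp add: LIMSEQ_unique)
  then show "conv g f' z = conv f g' z"
    by (metis vector_eq_rdot)
qed

section \<open>Mollifiers and integer fluxes\<close>

text \<open>The square of the positive part is C^1 with support in the ball of radius h, and no
  further smoothness is needed; its gradient has a closed form that is visibly radial.\<close>

definition bump :: "real \<Rightarrow> real^3 \<Rightarrow> real" where
  "bump h v = (max 0 (1 - (norm v / h)\<^sup>2))\<^sup>2"

definition bump_grad :: "real \<Rightarrow> real^3 \<Rightarrow> real^3" where
  "bump_grad h v = - (4 * max 0 (1 - (norm v / h)\<^sup>2) / h\<^sup>2) *\<^sub>R v"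

lemma bdd_integrable_bounded_support:
  fixes f :: "'a::euclidean_space \<Rightarrow> 'b::euclidean_space"
  assumes f: "f \<in> borel_measurable borel" and M: "\<And>z. norm (f z) \<le> M" and R: "\<And>z. R \<le> dist x z \<Longrightarrow> f z = 0"
  shows "bdd_integrable f"
proof -
  have "integrable lborel f"
  proof (rule integrableI_bounded_set[where A="ball x R" and B=M])
    show "emeasure lborel (ball x R) < \<infinity>"
      by (rule emeasure_bounded_finite) simp
  qed (use f M R in auto)
  then show ?thesis using f M unfolding bdd_integrable_def by blast
qed

lemma has_real_derivative_max_square:
  "((\<lambda>s::real. (max 0 s)\<^sup>2) has_real_derivative 2 * max 0 t) (at t)"
proof (cases "t = 0")
  case True
  have "((\<lambda>s::real. (max 0 s)\<^sup>2 / s) \<longlongrightarrow> 0) (at 0)"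
  proof (rule Lim_null_comparison)
    show "eventually (\<lambda>s::real. norm ((max 0 s)\<^sup>2 / s) \<le> \<bar>s\<bar>) (at 0)"
      by (rule always_eventually) (auto simp: max_def power2_eq_square)
    show "((\<lambda>s::real. \<bar>s\<bar>) \<longlongrightarrow> 0) (at 0)"
      by (rule tendsto_eq_intros | simp)+
  qed
  then show ?thesis using True by (simp add: DERIV_def)
next
  case False
  show ?thesis
  proof (cases "0 < t")
    case True
    have "((\<lambda>s::real. s\<^sup>2) has_real_derivative 2 * t) (at t)"
      by (auto intro!: derivative_eq_intros)
    then have "((\<lambda>s::real. (max 0 s)\<^sup>2) has_real_derivative 2 * t) (at t)"
      by (rule has_field_derivative_transform_within_open[where S="{0<..}"]) (use True in auto)
    then show ?thesis using True by simp
  next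
    case neg: False
    have "((\<lambda>s::real. 0) has_real_derivative 0) (at t)" by simp
    then have "((\<lambda>s::real. (max 0 s)\<^sup>2) has_real_derivative 0) (at t)"
      by (rule has_field_derivative_transform_within_open[where S="{..<0}"]) (use False neg in auto)
    then show ?thesis using neg by simp
  qed
qed

lemma has_derivative_bump:
  "(bump h has_derivative (\<lambda>w. bump_grad h v \<bullet> w)) (at v)"
proof -
  define c where "c = 1 / h\<^sup>2"
  have e: "bump h = (\<lambda>v. (max 0 (1 - c * (v \<bullet> v)))\<^sup>2)"
    by (simp add: fun_eq_iff bump_def power_divide power2_norm_eq_inner c_def)
  have "((\<lambda>v. 1 - c * (v \<bullet> v)) has_derivative (\<lambda>w. - (c * (2 * (v \<bullet> w))))) (at v)"
    by (auto intro!: derivative_eq_intros simp: inner_commute)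
  from has_derivative_compose[OF this, of "\<lambda>s. (max 0 s)\<^sup>2", OF has_real_derivative_max_square[unfolded has_field_derivative_def]]
  show ?thesis
    unfolding e bump_grad_def by (simp add: power_divide power2_norm_eq_inner c_def mult.assoc)
qed

context
  fixes h :: real
  assumes h: "0 < h"
begin

lemma bump_outside: "h \<le> norm v \<Longrightarrow> bump h v = 0" "h \<le> norm v \<Longrightarrow> bump_grad h v = 0"
proof -
  assume "h \<le> norm v"
  then have "1 \<le> (norm v / h)\<^sup>2" using h by (intro one_le_power) simp
  then show "bump h v = 0" "bump_grad h v = 0" by (simp_all add: bump_def bump_grad_def)
qed

lemma bump_nonneg: "0 \<le> bump h v" and bump_le_1: "bump h v \<le> 1"
  by (auto simp: bump_def power_le_one)

lemma norm_bump_grad_le: "norm (bump_grad h v) \<le> 4 / h"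
proof (cases "h \<le> norm v")
  case False
  have "norm (bump_grad h v) = 4 * max 0 (1 - (norm v / h)\<^sup>2) * (norm v / h) / h"
    using h by (simp add: bump_grad_def power2_eq_square abs_mult)
  also have "\<dots> \<le> 4 * 1 * 1 / h"
    using False h by (intro divide_right_mono mult_mono) auto
  finally show ?thesis by simp
qed (use h bump_outside in auto)

lemma bump_borel: "bump h \<in> borel_measurable borel" "bump_grad h \<in> borel_measurable borel"
  unfolding bump_def[abs_def] bump_grad_def[abs_def] by measurable

lemma bdd_integrable_bump: "bdd_integrable (bump h)" and bdd_integrable_bump_grad: "bdd_integrable (bump_grad h)"
proof -
  show "bdd_integrable (bump h)"
    by (rule bdd_integrable_bounded_support[OF bump_borel(1), of 1 h 0]) (use bump_le_1 bump_nonneg bump_outside in auto)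
  show "bdd_integrable (bump_grad h)"
    by (rule bdd_integrable_bounded_support[OF bump_borel(2) norm_bump_grad_le, of h 0]) (use bump_outside in auto)
qed

text \<open>On the ball of radius h / 2 the bump is at least (3/4)^2 >= 1/2, and that ball has
  volume \<open>unit_ball_vol 3 * h ^ 3 / 8\<close>. The lower bound of order h^3 controls the size
  of the normalised gradient.\<close>

lemma integral_bump_ge: "unit_ball_vol 3 * h ^ 3 / 16 \<le> (LBINT v. bump h v)"
proof -
  have "unit_ball_vol 3 * h ^ 3 / 16 = (LBINT v. 1/2 * indicator (ball (0::real^3) (h/2)) v)"
    using h content_ball[of "h/2" "0::real^3"] by (simp add: power_divide)
  also have "\<dots> \<le> (LBINT v. bump h v)"
  proof (rule integral_mono)
    show "integrable lborel (\<lambda>v. 1/2 * indicator (ball (0::real^3) (h/2)) v :: real)"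
      using emeasure_bounded_finite[OF bounded_ball, of "0::real^3" "h/2"]
      by (intro integrable_mult_right integrable_real_indicator) (auto simp: less_top)
    show "integrable lborel (bump h)" by (rule bdd_integrableD(2)[OF bdd_integrable_bump])
    show "1/2 * indicator (ball 0 (h/2)) v \<le> bump h v" for v
    proof (cases "v \<in> ball 0 (h/2)")
      case True
      then have "norm v / h \<le> 1/2" using h by (simp add: field_simps)
      then have "(norm v / h)\<^sup>2 \<le> (1/2)\<^sup>2" using h by (intro power_mono) auto
      also have "(1/2)\<^sup>2 = (1/4 :: real)" by (simp add: power2_eq_square)
      finally have "3/4 \<le> 1 - (norm v / h)\<^sup>2" by linarith
      then have "3/4 \<le> max 0 (1 - (norm v / h)\<^sup>2)" by (rule max.coboundedI2)
      then have "(3/4)\<^sup>2 \<le> bump h v" unfolding bump_def by (rule power_mono) simp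
      then show ?thesis using True by (simp add: power2_eq_square)
    qed (simp add: bump_nonneg)
  qed
  finally show ?thesis .
qed

end

definition bump_mass :: "real \<Rightarrow> real" where "bump_mass h = (LBINT v. bump h v)"

definition mollifier :: "real \<Rightarrow> real^3 \<Rightarrow> real" where "mollifier h v = bump h v / bump_mass h"

definition mollifier_grad :: "real \<Rightarrow> real^3 \<Rightarrow> real^3" where "mollifier_grad h v = bump_grad h v /\<^sub>R bump_mass h"

lemma bump_mass_pos: "0 < h \<Longrightarrow> 0 < bump_mass h"
proof -
  assume h: "0 < h"
  have "0 < unit_ball_vol 3 * h ^ 3 / 16" using h by simp
  then show ?thesis using integral_bump_ge[OF h] by (simp add: bump_mass_def)
qed

lemma bdd_integrable_scale: "bdd_integrable f \<Longrightarrow> bdd_integrable (\<lambda>z. c *\<^sub>R f z)"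
proof -
  assume f: "bdd_integrable f"
  obtain M where "\<And>z. norm (f z) \<le> M" using bdd_integrableD(3)[OF f] by blast
  then have "norm (c *\<^sub>R f z) \<le> \<bar>c\<bar> * M" for z by (simp add: mult_left_mono)
  then show ?thesis
    using bdd_integrableD(1,2)[OF f] unfolding bdd_integrable_def by auto
qed

lemma
  assumes h: "0 < h"
  shows bdd_integrable_mollifier: "bdd_integrable (mollifier h)" and bdd_integrable_mollifier_grad: "bdd_integrable (mollifier_grad h)"
    and mollifier_nonneg: "0 \<le> mollifier h v" and integral_mollifier: "(LBINT v. mollifier h v) = 1"
    and mollifier_outside: "h \<le> norm v \<Longrightarrow> mollifier h v = 0"
    and has_derivative_mollifier: "(mollifier h has_derivative (\<lambda>w. mollifier_grad h v \<bullet> w)) (at v)"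
proof -
  show "bdd_integrable (mollifier h)" "bdd_integrable (mollifier_grad h)"
    using bdd_integrable_scale[OF bdd_integrable_bump[OF h], of "1 / bump_mass h"] bdd_integrable_scale[OF bdd_integrable_bump_grad[OF h], of "inverse (bump_mass h)"]
    by (simp_all add: mollifier_def[abs_def] mollifier_grad_def[abs_def])
  show "0 \<le> mollifier h v" using bump_nonneg[OF h] bump_mass_pos[OF h] by (simp add: mollifier_def)
  show "(LBINT v. mollifier h v) = 1"
    using bump_mass_pos[OF h] by (simp add: mollifier_def bump_mass_def)
  show "h \<le> norm v \<Longrightarrow> mollifier h v = 0" using bump_outside[OF h] by (simp add: mollifier_def)
  show "(mollifier h has_derivative (\<lambda>w. mollifier_grad h v \<bullet> w)) (at v)"
    unfolding mollifier_def[abs_def] mollifier_grad_def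
    using has_derivative_mult_left[OF has_derivative_bump[of h v], of "1 / bump_mass h"]
    by (simp add: divide_inverse mult.commute)
qed

text \<open>The radial part of \<open>bump_grad h\<close>, with the factor -4 / h taken out so that
  it is bounded by 1, as the flux estimate requires of its weight.\<close>

definition profile :: "real \<Rightarrow> real \<Rightarrow> real" where
  "profile h r = max 0 (1 - (r / h)\<^sup>2) * (r / h)"

lemma profile_bounds:
  assumes "0 < h"
  shows "\<bar>profile h r\<bar> \<le> 1" "h \<le> r \<Longrightarrow> profile h r = 0"
proof -
  show "\<bar>profile h r\<bar> \<le> 1"
  proof (cases "\<bar>r / h\<bar> \<le> 1")
    case True
    have "\<bar>profile h r\<bar> = max 0 (1 - (r / h)\<^sup>2) * \<bar>r / h\<bar>" by (simp add: profile_def abs_mult)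
    also have "\<dots> \<le> 1 * 1" using True by (intro mult_mono) auto
    finally show ?thesis by simp
  next
    case False
    then have "1 \<le> \<bar>r / h\<bar>\<^sup>2" by (intro one_le_power) simp
    then have "1 \<le> (r / h)\<^sup>2" unfolding power2_abs .
    then show ?thesis by (simp add: profile_def)
  qed
  assume "h \<le> r"
  then have "1 \<le> (r / h)\<^sup>2" using assms by (intro one_le_power) simp
  then show "profile h r = 0" by (simp add: profile_def)
qed

section \<open>Pairing with mollifier gradients, integrated over all centres\<close>

lemma mollifier_grad_eq_radial:
  assumes "0 < h"
  shows "mollifier_grad h v = - (4 / (h * bump_mass h)) *\<^sub>R radial (profile h) v"
  using assms by (cases "v = 0")
    (auto simp: mollifier_grad_def bump_grad_def radial_def profile_def sgn_div_norm power2_eq_square divide_inverse mult_ac)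

text \<open>Tonelli: a point z is counted by exactly those centres y that lie in the ball of radius
  h about z.\<close>

lemma nn_integral_indicator_ball_swap:
  fixes g :: "real^3 \<Rightarrow> ennreal"
  assumes [measurable]: "g \<in> borel_measurable borel" and h: "0 \<le> h"
  shows "(\<integral>\<^sup>+y. (\<integral>\<^sup>+z. g z * indicator (ball y h) z \<partial>lborel) \<partial>lborel)
    = ennreal (unit_ball_vol 3 * h ^ 3) * (\<integral>\<^sup>+z. g z \<partial>lborel)"
proof -
  have "open {p :: (real^3) \<times> (real^3). dist (fst p) (snd p) < h}"
    by (intro open_Collect_less continuous_intros)
  then have [measurable]: "{p :: (real^3) \<times> (real^3). dist (fst p) (snd p) < h} \<in> sets (borel \<Otimes>\<^sub>M borel)"
    unfolding borel_prod by (rule borel_open)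
  have "(\<integral>\<^sup>+y. (\<integral>\<^sup>+z. g z * indicator (ball y h) z \<partial>lborel) \<partial>lborel)
    = (\<integral>\<^sup>+y. (\<integral>\<^sup>+z. g z * indicator {p. dist (fst p) (snd p) < h} (y, z) \<partial>lborel) \<partial>lborel)"
    by (intro nn_integral_cong) (auto split: split_indicator)
  also have "\<dots> = (\<integral>\<^sup>+z. (\<integral>\<^sup>+y. g z * indicator {p. dist (fst p) (snd p) < h} (y, z) \<partial>lborel) \<partial>lborel)"
    by (rule lborel_pair.Fubini'[symmetric]) measurable
  also have "\<dots> = (\<integral>\<^sup>+z. ennreal (unit_ball_vol 3 * h ^ 3) * g z \<partial>lborel)"
  proof (rule nn_integral_cong)
    fix z :: "real^3"
    have "(\<integral>\<^sup>+y. g z * indicator {p. dist (fst p) (snd p) < h} (y, z) \<partial>lborel) = (\<integral>\<^sup>+y. g z * indicator (ball z h) y \<partial>lborel)"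
      by (intro nn_integral_cong) (auto simp: dist_commute split: split_indicator)
    also have "\<dots> = g z * emeasure lborel (ball z h)"
      by (rule nn_integral_cmult_indicator) simp
    finally show "(\<integral>\<^sup>+y. g z * indicator {p. dist (fst p) (snd p) < h} (y, z) \<partial>lborel) = ennreal (unit_ball_vol 3 * h ^ 3) * g z"
      using emeasure_ball[OF h, of z] by (simp add: mult.commute)
  qed
  also have "\<dots> = ennreal (unit_ball_vol 3 * h ^ 3) * (\<integral>\<^sup>+z. g z \<partial>lborel)"
    by (rule nn_integral_cmult) simp
  finally show ?thesis .
qed

lemma profile_borel [measurable]: "profile h \<in> borel_measurable borel"
  unfolding profile_def[abs_def] by measurable

text \<open>Powers of h: h^-4 from the kernel, h^(2p-2) from the flux bound on each ball, h^3 from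
  the integration over centres. The constant 128 is 4 * 2 * 16, from the gradient of the bump, the
  flux bound and the lower bound of its mass. Integrality is demanded only at centres where
  \<open>\<phi>\<close> is nonzero.\<close>

lemma integer_flux_pairing_le:
  fixes F :: form2
  assumes F: "integrable lborel F" and Fm [measurable]: "F \<in> borel_measurable borel" and p: "1 < p" and h: "0 < h"
    and N: "(\<integral>\<^sup>+z. ennreal (norm (F z) powr p) \<partial>lborel) \<le> ennreal N" "0 \<le> N"
    and phi: "bdd_integrable \<phi>" "\<And>y. \<bar>\<phi> y\<bar> \<le> S"
    and int: "\<And>y. \<phi> y \<noteq> 0 \<Longrightarrow> AE r in lborel. 0 < r \<and> r < h \<longrightarrow> sphere_flux F y r \<in> \<int>"
  shows "\<bar>\<integral>z. F z \<bullet> conv \<phi> (mollifier_grad h) z \<partial>lborel\<bar> \<le> S * (128 * (4 * pi\<^sup>2) powr (p - 1)) * h powr (2 * p - 3) * N"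
proof -
  have S: "0 \<le> S" using phi(2)[of 0] by linarith
  define m where "m = bump_mass h"
  have m: "0 < m" "unit_ball_vol 3 * h ^ 3 / 16 \<le> m"
    using bump_mass_pos[OF h] integral_bump_ge[OF h] by (simp_all add: m_def bump_mass_def)
  define c where "c = 2 * (4 * pi\<^sup>2 * h\<^sup>2) powr (p - 1)"
  define D where "D y = (LBINT z. F z \<bullet> radial (profile h) (z - y))" for y
  let ?J = "\<lambda>y. \<integral>\<^sup>+z. ennreal (norm (F z) powr p) * indicator (ball y h) z \<partial>lborel"
  have c0: "0 \<le> c" by (simp add: c_def)
  have D: "(LBINT z. F z \<bullet> mollifier_grad h (z - y)) = - (4 / (h * m)) * D y" for y
    unfolding mollifier_grad_eq_radial[OF h] m_def[symmetric] D_def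
    by (simp flip: Bochner_Integration.integral_mult_right_zero)
  have Dle: "ennreal \<bar>\<phi> y * (- (4 / (h * m)) * D y)\<bar> \<le> ennreal (S * (4 / (h * m)) * c) * ?J y" for y
  proof (cases "\<phi> y = 0")
    case False
    have "ennreal \<bar>D y\<bar> \<le> ennreal c * ?J y"
      unfolding D_def c_def
      by (rule integer_flux_radial_le[OF F Fm p int[OF False] profile_borel]) (use profile_bounds[OF h] in auto)
    then have "ennreal (S * (4 / (h * m))) * ennreal \<bar>D y\<bar> \<le> ennreal (S * (4 / (h * m))) * (ennreal c * ?J y)"
      by (rule mult_left_mono) simp
    also have "\<dots> = ennreal (S * (4 / (h * m)) * c) * ?J y"
      using S h m c0 by (subst ennreal_mult) (auto simp: mult.assoc)
    finally have "ennreal (S * (4 / (h * m)) * \<bar>D y\<bar>) \<le> ennreal (S * (4 / (h * m)) * c) * ?J y"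
      using S h m by (subst ennreal_mult) auto
    moreover have "\<bar>\<phi> y * (- (4 / (h * m)) * D y)\<bar> = \<bar>\<phi> y\<bar> * (4 / (h * m) * \<bar>D y\<bar>)"
      using h m by (simp add: abs_mult)
    moreover have "\<bar>\<phi> y\<bar> * (4 / (h * m) * \<bar>D y\<bar>) \<le> S * (4 / (h * m) * \<bar>D y\<bar>)"
      using h m by (intro mult_right_mono phi(2)) auto
    ultimately show ?thesis
      by (simp add: mult.assoc) (meson ennreal_leI order_trans)
  qed simp
  have "ennreal \<bar>\<integral>z. F z \<bullet> conv \<phi> (mollifier_grad h) z \<partial>lborel\<bar> \<le> (\<integral>\<^sup>+y. ennreal \<bar>\<phi> y * (- (4 / (h * m)) * D y)\<bar> \<partial>lborel)"
    unfolding conv_pairing(1)[OF F Fm phi(1) bdd_integrable_mollifier_grad[OF h]] D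
    using norm_integral_le_nn_integral[of lborel "\<lambda>y. \<phi> y * (- (4 / (h * m)) * D y)"] by simp
  also have "\<dots> \<le> (\<integral>\<^sup>+y. ennreal (S * (4 / (h * m)) * c) * ?J y \<partial>lborel)"
    by (rule nn_integral_mono) (rule Dle)
  also have "\<dots> = ennreal (S * (4 / (h * m)) * c) * (\<integral>\<^sup>+y. ?J y \<partial>lborel)"
  proof (rule nn_integral_cmult)
    have "open {p :: (real^3) \<times> (real^3). dist (fst p) (snd p) < h}"
      by (intro open_Collect_less continuous_intros)
    then have [measurable]: "{p :: (real^3) \<times> (real^3). dist (fst p) (snd p) < h} \<in> sets (borel \<Otimes>\<^sub>M borel)"
      unfolding borel_prod by (rule borel_open)
    have "(\<lambda>(y, z). ennreal (norm (F z) powr p) * indicator {p. dist (fst p) (snd p) < h} (y, z)) \<in> borel_measurable (lborel \<Otimes>\<^sub>M lborel)"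
      by measurable
    then have "(\<lambda>y. \<integral>\<^sup>+z. (case (y, z) of (y, z) \<Rightarrow> ennreal (norm (F z) powr p) * indicator {p. dist (fst p) (snd p) < h} (y, z)) \<partial>lborel) \<in> borel_measurable lborel"
      by (rule lborel.borel_measurable_nn_integral_fst)
    also have "(\<lambda>y. \<integral>\<^sup>+z. (case (y, z) of (y, z) \<Rightarrow> ennreal (norm (F z) powr p) * indicator {p. dist (fst p) (snd p) < h} (y, z)) \<partial>lborel) = ?J"
      by (intro ext nn_integral_cong) (auto split: split_indicator)
    finally show "?J \<in> borel_measurable lborel" .
  qed
  also have "(\<integral>\<^sup>+y. ?J y \<partial>lborel) = ennreal (unit_ball_vol 3 * h ^ 3) * (\<integral>\<^sup>+z. ennreal (norm (F z) powr p) \<partial>lborel)"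
    using h by (intro nn_integral_indicator_ball_swap) auto
  also have "ennreal (S * (4 / (h * m)) * c) * \<dots> \<le> ennreal (S * (4 / (h * m)) * c) * (ennreal (unit_ball_vol 3 * h ^ 3) * ennreal N)"
    by (intro mult_left_mono N) auto
  also have "\<dots> = ennreal (S * (4 / (h * m)) * c * (unit_ball_vol 3 * h ^ 3 * N))"
  proof -
    have "ennreal A * (ennreal B * ennreal N) = ennreal (A * (B * N))" if "0 \<le> A" "0 \<le> B" for A B
      using that N(2) by (simp add: ennreal_mult)
    then show ?thesis using S h m c0 by simp
  qed
  finally have "\<bar>\<integral>z. F z \<bullet> conv \<phi> (mollifier_grad h) z \<partial>lborel\<bar> \<le> S * (4 / (h * m)) * c * (unit_ball_vol 3 * h ^ 3 * N)"
    using S h m c0 N(2) by (subst (asm) ennreal_le_iff) auto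
  \<comment> \<open>The quotient isolated here is at most 16: the volume gained over the centres
    cancels the normalisation of the mollifier.\<close>
  also have "\<dots> = S * (4 / h) * c * N * ((unit_ball_vol 3 * h ^ 3) / m)"
    by simp
  also have "\<dots> \<le> S * (4 / h) * c * N * 16"
    using m S h c0 N(2) by (intro mult_left_mono) (auto simp: field_simps)
  also have "\<dots> = S * (128 * (4 * pi\<^sup>2) powr (p - 1)) * (h powr (2 * p - 3)) * N"
  proof -
    have "(4 * pi\<^sup>2 * h\<^sup>2) powr (p - 1) = (4 * pi\<^sup>2) powr (p - 1) * (h\<^sup>2) powr (p - 1)"
      by (rule powr_mult)
    also have "(h\<^sup>2) powr (p - 1) = h powr (2 * (p - 1))"
      using h by (simp add: powr_powr flip: powr_numeral)
    also have "\<dots> = h powr (2 * p - 3) * h"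
      using h powr_add[of h "2 * p - 3" 1] by (simp add: algebra_simps)
    finally show ?thesis using h by (simp add: c_def)
  qed
  finally show ?thesis .
qed

text \<open>A mollification is an average over a ball of radius h, so closeness to a fixed value w
  passes to it. The value w is free: w = f z yields approximation rates, and w = 0 with e = 0
  controls supports.\<close>

lemma conv_mollifier_near:
  fixes f :: "real^3 \<Rightarrow> 'b::euclidean_space"
  assumes h: "0 < h" and f: "bdd_integrable f" and near: "\<And>z'. dist z z' \<le> h \<Longrightarrow> norm (f z' - w) \<le> e"
  shows "norm (conv (mollifier h) f z - w) \<le> e"
proof -
  have i1: "integrable lborel (\<lambda>u. mollifier h u *\<^sub>R f (z - u))"
    by (rule integrable_conv_kernel[OF bdd_integrable_mollifier[OF h] f])
  have i2: "integrable lborel (\<lambda>u. mollifier h u *\<^sub>R w)"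
    using bdd_integrableD(2)[OF bdd_integrable_mollifier[OF h]] by (rule integrable_scaleR_left)
  have i3: "integrable lborel (\<lambda>u. mollifier h u *\<^sub>R (f (z - u) - w))"
    using Bochner_Integration.integrable_diff[OF i1 i2] by (simp add: scaleR_diff_right)
  have "(LBINT u. mollifier h u *\<^sub>R w) = w"
    using bdd_integrableD(2)[OF bdd_integrable_mollifier[OF h]] integral_mollifier[OF h] by simp
  then have "conv (mollifier h) f z - w = (LBINT u. mollifier h u *\<^sub>R (f (z - u) - w))"
    using Bochner_Integration.integral_diff[OF i1 i2] by (simp add: conv_def scaleR_diff_right)
  then have "norm (conv (mollifier h) f z - w) \<le> (LBINT u. norm (mollifier h u *\<^sub>R (f (z - u) - w)))"
    by (simp only: integral_norm_bound)
  also have "\<dots> \<le> (LBINT u. mollifier h u * e)"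
  proof (rule integral_mono)
    show "integrable lborel (\<lambda>u. norm (mollifier h u *\<^sub>R (f (z - u) - w)))" by (rule integrable_norm[OF i3])
    show "integrable lborel (\<lambda>u. mollifier h u * e)" using bdd_integrableD(2)[OF bdd_integrable_mollifier[OF h]] by simp
    fix u
    show "norm (mollifier h u *\<^sub>R (f (z - u) - w)) \<le> mollifier h u * e"
    proof (cases "h \<le> norm u")
      case True
      then show ?thesis using mollifier_outside[OF h] by simp
    next
      case False
      then show ?thesis
        using near[of "z - u"] mollifier_nonneg[OF h, of u] by (simp add: dist_norm mult_left_mono)
    qed
  qed
  also have "\<dots> = e" using integral_mollifier[OF h] by simp
  finally show ?thesis .
qed

lemma norm_conv_mollifier_le:
  assumes h: "0 < h" and M: "\<And>z. norm (f z) \<le> M"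
  shows "norm (conv (mollifier h) f z) \<le> M"
  using norm_conv_le[OF bdd_integrable_mollifier[OF h], of f M z] M mollifier_nonneg[OF h] integral_mollifier[OF h] by simp

section \<open>Telescoping over dyadic scales\<close>

lemma conv_diff_left:
  assumes "bdd_integrable f" "bdd_integrable g" "bdd_integrable k"
  shows "conv (\<lambda>z. f z - g z) k z = conv f k z - conv g k z"
  using integrable_conv_kernel[OF assms(1,3)] integrable_conv_kernel[OF assms(2,3)]
  by (simp add: conv_def scaleR_diff_left)

text \<open>The induction carries the exact partial geometric sum, so that the bound with 1 -
  \<open>\<rho>\<close> in the denominator is uniform in j and passes to the limit.\<close>

lemma geometric_telescope:
  fixes a :: "nat \<Rightarrow> real"
  assumes step: "\<And>i. k \<le> i \<Longrightarrow> \<bar>a i - a (Suc i)\<bar> \<le> c * \<rho> ^ i" and \<rho>: "0 \<le> \<rho>" "\<rho> < 1" and c: "0 \<le> c"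
    and lim: "a \<longlonglongrightarrow> l"
  shows "\<bar>l - a k\<bar> \<le> c * \<rho> ^ k / (1 - \<rho>)"
proof -
  have sum: "\<bar>a (k + j) - a k\<bar> \<le> c * \<rho> ^ k * (1 - \<rho> ^ j) / (1 - \<rho>)" for j
  proof (induction j)
    case (Suc j)
    have "\<bar>a (k + Suc j) - a k\<bar> \<le> c * \<rho> ^ (k + j) + c * \<rho> ^ k * (1 - \<rho> ^ j) / (1 - \<rho>)"
      using Suc step[of "k + j"] by simp
    also have "\<dots> = c * \<rho> ^ k * (1 - \<rho> ^ Suc j) / (1 - \<rho>)"
      using \<rho> by (simp add: field_simps power_add)
    finally show ?case .
  qed simp
  have "\<bar>a (k + j) - a k\<bar> \<le> c * \<rho> ^ k / (1 - \<rho>)" for j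
  proof -
    have "c * \<rho> ^ k * (1 - \<rho> ^ j) / (1 - \<rho>) \<le> c * \<rho> ^ k * 1 / (1 - \<rho>)"
      using \<rho> c by (intro divide_right_mono mult_left_mono) auto
    then show ?thesis using sum[of j] by simp
  qed
  moreover have "(\<lambda>j. \<bar>a (k + j) - a k\<bar>) \<longlonglongrightarrow> \<bar>l - a k\<bar>"
    using LIMSEQ_ignore_initial_segment[OF lim, of k] by (intro tendsto_intros) (simp add: add.commute)
  ultimately show ?thesis by (intro LIMSEQ_le_const2) auto
qed

text \<open>Only differences \<open>\<phi>\<close> of mollifications of \<open>\<Theta>\<close> occur on the right; they are of order g + h when \<open>\<Theta>\<close> is Lipschitz,
  whereas \<open>\<Theta>\<close> itself would not be small enough for the sum over dyadic scales to converge.\<close>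

lemma mollifier_telescope:
  assumes g: "0 < g" and h: "0 < h" and T: "bdd_integrable \<Theta>" and W: "bdd_integrable W"
    and der: "\<And>z. (\<Theta> has_derivative (\<lambda>w. W z \<bullet> w)) (at z)"
  defines "\<phi> \<equiv> \<lambda>z. conv (mollifier g) \<Theta> z - conv (mollifier h) \<Theta> z"
  shows "conv (mollifier g) (conv (mollifier g) W) z - conv (mollifier h) (conv (mollifier h) W) z
    = conv \<phi> (mollifier_grad g) z + conv \<phi> (mollifier_grad h) z"
proof -
  note n = bdd_integrable_mollifier[OF g] bdd_integrable_mollifier[OF h] bdd_integrable_mollifier_grad[OF g] bdd_integrable_mollifier_grad[OF h] T W
  \<comment> \<open>The derivative is moved from the potential to the mollifier, whose gradient is
    an explicit radial kernel.\<close>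
  have grad: "conv (mollifier g) W = conv \<Theta> (mollifier_grad g)" "conv (mollifier h) W = conv \<Theta> (mollifier_grad h)"
    by (intro conv_gradient n der has_derivative_mollifier g h)+
  have "conv \<phi> (mollifier_grad g) z = conv (mollifier g) (conv (mollifier g) W) z - conv (mollifier h) (conv (mollifier g) W) z"
    unfolding \<phi>_def grad using n by (simp add: conv_diff_left bdd_integrable_conv conv_assoc)
  moreover have "conv \<phi> (mollifier_grad h) z = conv (mollifier g) (conv (mollifier h) W) z - conv (mollifier h) (conv (mollifier h) W) z"
    unfolding \<phi>_def grad using n by (simp add: conv_diff_left bdd_integrable_conv conv_assoc)
  \<comment> \<open>The mixed terms of the expanded product of difference and sum cancel because
    convolutions commute.\<close>
  moreover have "conv (mollifier g) (conv (mollifier h) W) = conv (mollifier h) (conv (mollifier g) W)"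
    by (intro conv_left_commute n)
  ultimately show ?thesis by simp
qed

lemma conv_mollifier_tendsto:
  fixes W :: "real^3 \<Rightarrow> 'b::euclidean_space"
  assumes W: "bdd_integrable W" and cont: "isCont W z"
  shows "(\<lambda>i. conv (mollifier ((1/2) ^ i)) (conv (mollifier ((1/2) ^ i)) W) z) \<longlonglongrightarrow> W z"
proof (rule metric_LIMSEQ_I)
  fix e :: real assume "0 < e"
  then obtain d where d: "0 < d" "\<And>z'. dist z' z < d \<Longrightarrow> dist (W z') (W z) < e / 2"
    using cont half_gt_zero[of e] unfolding continuous_at_eps_delta by blast
  have "(\<lambda>i. (1/2::real) ^ i) \<longlonglongrightarrow> 0" by (rule LIMSEQ_realpow_zero) auto
  \<comment> \<open>Two successive mollifications reach points at distance at most twice the scale,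
    hence d / 2.\<close>
  then have "eventually (\<lambda>i. (1/2::real) ^ i < d / 2) sequentially"
    using d(1) by (intro order_tendstoD) auto
  then obtain k where k: "\<And>i. k \<le> i \<Longrightarrow> (1/2::real) ^ i < d / 2"
    by (auto simp: eventually_sequentially)
  have "dist (conv (mollifier ((1/2) ^ i)) (conv (mollifier ((1/2) ^ i)) W) z) (W z) < e" if i: "k \<le> i" for i
  proof -
    have h: "0 < (1/2::real) ^ i" by simp
    have "norm (conv (mollifier ((1/2) ^ i)) (conv (mollifier ((1/2) ^ i)) W) z - W z) \<le> e / 2"
    proof (rule conv_mollifier_near[OF h bdd_integrable_conv[OF bdd_integrable_mollifier[OF h] W]])
      fix z' assume z': "dist z z' \<le> (1/2) ^ i"
      show "norm (conv (mollifier ((1/2) ^ i)) W z' - W z) \<le> e / 2"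
      proof (rule conv_mollifier_near[OF h W])
        fix z'' assume z'': "dist z' z'' \<le> (1/2) ^ i"
        have "dist z'' z < d"
          using dist_triangle[of z z'' z'] z' z'' k[OF i] by (simp add: dist_commute)
        then show "norm (W z'' - W z) \<le> e / 2"
          using d(2) by (simp add: dist_norm less_imp_le)
      qed
    qed
    then show ?thesis using \<open>0 < e\<close> by (simp add: dist_norm)
  qed
  then show "\<exists>k. \<forall>i\<ge>k. dist (conv (mollifier ((1/2) ^ i)) (conv (mollifier ((1/2) ^ i)) W) z) (W z) < e" by blast
qed

text \<open>The differences between scales i and i + 1 are summed from k on. A step costs a multiple
  of h^(2p-3) * h, that is \<open>\<rho> ^ i\<close>, and \<open>\<rho>\<close> is below 1 exactly
  because p > 1. The bound involves F only through its p-energy N and is the same for all admissible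
  W. Integrality is asked beyond radius b, since mollifying spreads the support of the potential by
  up to (1/2)^k.\<close>

lemma integer_flux_mollification_error:
  fixes F :: form2
  assumes F: "integrable lborel F" and Fm [measurable]: "F \<in> borel_measurable borel" and p: "1 < p"
    and N: "(\<integral>\<^sup>+z. ennreal (norm (F z) powr p) \<partial>lborel) \<le> ennreal N" "0 \<le> N"
    and T: "bdd_integrable \<Theta>" and W: "bdd_integrable W" "\<And>z. isCont W z" "\<And>z. norm (W z) \<le> 1"
    and der: "\<And>z. (\<Theta> has_derivative (\<lambda>w. W z \<bullet> w)) (at z)"
    and out: "\<And>z. b \<le> dist x z \<Longrightarrow> \<Theta> z = 0"
    and int: "\<And>y. dist x y < b + (1/2) ^ k \<Longrightarrow> AE r in lborel. 0 < r \<and> r < (1/2) ^ k \<longrightarrow> sphere_flux F y r \<in> \<int>"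
  defines "\<rho> \<equiv> (1/2) powr (2 * p - 2)"
  shows "\<bar>(LBINT z. F z \<bullet> W z) - (LBINT z. F z \<bullet> conv (mollifier ((1/2) ^ k)) (conv (mollifier ((1/2) ^ k)) W) z)\<bar>
    \<le> 6 * (128 * (4 * pi\<^sup>2) powr (p - 1)) * N * \<rho> ^ k / (1 - \<rho>)"
proof -
  define h where "h i = (1/2::real) ^ i" for i :: nat
  define K where "K = 128 * (4 * pi\<^sup>2) powr (p - 1)"
  have h: "0 < h i" "h (Suc i) = h i / 2" for i by (simp_all add: h_def)
  have K: "0 \<le> K" by (simp add: K_def)
  define V where "V i = conv (mollifier (h i)) (conv (mollifier (h i)) W)" for i
  define a where "a i = (LBINT z. F z \<bullet> V i z)" for i
  have V_bdd: "bdd_integrable (V i)" for i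
    unfolding V_def by (intro bdd_integrable_conv bdd_integrable_mollifier h W)
  have V1: "norm (V i z) \<le> 1" for i z
    unfolding V_def by (intro norm_conv_mollifier_le h W)
  have lip: "\<bar>\<Theta> y - \<Theta> z\<bar> \<le> dist y z" for y z
    using gradient_bound_lipschitz[of \<Theta> W 1, OF der W(3)] by simp
  have FV: "integrable lborel (\<lambda>z. F z \<bullet> V i z)" for i
    by (rule integrable_inner_bounded[OF F bdd_integrableD(1)[OF V_bdd] V1])
  have step: "\<bar>a i - a (Suc i)\<bar> \<le> 6 * K * N * \<rho> ^ i" if i: "k \<le> i" for i
  proof -
    define \<phi> where "\<phi> z = conv (mollifier (h i)) \<Theta> z - conv (mollifier (h (Suc i))) \<Theta> z" for z
    have n\<phi>: "bdd_integrable \<phi>"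
      unfolding \<phi>_def[abs_def] by (intro bdd_integrable_diff bdd_integrable_conv bdd_integrable_mollifier h T)
    have near: "\<bar>conv (mollifier (h j)) \<Theta> z - \<Theta> z\<bar> \<le> h j" for j z
    proof -
      have "norm (conv (mollifier (h j)) \<Theta> z - \<Theta> z) \<le> h j"
      proof (rule conv_mollifier_near[OF h(1)[of j] T])
        fix z' assume "dist z z' \<le> h j"
        then show "norm (\<Theta> z' - \<Theta> z) \<le> h j"
          using lip[of z' z] by (simp add: dist_commute)
      qed
      then show ?thesis by simp
    qed
    \<comment> \<open>A mollification moves a function with Lipschitz constant 1 by at most its
      scale, so the difference is at most h i + h i / 2.\<close>
    have S: "\<bar>\<phi> y\<bar> \<le> 2 * h i" for y
      using near[of i y] near[of "Suc i" y] h[of i] unfolding \<phi>_def by linarith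
    have hk: "h i \<le> h k" using i by (simp add: h_def power_decreasing)
    then have hsk: "h (Suc i) \<le> h k" using h[of i] by linarith
    \<comment> \<open>Beyond this radius both mollifications average only zeros of
      \<open>\<Theta>\<close>, as their scales do not exceed h k.\<close>
    have supp: "dist x y < b + h k" if "\<phi> y \<noteq> 0" for y
    proof (rule ccontr)
      assume far: "\<not> ?thesis"
      have zero: "conv (mollifier (h j)) \<Theta> y = 0" if "h j \<le> h k" for j
      proof -
        have "norm (\<Theta> z' - 0) \<le> 0" if "dist y z' \<le> h j" for z'
          using out[of z'] far that \<open>h j \<le> h k\<close> dist_triangle[of x y z'] by (simp add: dist_commute)
        then show ?thesis
          using conv_mollifier_near[OF h(1)[of j] T, of y 0 0] by simp
      qed
      have "\<phi> y = 0" unfolding \<phi>_def zero[OF hk] zero[OF hsk] by simp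
      then show False using that by simp
    qed
    have int': "AE r in lborel. 0 < r \<and> r < h j \<longrightarrow> sphere_flux F y r \<in> \<int>" if "\<phi> y \<noteq> 0" "h j \<le> h k" for y j
    proof -
      have "AE r in lborel. 0 < r \<and> r < h k \<longrightarrow> sphere_flux F y r \<in> \<int>"
        using supp[OF that(1)] unfolding h_def by (rule int)
      then show ?thesis
      proof eventually_elim
        case (elim r)
        then show ?case using less_le_trans[OF _ that(2), of r] by blast
      qed
    qed
    have bnd: "\<bar>\<integral>z. F z \<bullet> conv \<phi> (mollifier_grad (h j)) z \<partial>lborel\<bar> \<le> 2 * h i * K * h j powr (2 * p - 3) * N" if "h j \<le> h k" for j
      unfolding K_def
      by (rule integer_flux_pairing_le[OF F Fm p h(1) N n\<phi> S]) (rule int'[OF _ that])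
    have "V i z - V (Suc i) z = conv \<phi> (mollifier_grad (h i)) z + conv \<phi> (mollifier_grad (h (Suc i))) z" for z
      using mollifier_telescope[OF h(1)[of i] h(1)[of "Suc i"] T W(1) der, of z] unfolding V_def \<phi>_def[abs_def] .
    then have V_split: "F z \<bullet> V i z - F z \<bullet> V (Suc i) z = F z \<bullet> conv \<phi> (mollifier_grad (h i)) z + F z \<bullet> conv \<phi> (mollifier_grad (h (Suc i))) z" for z
      unfolding inner_diff_right[symmetric] inner_add_right[symmetric] by (rule arg_cong)
    have iconv: "integrable lborel (\<lambda>z. F z \<bullet> conv \<phi> (mollifier_grad (h j)) z)" for j
    proof -
      have n: "bdd_integrable (conv \<phi> (mollifier_grad (h j)))" by (intro bdd_integrable_conv n\<phi> bdd_integrable_mollifier_grad h)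
      obtain M where "\<And>z. norm (conv \<phi> (mollifier_grad (h j)) z) \<le> M" using bdd_integrableD(3)[OF n] by blast
      then show ?thesis by (rule integrable_inner_bounded[OF F bdd_integrableD(1)[OF n]])
    qed
    have "a i - a (Suc i) = (LBINT z. F z \<bullet> V i z - F z \<bullet> V (Suc i) z)"
      unfolding a_def by (rule Bochner_Integration.integral_diff[OF FV FV, symmetric])
    also have "\<dots> = (LBINT z. F z \<bullet> conv \<phi> (mollifier_grad (h i)) z) + (LBINT z. F z \<bullet> conv \<phi> (mollifier_grad (h (Suc i))) z)"
      unfolding V_split by (rule Bochner_Integration.integral_add[OF iconv iconv])
    finally have "a i - a (Suc i) = (LBINT z. F z \<bullet> conv \<phi> (mollifier_grad (h i)) z) + (LBINT z. F z \<bullet> conv \<phi> (mollifier_grad (h (Suc i))) z)" .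
    then have "\<bar>a i - a (Suc i)\<bar> \<le> 2 * h i * K * h i powr (2 * p - 3) * N + 2 * h i * K * h (Suc i) powr (2 * p - 3) * N"
      using bnd[OF hk] bnd[OF hsk] by linarith
    \<comment> \<open>The exponent 2p - 3 may be negative, and then halving h enlarges the power;
      the loss \<open>2 powr (3 - 2 * p)\<close> is below 2 since p > 1. The constant 6 is 2 + 2 *
      2.\<close>
    also have "\<dots> \<le> 2 * h i * K * h i powr (2 * p - 3) * N + 2 * h i * K * (2 * h i powr (2 * p - 3)) * N"
    proof -
      have "h (Suc i) powr e = h i powr e * 2 powr (- e)" for e
        unfolding h(2) powr_divide powr_minus by (rule divide_inverse)
      from this[of "2 * p - 3"]
      have "h (Suc i) powr (2 * p - 3) = h i powr (2 * p - 3) * 2 powr (3 - 2 * p)"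
        by (simp only: minus_diff_eq)
      also have "\<dots> \<le> h i powr (2 * p - 3) * 2 powr 1"
        using p by (intro mult_left_mono powr_mono) auto
      finally have "h (Suc i) powr (2 * p - 3) \<le> 2 * h i powr (2 * p - 3)"
        by (simp add: mult.commute)
      then show ?thesis
        using less_imp_le[OF h(1)[of i]] K N(2) by (intro add_left_mono mult_right_mono mult_left_mono) simp_all
    qed
    also have "\<dots> = 6 * K * N * (h i powr (2 * p - 3) * h i)"
      by (simp add: algebra_simps)
    also have "h i powr (2 * p - 3) * h i = h i powr (2 * p - 2)"
    proof -
      have "h i powr (2 * p - 3) * h i powr 1 = h i powr (2 * p - 2)"
        unfolding powr_add[symmetric] by (rule arg_cong) simp
      then show ?thesis using h(1)[of i] by simp
    qed
    also have "\<dots> = \<rho> ^ i"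
    proof -
      have "h i = (1/2) powr real i" by (simp add: h_def powr_realpow)
      then have "h i powr (2 * p - 2) = (1/2) powr (real i * (2 * p - 2))" by (simp only: powr_powr)
      then show ?thesis by (simp add: \<rho>_def powr_power)
    qed
    finally show ?thesis .
  qed
  \<comment> \<open>Continuity of W gives pointwise convergence and |V i| <= 1 gives domination, so
    the telescoping sum ends at W itself.\<close>
  have "a \<longlonglongrightarrow> (LBINT z. F z \<bullet> W z)"
    unfolding a_def
  proof (rule integral_dominated_convergence[where w="\<lambda>z. norm (F z)"])
    show "AE z in lborel. (\<lambda>i. F z \<bullet> V i z) \<longlonglongrightarrow> F z \<bullet> W z"
      unfolding V_def h_def by (intro AE_I2 tendsto_inner tendsto_const conv_mollifier_tendsto W)
    show "AE z in lborel. norm (F z \<bullet> V i z) \<le> norm (F z)" for i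
    proof (rule AE_I2)
      fix z
      have "\<bar>F z \<bullet> V i z\<bar> \<le> norm (F z) * norm (V i z)" by (rule Cauchy_Schwarz_ineq2)
      also have "\<dots> \<le> norm (F z) * 1" by (intro mult_left_mono V1) simp
      finally show "norm (F z \<bullet> V i z) \<le> norm (F z)" by simp
    qed
    show "(\<lambda>z. F z \<bullet> W z) \<in> borel_measurable lborel" using bdd_integrableD(1)[OF W(1)] by simp
    show "(\<lambda>z. F z \<bullet> V i z) \<in> borel_measurable lborel" for i using bdd_integrableD(1)[OF V_bdd] by simp
  qed (use F in simp)
  moreover have "0 \<le> \<rho>" by (simp add: \<rho>_def)
  moreover have "\<rho> < 1"
    using p powr_less_mono2[of "2 * p - 2" "1/2" 1] by (simp add: \<rho>_def)
  ultimately have "\<bar>(LBINT z. F z \<bullet> W z) - a k\<bar> \<le> 6 * K * N * \<rho> ^ k / (1 - \<rho>)"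
    using K N(2) by (intro geometric_telescope[OF step]) auto
  then show ?thesis unfolding a_def V_def h_def K_def .
qed

section \<open>The flux of the weak limit\<close>

text \<open>The unit normal field is discontinuous at the centre; since \<open>\<theta>\<close>
  vanishes up to the radius a > 0, the product is identically 0 near x.\<close>

lemma
  fixes \<theta> :: "real \<Rightarrow> real" and x :: "real^3"
  assumes cont: "continuous_on UNIV \<theta>" and bd: "\<And>r. \<bar>\<theta> r\<bar> \<le> 1" and a: "0 < a"
    and zero: "\<And>r. r \<le> a \<or> b \<le> r \<Longrightarrow> \<theta> r = 0"
  shows bdd_integrable_radial: "bdd_integrable (\<lambda>z. radial \<theta> (z - x))"
    and isCont_radial: "isCont (\<lambda>z. radial \<theta> (z - x)) z"
proof -
  have [measurable]: "\<theta> \<in> borel_measurable borel"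
    using cont by (rule borel_measurable_continuous_onI)
  show "bdd_integrable (\<lambda>z. radial \<theta> (z - x))"
  proof (rule bdd_integrable_bounded_support[where M=1 and R=b and x=x])
    show "norm (radial \<theta> (z - x)) \<le> 1" for z
      by (rule norm_radial_le) (rule bd)
    show "b \<le> dist x z \<Longrightarrow> radial \<theta> (z - x) = 0" for z
      using zero[of "dist x z"] by (simp add: radial_def dist_norm norm_minus_commute)
  qed measurable
  show "isCont (\<lambda>z. radial \<theta> (z - x)) z"
  proof (cases "z = x")
    case True
    have "eventually (\<lambda>z. z \<in> ball x a) (nhds x)"
      using a by (intro eventually_nhds_in_open) auto
    then have "eventually (\<lambda>z. radial \<theta> (z - x) = 0) (nhds x)"
      by eventually_elim (simp add: radial_def zero dist_norm norm_minus_commute)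
    then have "isCont (\<lambda>z. radial \<theta> (z - x)) x \<longleftrightarrow> isCont (\<lambda>z. 0 :: real^3) x"
      by (rule isCont_cong)
    then show ?thesis using True by simp
  next
    case False
    have "isCont \<theta> (norm (z - x))"
      using cont by (simp add: continuous_on_eq_continuous_at)
    moreover have "isCont (\<lambda>z. norm (z - x)) z"
      unfolding isCont_def by (intro tendsto_norm tendsto_diff tendsto_ident_at tendsto_const)
    ultimately have "isCont (\<lambda>z. \<theta> (norm (z - x))) z"
      by (rule isCont_o2[rotated])
    moreover have "isCont (\<lambda>z. (z - x) /\<^sub>R norm (z - x)) z"
      unfolding isCont_def
      by (intro tendsto_scaleR tendsto_inverse tendsto_norm tendsto_diff tendsto_ident_at tendsto_const) (use False in simp)
    ultimately show ?thesis
      unfolding radial_def sgn_div_norm isCont_def by (rule tendsto_scaleR)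
  qed
qed

text \<open>A radial field is a gradient: its potential is an antiderivative of
  \<open>\<theta>\<close> evaluated at the distance to x. It is constant within distance a, which
  gives differentiability at x, where the norm has none.\<close>

lemma radial_potential:
  fixes \<theta> :: "real \<Rightarrow> real" and x :: "real^3"
  assumes cont: "continuous_on UNIV \<theta>" and a: "0 < a" and ab: "a < b"
    and zero: "\<And>r. r \<le> a \<or> b \<le> r \<Longrightarrow> \<theta> r = 0"
  shows "\<exists>\<Theta>. bdd_integrable \<Theta> \<and> (\<forall>z. (\<Theta> has_derivative (\<lambda>w. radial \<theta> (z - x) \<bullet> w)) (at z)) \<and> (\<forall>z. b \<le> dist x z \<longrightarrow> \<Theta> z = 0)"
proof -
  \<comment> \<open>Subtracting the integral up to b makes the potential vanish beyond b; compact
    support is what makes it integrable and confines the centres of the flux estimate.\<close>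
  define T where "T s = integral {0..s} \<theta> - integral {0..b} \<theta>" for s
  define \<Theta> where "\<Theta> z = T (norm (z - x))" for z
  have int: "\<theta> integrable_on {r..s}" for r s
    using continuous_on_subset[OF cont] by (intro integrable_continuous_interval) auto
  have T': "(T has_real_derivative \<theta> s) (at s)" if "0 < s" for s
  proof -
    have "((\<lambda>s. integral {0..s} \<theta>) has_real_derivative \<theta> s) (at s within {0..s + 1})"
      using that continuous_on_subset[OF cont] by (intro integral_has_real_derivative) auto
    then have "((\<lambda>s. integral {0..s} \<theta>) has_real_derivative \<theta> s) (at s)"
      using that by (simp add: at_within_Icc_at)
    from DERIV_diff[OF this DERIV_const] show ?thesis
      unfolding T_def[abs_def] by simp
  qed
  have Tb: "T s = 0" if "b \<le> s" for s
  proof -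
    have "integral {b..s} \<theta> = integral {b..s} (\<lambda>_. 0)"
      by (rule Henstock_Kurzweil_Integration.integral_cong) (simp add: zero)
    moreover have "integral {0..b} \<theta> + integral {b..s} \<theta> = integral {0..s} \<theta>"
      using a ab that by (intro Henstock_Kurzweil_Integration.integral_combine int) auto
    ultimately show ?thesis by (simp add: T_def)
  qed
  have Ta: "T s = - integral {0..b} \<theta>" if "s \<le> a" for s
  proof -
    have "integral {0..s} \<theta> = integral {0..s} (\<lambda>_. 0)"
      using that by (intro Henstock_Kurzweil_Integration.integral_cong) (simp add: zero)
    then show ?thesis by (simp add: T_def)
  qed
  have out: "\<Theta> z = 0" if "b \<le> dist x z" for z
    using Tb that by (simp add: \<Theta>_def dist_norm norm_minus_commute)
  have der: "(\<Theta> has_derivative (\<lambda>w. radial \<theta> (z - x) \<bullet> w)) (at z)" for z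
  proof (cases "z = x")
    case True
    have "((\<lambda>z. - integral {0..b} \<theta>) has_derivative (\<lambda>w. 0)) (at x)" by simp
    then have "(\<Theta> has_derivative (\<lambda>w. 0)) (at x)"
      by (rule has_derivative_transform_within_open[where s="ball x a"])
        (use a Ta in \<open>auto simp: \<Theta>_def dist_norm norm_minus_commute\<close>)
    then show ?thesis using True by (simp add: radial_def)
  next
    case False
    have "((\<lambda>z. norm (z - x)) has_derivative (\<lambda>w. w \<bullet> sgn (z - x))) (at z)"
    proof -
      have "((\<lambda>z. z - x) has_derivative (\<lambda>w. w)) (at z)"
        by (auto intro!: derivative_eq_intros)
      from has_derivative_compose[OF this has_derivative_norm] show ?thesis using False by simp
    qed
    from has_derivative_compose[OF this, of T] T'[of "norm (z - x)"] False
    have "(\<Theta> has_derivative (\<lambda>w. \<theta> (norm (z - x)) * (w \<bullet> sgn (z - x)))) (at z)"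
      unfolding \<Theta>_def[abs_def] has_field_derivative_def by simp
    then show ?thesis by (simp add: radial_def inner_commute)
  qed
  have contT: "continuous_on UNIV \<Theta>"
    by (intro continuous_at_imp_continuous_on ballI has_derivative_continuous[OF der])
  have "bounded (\<Theta> ` cball x b)"
    using continuous_on_subset[OF contT] by (intro compact_imp_bounded compact_continuous_image) auto
  then obtain M where M: "\<And>z. z \<in> cball x b \<Longrightarrow> norm (\<Theta> z) \<le> M"
    unfolding bounded_iff by blast
  have "bdd_integrable \<Theta>"
  proof (rule bdd_integrable_bounded_support[OF borel_measurable_continuous_onI[OF contT], where R=b and x=x and M="max 0 M"])
    show "norm (\<Theta> z) \<le> max 0 M" for z
      using M[of z] out[of z] by (cases "dist x z \<le> b") auto
  qed (rule out)
  then show ?thesis using der out by blast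
qed

text \<open>Duality for the L^1 norm on an interval. The ideal test function is the sign of g; it is
  an almost everywhere limit of continuous functions, and dominated convergence passes the bound to
  it.\<close>

lemma integral_abs_le_of_continuous_tests:
  fixes g :: "real \<Rightarrow> real"
  assumes g: "integrable lborel g"
    and test: "\<And>\<theta>. continuous_on UNIV \<theta> \<Longrightarrow> (\<And>r. \<bar>\<theta> r\<bar> \<le> 1) \<Longrightarrow> (\<And>r. r \<le> a \<or> b \<le> r \<Longrightarrow> \<theta> r = 0) \<Longrightarrow> \<bar>\<integral>r. \<theta> r * g r \<partial>lborel\<bar> \<le> e"
  shows "(LBINT r. indicator {a<..<b} r * \<bar>g r\<bar>) \<le> e"
proof -
  have gm: "g \<in> borel_measurable lborel" using g by (rule borel_measurable_integrable)
  then have "(\<lambda>r. sgn (g r)) \<in> borel_measurable lebesgue"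
    by (intro measurable_completion) simp
  then have "(\<lambda>r. sgn (g r)) measurable_on UNIV"
    by (intro lebesgue_measurable_imp_measurable_on_real) auto
  then obtain N c where N: "negligible N" and c: "\<And>n. continuous_on UNIV (c n)"
    "\<And>r. r \<notin> N \<Longrightarrow> (\<lambda>n. c n r) \<longlonglongrightarrow> sgn (g r)"
    by (auto simp: measurable_on_def)
  \<comment> \<open>The first factor clamps the approximant of the sign to [-1, 1]. The second is a
    continuous cutoff that vanishes outside the open interval from a to b and, at each point inside,
    equals 1 for all large n.\<close>
  define \<theta> where "\<theta> n r = max (- 1) (min 1 (c n r)) * max 0 (min 1 (real n * min (r - a) (b - r)))" for n r
  have \<theta>c: "continuous_on UNIV (\<theta> n)" for n
    unfolding \<theta>_def[abs_def] by (intro continuous_intros c(1))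
  have \<theta>1: "\<bar>\<theta> n r\<bar> \<le> 1" for n r
  proof -
    have "\<bar>\<theta> n r\<bar> \<le> 1 * 1"
      unfolding \<theta>_def abs_mult by (intro mult_mono) auto
    then show ?thesis by simp
  qed
  have \<theta>0: "\<theta> n r = 0" if "r \<le> a \<or> b \<le> r" for n r
  proof -
    have "real n * min (r - a) (b - r) \<le> 0"
      using that by (intro mult_nonneg_nonpos) auto
    then show ?thesis by (simp add: \<theta>_def)
  qed
  have lim: "(\<lambda>n. \<theta> n r) \<longlonglongrightarrow> indicator {a<..<b} r * sgn (g r)" if "r \<notin> N" for r
  proof (cases "r \<in> {a<..<b}")
    case True
    then have m: "0 < min (r - a) (b - r)" by auto
    obtain n0 :: nat where n0: "1 < real n0 * min (r - a) (b - r)"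
      using reals_Archimedean3[OF m] by blast
    have "max 0 (min 1 (real n * min (r - a) (b - r))) = 1" if "n0 \<le> n" for n
    proof -
      have "real n0 * min (r - a) (b - r) \<le> real n * min (r - a) (b - r)"
        using that m by (intro mult_right_mono) auto
      then show ?thesis using n0 by auto
    qed
    then have "eventually (\<lambda>n. max (- 1) (min 1 (c n r)) = \<theta> n r) sequentially"
      unfolding eventually_sequentially \<theta>_def by (intro exI[of _ n0]) simp
    moreover have "(\<lambda>n. max (- 1) (min 1 (c n r))) \<longlonglongrightarrow> max (- 1) (min 1 (sgn (g r)))"
      by (intro tendsto_max tendsto_min tendsto_const c that)
    moreover have "max (- 1) (min 1 (sgn (g r))) = sgn (g r)" by (simp add: sgn_if)
    ultimately show ?thesis
      using True by (auto intro: Lim_transform_eventually)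
  next
    case False
    then have "\<theta> n r = 0" for n by (intro \<theta>0) auto
    then show ?thesis using False by simp
  qed
  have "N \<in> null_sets lebesgue" using N by (simp add: negligible_iff_null_sets)
  then have "AE r in lebesgue. r \<notin> N" by (rule AE_not_in)
  then have AEN: "AE r in lborel. r \<notin> N" by (simp only: AE_completion_iff)
  have "(\<lambda>n. LBINT r. \<theta> n r * g r) \<longlonglongrightarrow> (LBINT r. indicator {a<..<b} r * \<bar>g r\<bar>)"
  proof (rule integral_dominated_convergence[where w="\<lambda>r. \<bar>g r\<bar>"])
    show "AE r in lborel. (\<lambda>n. \<theta> n r * g r) \<longlonglongrightarrow> indicator {a<..<b} r * \<bar>g r\<bar>"
      using AEN
    proof eventually_elim
      case (elim r)
      have "(\<lambda>n. \<theta> n r * g r) \<longlonglongrightarrow> indicator {a<..<b} r * sgn (g r) * g r"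
        by (intro tendsto_mult tendsto_const lim elim)
      then show ?case by (simp only: abs_sgn mult_ac)
    qed
    show "(\<lambda>r. \<theta> n r * g r) \<in> borel_measurable lborel" for n
      using borel_measurable_continuous_onI[OF \<theta>c] gm by simp
    show "AE r in lborel. norm (\<theta> n r * g r) \<le> \<bar>g r\<bar>" for n
      using \<theta>1 by (intro AE_I2) (simp add: abs_mult mult_left_le_one_le)
  qed (use g gm in auto)
  then have "(\<lambda>n. \<bar>\<integral>r. \<theta> n r * g r \<partial>lborel\<bar>) \<longlonglongrightarrow> \<bar>\<integral>r. indicator {a<..<b} r * \<bar>g r\<bar> \<partial>lborel\<bar>"
    by (rule tendsto_rabs)
  then have "\<bar>\<integral>r. indicator {a<..<b} r * \<bar>g r\<bar> \<partial>lborel\<bar> \<le> e"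
    using test[OF \<theta>c \<theta>1 \<theta>0] by (intro LIMSEQ_le_const2) auto
  then show ?thesis by linarith
qed

text \<open>At a fixed scale, smoothing turns weak into strong convergence: at each y the mollified
  field is a pairing with a fixed bounded test field, hence tends to 0, and it is dominated by a
  constant on the ball of radius R + h.\<close>

lemma weakly_null_mollified:
  fixes D :: "nat \<Rightarrow> real^3 \<Rightarrow> real^3"
  assumes h: "0 < h" and D: "\<And>n. integrable lborel (D n)" "\<And>n. D n \<in> borel_measurable borel"
    and out: "\<And>n z. R \<le> norm z \<Longrightarrow> D n z = 0"
    and L1: "\<And>n. (LBINT z. norm (D n z)) \<le> B"
    and weak: "\<And>g M. g \<in> borel_measurable borel \<Longrightarrow> (\<And>z. norm (g z) \<le> M) \<Longrightarrow> (\<lambda>n. LBINT z. D n z \<bullet> g z) \<longlonglongrightarrow> 0"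
  shows "(\<lambda>n. LBINT y. norm (LBINT z. mollifier h (z - y) *\<^sub>R D n z)) \<longlonglongrightarrow> 0"
    and "\<And>n. integrable lborel (\<lambda>y. norm (LBINT z. mollifier h (z - y) *\<^sub>R D n z))"
proof -
  let ?A = "\<lambda>n y. LBINT z. mollifier h (z - y) *\<^sub>R D n z"
  note molm = bdd_integrableD(1)[OF bdd_integrable_mollifier[OF h], measurable] and D(2)[measurable]
  obtain S where S: "0 \<le> S" "\<And>z. \<bar>mollifier h z\<bar> \<le> S" using bdd_integrableD(3)[OF bdd_integrable_mollifier[OF h]] by auto
  have iA: "integrable lborel (\<lambda>z. mollifier h (z - y) *\<^sub>R D n z)" for n y
  proof (rule Bochner_Integration.integrable_bound)
    show "integrable lborel (\<lambda>z. S * norm (D n z))" using D(1) by simp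
    show "AE z in lborel. norm (mollifier h (z - y) *\<^sub>R D n z) \<le> norm (S * norm (D n z))"
      using S order_trans[OF S(2) abs_ge_self] by (auto simp: abs_mult intro!: mult_right_mono)
  qed simp
  have Ab: "norm (?A n y) \<le> S * B" for n y
  proof -
    have "norm (?A n y) \<le> (LBINT z. norm (mollifier h (z - y) *\<^sub>R D n z))"
      by (rule integral_norm_bound)
    also have "\<dots> \<le> (LBINT z. S * norm (D n z))"
      using iA D(1) S by (intro integral_mono integrable_norm) (auto intro!: mult_right_mono)
    also have "\<dots> \<le> S * B" using L1 S by (simp add: mult_left_mono)
    finally show ?thesis .
  qed
  have A0: "?A n y = 0" if "y \<notin> ball 0 (R + h)" for n y
  proof -
    have "mollifier h (z - y) *\<^sub>R D n z = 0" for z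
    proof (cases "R \<le> norm z")
      case False
      then have "h \<le> norm (z - y)" using that norm_triangle_ineq2[of y z] by (simp add: norm_minus_commute)
      then show ?thesis by (simp add: mollifier_outside[OF h])
    qed (simp add: out)
    then show ?thesis by (simp only: integral_zero)
  qed
  have Am: "?A n \<in> borel_measurable lborel" for n
    by measurable
  have "(\<lambda>n. ?A n y $ i) \<longlonglongrightarrow> 0" for y i
  proof -
    have "?A n y $ i = (LBINT z. D n z \<bullet> (mollifier h (z - y) *\<^sub>R axis i 1))" for n
    proof -
      have "?A n y $ i = ?A n y \<bullet> axis i 1" by (simp add: inner_axis)
      also have "\<dots> = (LBINT z. (mollifier h (z - y) *\<^sub>R D n z) \<bullet> axis i 1)"
        by (rule integral_inner_left[symmetric]) (rule iA)
      finally show ?thesis by simp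
    qed
    moreover have "(\<lambda>n. LBINT z. D n z \<bullet> (mollifier h (z - y) *\<^sub>R axis i 1)) \<longlonglongrightarrow> 0"
      by (rule weak[where M=S]) (use S in auto)
    ultimately show ?thesis by simp
  qed
  then have Alim: "(\<lambda>n. ?A n y) \<longlonglongrightarrow> 0" for y
    by (intro vec_tendstoI) simp
  have dom: "norm (norm (?A n y)) \<le> S * B * indicator (ball 0 (R + h)) y" for n y
    using Ab A0 by (auto split: split_indicator)
  have iw: "integrable lborel (\<lambda>y. S * B * indicator (ball (0::real^3) (R + h)) y)"
    using emeasure_bounded_finite[OF bounded_ball, of "0::real^3" "R + h"]
    by (intro integrable_mult_right integrable_real_indicator) (auto simp: less_top)
  have "(\<lambda>n. LBINT y. norm (?A n y)) \<longlonglongrightarrow> (\<integral>y. 0 \<partial>(lborel :: (real^3) measure))"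
  proof (rule integral_dominated_convergence[OF _ _ iw])
    show "AE y in lborel. (\<lambda>n. norm (?A n y)) \<longlonglongrightarrow> 0"
      using Alim by (intro AE_I2 tendsto_norm_zero)
  qed (use dom Am in auto)
  then show "(\<lambda>n. LBINT y. norm (?A n y)) \<longlonglongrightarrow> 0" by simp
  show "integrable lborel (\<lambda>y. norm (?A n y))" for n
  proof (rule Bochner_Integration.integrable_bound[OF iw])
    show "AE y in lborel. norm (norm (?A n y)) \<le> norm (S * B * indicator (ball 0 (R + h)) y)"
      using order_trans[OF dom abs_ge_self] by (intro AE_I2) simp
  qed (use Am in simp)
qed

text \<open>Truncation at height 1: |F| <= 1 + |F|^p on the ball, and F vanishes off it.\<close>

lemma integrable_of_powr_integrable_on_ball:
  fixes F :: form2
  assumes Fm [measurable]: "F \<in> borel_measurable borel" and p: "1 < p" and out: "\<And>z. 1 \<le> norm z \<Longrightarrow> F z = 0"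
    and N: "(\<integral>\<^sup>+z. ennreal (norm (F z) powr p) \<partial>lborel) \<le> ennreal N" "0 \<le> N"
  shows "integrable lborel F" "(LBINT z. norm (F z)) \<le> measure lborel (ball (0::real^3) 1) + N"
proof -
  have fin: "emeasure lborel (ball (0::real^3) 1) < \<infinity>"
    by (rule emeasure_bounded_finite) simp
  have "(\<integral>\<^sup>+z. ennreal (norm (F z)) \<partial>lborel) \<le> (\<integral>\<^sup>+z. indicator (ball 0 1) z + ennreal (norm (F z) powr p) \<partial>lborel)"
  proof (rule nn_integral_mono)
    fix z
    have "norm (F z) \<le> indicator (ball 0 1) z + norm (F z) powr p"
      using le_truncation_powr[of "norm (F z)" 1 p] p out[of z] by (auto split: split_indicator)
    then have "ennreal (norm (F z)) \<le> ennreal (indicator (ball 0 1) z + norm (F z) powr p)"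
      by (rule ennreal_leI)
    then show "ennreal (norm (F z)) \<le> indicator (ball 0 1) z + ennreal (norm (F z) powr p)"
      by (simp add: ennreal_plus ennreal_indicator)
  qed
  also have "\<dots> = emeasure lborel (ball (0::real^3) 1) + (\<integral>\<^sup>+z. ennreal (norm (F z) powr p) \<partial>lborel)"
    by (subst nn_integral_add) (auto intro!: borel_measurable_indicator)
  also have "\<dots> \<le> ennreal (measure lborel (ball (0::real^3) 1)) + ennreal N"
    using fin N(1) by (intro add_mono) (auto simp: emeasure_eq_ennreal_measure)
  also have "\<dots> = ennreal (measure lborel (ball (0::real^3) 1) + N)"
    using N(2) by (simp add: ennreal_plus)
  finally have le: "(\<integral>\<^sup>+z. ennreal (norm (F z)) \<partial>lborel) \<le> ennreal (measure lborel (ball (0::real^3) 1) + N)" .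
  then show i: "integrable lborel F"
    by (intro integrableI_bounded) (auto intro: le_less_trans)
  show "(LBINT z. norm (F z)) \<le> measure lborel (ball (0::real^3) 1) + N"
    using le N(2)
    by (subst (asm) nn_integral_eq_integral[OF integrable_norm[OF i]]) (auto simp: ennreal_le_iff simp del: ennreal_plus)
qed

text \<open>Against a radial field W with profile \<open>\<theta>\<close>, the flux difference f n
  pairs like \<open>D n\<close>. With V the double mollification of W, this pairing splits into two
  replacement errors, for \<open>F n\<close> and for G, and the pairing of \<open>D n\<close> with
  V. All bounds are uniform in \<open>\<theta>\<close>, so duality turns them into L^1 convergence
  of the fluxes.\<close>

lemma limit_flux_integer:
  fixes F :: "nat \<Rightarrow> form2" and G :: form2
  assumes p: "1 < p" and Fm: "\<And>n. F n \<in> borel_measurable borel" and Gm: "G \<in> borel_measurable borel"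
    and Fout: "\<And>n z. 1 \<le> norm z \<Longrightarrow> F n z = 0" and Gout: "\<And>z. 1 \<le> norm z \<Longrightarrow> G z = 0"
    and N: "\<And>n. (\<integral>\<^sup>+z. ennreal (norm (F n z) powr p) \<partial>lborel) \<le> ennreal N" "0 \<le> N"
    and G: "integrable lborel G"
    and int: "\<And>n y. norm y < 1 \<Longrightarrow> AE r in lborel. 0 < r \<and> r < 1 - norm y \<longrightarrow> sphere_flux (F n) y r \<in> \<int>"
    and weak: "\<And>g M. g \<in> borel_measurable borel \<Longrightarrow> (\<And>z. norm (g z) \<le> M) \<Longrightarrow>
      (\<lambda>n. LBINT z. F n z \<bullet> g z) \<longlonglongrightarrow> (LBINT z. G z \<bullet> g z)"
    and x: "norm x < 1"
  shows "AE r in lborel. 0 < r \<and> r < 1 - norm x \<longrightarrow> sphere_flux G x r \<in> \<int>"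
proof -
  have Fi: "integrable lborel (F n)" "(LBINT z. norm (F n z)) \<le> measure lborel (ball (0::real^3) 1) + N" for n
    using integrable_of_powr_integrable_on_ball[OF Fm p _ N] Fout by blast+
  define D where "D n z = F n z - G z" for n z
  define f where "f n r = indicator {0<..} r * sphere_flux (F n) x r - indicator {0<..} r * sphere_flux G x r" for n r
  have fi: "integrable lborel (f n)" for n
    unfolding f_def[abs_def]
    by (intro Bochner_Integration.integrable_diff integrable_sphere_flux Fi G Fm Gm)
  have Di: "integrable lborel (D n)" for n
    unfolding D_def[abs_def] by (intro Bochner_Integration.integrable_diff Fi G)
  have Dm: "D n \<in> borel_measurable borel" for n
    unfolding D_def[abs_def] by (intro borel_measurable_diff Fm Gm)
  have Dout: "D n z = 0" if "1 \<le> norm z" for n z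
    using that by (simp add: D_def Fout Gout)
  define B where "B = measure lborel (ball (0::real^3) 1) + N + (LBINT z. norm (G z))"
  have DB: "(LBINT z. norm (D n z)) \<le> B" for n
  proof -
    have "(LBINT z. norm (D n z)) \<le> (LBINT z. norm (F n z) + norm (G z))"
      unfolding D_def
      by (intro integral_mono norm_triangle_ineq4 integrable_norm Bochner_Integration.integrable_add
          Bochner_Integration.integrable_diff Fi(1) G)
    also have "\<dots> = (LBINT z. norm (F n z)) + (LBINT z. norm (G z))"
      by (intro Bochner_Integration.integral_add integrable_norm Fi G)
    also have "\<dots> \<le> B" using Fi(2)[of n] by (simp add: B_def)
    finally show ?thesis .
  qed
  have pairD: "(LBINT z. D n z \<bullet> g z) = (LBINT z. F n z \<bullet> g z) - (LBINT z. G z \<bullet> g z)"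
    if "g \<in> borel_measurable borel" "\<And>z. norm (g z) \<le> M" for g M n
    unfolding D_def inner_diff_left
    by (intro Bochner_Integration.integral_diff integrable_inner_bounded[OF _ that] Fi G)
  have weakD: "(\<lambda>n. LBINT z. D n z \<bullet> g z) \<longlonglongrightarrow> 0"
    if "g \<in> borel_measurable borel" "\<And>z. norm (g z) \<le> M" for g M
    unfolding pairD[OF that] using tendsto_diff[OF weak[OF that] tendsto_const[of "LBINT z. G z \<bullet> g z"]] by simp
  define \<rho> where "\<rho> = (1/2::real) powr (2 * p - 2)"
  define E where "E k = 6 * (128 * (4 * pi\<^sup>2) powr (p - 1)) * N * \<rho> ^ k / (1 - \<rho>)" for k :: nat
  have \<rho>: "0 \<le> \<rho>" "\<rho> < 1"
    using p powr_less_mono2[of "2 * p - 2" "1/2" 1] by (simp_all add: \<rho>_def)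
  have E0: "E \<longlonglongrightarrow> 0"
  proof -
    have "(\<lambda>k. 6 * (128 * (4 * pi\<^sup>2) powr (p - 1)) * N * \<rho> ^ k / (1 - \<rho>)) \<longlonglongrightarrow> 6 * (128 * (4 * pi\<^sup>2) powr (p - 1)) * N * 0 / (1 - \<rho>)"
      using \<rho> by (intro tendsto_divide tendsto_mult tendsto_const LIMSEQ_realpow_zero) auto
    then show ?thesis by (simp add: E_def[abs_def])
  qed
  have L1: "(\<lambda>n. LBINT r. indicator {a<..<b} r * \<bar>f n r\<bar>) \<longlonglongrightarrow> 0"
    if a: "0 < a" and ab: "a < b" and b: "b < 1 - norm x" for a b
  proof (rule LIMSEQ_I)
    fix e :: real assume e: "0 < e"
    \<comment> \<open>The scale k comes first and n0 depends on it; neither may depend on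
      \<open>\<theta>\<close>. The second condition on k keeps all balls of the flux estimate inside
      the unit ball.\<close>
    have "eventually (\<lambda>k. E k < e / 4) sequentially"
      using E0 e by (intro order_tendstoD) auto
    moreover have "eventually (\<lambda>k. (1/2::real) ^ k < (1 - norm x - b) / 2) sequentially"
      using b by (intro order_tendstoD[OF LIMSEQ_realpow_zero]) auto
    ultimately have "eventually (\<lambda>k. E k < e / 4 \<and> (1/2::real) ^ k < (1 - norm x - b) / 2) sequentially"
      by (rule eventually_conj)
    then obtain k where k: "E k < e / 4" "(1/2::real) ^ k < (1 - norm x - b) / 2"
      by (auto simp: eventually_sequentially)
    define h where "h = (1/2::real) ^ k"
    have h: "0 < h" by (simp add: h_def)
    let ?A = "\<lambda>n y. LBINT z. mollifier h (z - y) *\<^sub>R D n z"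
    have null: "(\<lambda>n. LBINT y. norm (?A n y)) \<longlonglongrightarrow> 0"
      by (rule weakly_null_mollified(1)[OF h Di Dm]) (fact Dout, fact DB, fact weakD)
    have null_int: "integrable lborel (\<lambda>y. norm (?A n y))" for n
      by (rule weakly_null_mollified(2)[OF h Di Dm]) (fact Dout, fact DB, fact weakD)
    have "eventually (\<lambda>n. (LBINT y. norm (?A n y)) < e / 4) sequentially"
      using e by (intro order_tendstoD[OF null]) auto
    then obtain n0 where n0: "\<And>n. n0 \<le> n \<Longrightarrow> (LBINT y. norm (?A n y)) < e / 4"
      by (auto simp: eventually_sequentially)
    \<comment> \<open>The three quarters are the replacement error for \<open>F n\<close>, the same
      error for G, and the mollified difference.\<close>
    have test: "\<bar>\<integral>r. \<theta> r * f n r \<partial>lborel\<bar> \<le> 3 * e / 4"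
      if \<theta>: "continuous_on UNIV \<theta>" "\<And>r. \<bar>\<theta> r\<bar> \<le> 1" "\<And>r. r \<le> a \<or> b \<le> r \<Longrightarrow> \<theta> r = 0" and n: "n0 \<le> n" for \<theta> n
    proof -
      define W where "W z = radial \<theta> (z - x)" for z
      obtain \<Theta> where T: "bdd_integrable \<Theta>" "\<And>z. (\<Theta> has_derivative (\<lambda>w. W z \<bullet> w)) (at z)" "\<And>z. b \<le> dist x z \<Longrightarrow> \<Theta> z = 0"
        using radial_potential[OF \<theta>(1) a ab \<theta>(3), of x] unfolding W_def by blast
      have W: "bdd_integrable W" "\<And>z. isCont W z" "\<And>z. norm (W z) \<le> 1"
        unfolding W_def[abs_def]
        using bdd_integrable_radial[OF \<theta>(1,2) a \<theta>(3)] isCont_radial[OF \<theta>(1,2) a \<theta>(3)] norm_radial_le[OF \<theta>(2)] by simp_all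
      define U where "U = conv (mollifier h) W"
      define V where "V = conv (mollifier h) U"
      have U: "bdd_integrable U" "\<And>z. norm (U z) \<le> 1"
        unfolding U_def by (intro bdd_integrable_conv bdd_integrable_mollifier h W norm_conv_mollifier_le)+
      have V: "bdd_integrable V" "\<And>z. norm (V z) \<le> 1"
        unfolding V_def by (intro bdd_integrable_conv bdd_integrable_mollifier h U norm_conv_mollifier_le)+
      have errF: "\<bar>(LBINT z. F m z \<bullet> W z) - (LBINT z. F m z \<bullet> V z)\<bar> \<le> E k" for m
        unfolding E_def \<rho>_def V_def U_def h_def
      proof (rule integer_flux_mollification_error[OF Fi(1) Fm p N T(1) W T(2,3)])
        \<comment> \<open>A centre y satisfies |y| < |x| + b + h, and the choice of k gives 2 * h <
          1 - |x| - b; hence h < 1 - |y|, and every radius below h is admissible at y.\<close>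
        fix y assume y: "dist x y < b + (1/2) ^ k"
        have "norm y \<le> norm x + dist x y"
          using norm_triangle_ineq2[of y x] by (simp add: dist_norm norm_minus_commute)
        moreover have "dist x y < b + h" using y unfolding h_def .
        moreover have "2 * h < 1 - norm x - b" using k(2) unfolding h_def[symmetric] by simp
        ultimately have hy: "h < 1 - norm y" by linarith
        then have "norm y < 1" using h by linarith
        with hy show "AE r in lborel. 0 < r \<and> r < (1/2) ^ k \<longrightarrow> sphere_flux (F m) y r \<in> \<int>"
          using int[of y m] unfolding h_def by (auto elim!: eventually_mono)
      qed
      \<comment> \<open>G is not yet known to have integer fluxes, so its error bound is the weak
        limit of those of \<open>F m\<close>, for the same fixed W and V.\<close>
      have "(\<lambda>m. \<bar>(LBINT z. F m z \<bullet> W z) - (LBINT z. F m z \<bullet> V z)\<bar>) \<longlonglongrightarrow> \<bar>(LBINT z. G z \<bullet> W z) - (LBINT z. G z \<bullet> V z)\<bar>"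
        by (intro tendsto_rabs tendsto_diff weak[OF bdd_integrableD(1)[OF W(1)] W(3)] weak[OF bdd_integrableD(1)[OF V(1)] V(2)])
      then have errG: "\<bar>(LBINT z. G z \<bullet> W z) - (LBINT z. G z \<bullet> V z)\<bar> \<le> E k"
        by (rule LIMSEQ_le_const2) (use errF in blast)
      have mid: "\<bar>\<integral>z. D n z \<bullet> V z \<partial>lborel\<bar> \<le> e / 4"
      proof -
        \<comment> \<open>The outer mollification is moved onto \<open>D n\<close>, where it yields
          strong smallness; what remains on the test side is U, bounded by 1 for every
          \<open>\<theta>\<close>, so n0 need not depend on \<open>\<theta>\<close>.\<close>
        have "(LBINT z. D n z \<bullet> V z) = (LBINT y. ?A n y \<bullet> U y)"
          unfolding V_def by (rule conv_pairing(2)[OF Di Dm bdd_integrable_mollifier[OF h] U(1)])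
        also have "\<bar>\<dots>\<bar> \<le> (LBINT y. norm (?A n y))"
        proof (rule order_trans[OF integral_abs_bound])
          show "(LBINT y. \<bar>?A n y \<bullet> U y\<bar>) \<le> (LBINT y. norm (?A n y))"
          proof (rule integral_mono')
            fix y
            have "\<bar>?A n y \<bullet> U y\<bar> \<le> norm (?A n y) * norm (U y)" by (rule Cauchy_Schwarz_ineq2)
            also have "\<dots> \<le> norm (?A n y) * 1" by (intro mult_left_mono U) simp
            finally show "\<bar>?A n y \<bullet> U y\<bar> \<le> norm (?A n y)" by simp
          qed (use null_int in auto)
        qed
        finally show ?thesis using n0[OF n] by linarith
      qed
      have \<theta>b: "\<theta> \<in> borel_measurable borel" by (rule borel_measurable_continuous_onI[OF \<theta>(1)])
      have "(LBINT r. \<theta> r * f n r) = (LBINT z. F n z \<bullet> W z) - (LBINT z. G z \<bullet> W z)"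
      proof -
        have i: "integrable lborel (\<lambda>r. \<theta> r * (indicator {0<..} r * sphere_flux H x r))"
          if "integrable lborel H" "H \<in> borel_measurable borel" for H
        proof (rule Bochner_Integration.integrable_bound[OF integrable_sphere_flux[OF that, of x]])
          show "AE r in lborel. norm (\<theta> r * (indicator {0<..} r * sphere_flux H x r)) \<le> norm (indicator {0<..} r * sphere_flux H x r)"
            using \<theta>(2) by (intro AE_I2) (simp add: abs_mult mult_left_le_one_le)
        qed (use \<theta>b borel_measurable_integrable[OF integrable_sphere_flux[OF that, of x]] in simp)
        show ?thesis
          unfolding W_def integral_inner_radial[OF Fi(1) Fm \<theta>b \<theta>(2)] integral_inner_radial[OF G Gm \<theta>b \<theta>(2)]
            f_def right_diff_distrib
          by (intro Bochner_Integration.integral_diff i Fi G Fm Gm)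
      qed
      moreover have "(LBINT z. D n z \<bullet> V z) = (LBINT z. F n z \<bullet> V z) - (LBINT z. G z \<bullet> V z)"
        by (rule pairD[OF bdd_integrableD(1)[OF V(1)] V(2)])
      ultimately show ?thesis
        using errF[of n] errG mid k(1) by linarith
    qed
    have "norm ((LBINT r. indicator {a<..<b} r * \<bar>f n r\<bar>) - 0) < e" if n: "n0 \<le> n" for n
    proof -
      have "(LBINT r. indicator {a<..<b} r * \<bar>f n r\<bar>) \<le> 3 * e / 4"
        by (rule integral_abs_le_of_continuous_tests[OF fi]) (rule test[OF _ _ _ n])
      moreover have "0 \<le> (LBINT r. indicator {a<..<b} r * \<bar>f n r\<bar>)"
        by (rule Bochner_Integration.integral_nonneg) simp
      ultimately show ?thesis using e by simp
    qed
    then show "\<exists>n0. \<forall>n\<ge>n0. norm ((LBINT r. indicator {a<..<b} r * \<bar>f n r\<bar>) - 0) < e" by blast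
  qed
  have AEn: "AE r in lborel. \<forall>n. 0 < r \<and> r < 1 - norm x \<longrightarrow> sphere_flux (F n) x r \<in> \<int>"
    unfolding AE_all_countable using int[OF x] by blast
  have AEab: "AE r in lborel. a < r \<and> r < b \<longrightarrow> sphere_flux G x r \<in> \<int>"
    if a: "0 < a" and ab: "a < b" and b: "b < 1 - norm x" for a b
  proof -
    have i: "integrable lborel (\<lambda>r. indicator {a<..<b} r * f n r)" for n
      using integrable_mult_indicator[OF _ fi[of n], of "{a<..<b}"] by simp
    have "(\<lambda>n. LBINT r. norm (indicator {a<..<b} r * f n r)) \<longlonglongrightarrow> 0"
      using L1[OF a ab b] by (simp add: abs_mult)
    \<comment> \<open>L^1 convergence gives almost everywhere convergence of the fluxes along a
      subsequence, and the integers are closed.\<close>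
    from tendsto_L1_AE_subseq[OF i this]
    obtain s where s: "AE r in lborel. (\<lambda>n. indicator {a<..<b} r * f (s n) r) \<longlonglongrightarrow> 0" by blast
    show ?thesis
      using s AEn
    proof eventually_elim
      case (elim r)
      show ?case
      proof
        assume r: "a < r \<and> r < b"
        then have r0: "0 < r" "r < 1 - norm x" using a b by auto
        have "(\<lambda>n. sphere_flux (F (s n)) x r - sphere_flux G x r) \<longlonglongrightarrow> 0"
          using elim(1) r r0 by (simp add: f_def)
        from tendsto_add[OF this tendsto_const[of "sphere_flux G x r"]]
        have "(\<lambda>n. sphere_flux (F (s n)) x r) \<longlonglongrightarrow> sphere_flux G x r" by simp
        then show "sphere_flux G x r \<in> \<int>"
          using elim(2) r0 by (intro Lim_in_closed_set[OF closed_Ints]) auto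
      qed
    qed
  qed
  \<comment> \<open>The interval of radii is exhausted by countably many subintervals at positive
    distance from both ends, so the exceptional null sets can be united.\<close>
  have "AE r in lborel. \<forall>j::nat. 1 / real (Suc j) < r \<and> r < (1 - norm x) - 1 / real (Suc j) \<longrightarrow> sphere_flux G x r \<in> \<int>"
    unfolding AE_all_countable
  proof
    fix j :: nat
    let ?a = "1 / real (Suc j)"
    show "AE r in lborel. ?a < r \<and> r < (1 - norm x) - ?a \<longrightarrow> sphere_flux G x r \<in> \<int>"
    proof (cases "?a < (1 - norm x) - ?a")
      case True
      show ?thesis by (rule AEab[OF _ True]) simp_all
    next
      case False
      then show ?thesis by (intro AE_I2) linarith
    qed
  qed
  then show ?thesis
  proof eventually_elim
    case (elim r)
    show ?case
    proof
      assume r: "0 < r \<and> r < 1 - norm x"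
      then have "0 < min r (1 - norm x - r)" by auto
      then obtain j where "inverse (real (Suc j)) < min r (1 - norm x - r)"
        using reals_Archimedean by blast
      then have "1 / real (Suc j) < r \<and> r < (1 - norm x) - 1 / real (Suc j)"
        by (simp add: inverse_eq_divide)
      then show "sphere_flux G x r \<in> \<int>" using elim by blast
    qed
  qed
qed

section \<open>Borel versions on the ball\<close>

lemma B3_iff: "z \<in> B3 \<longleftrightarrow> norm z < 1"
  by (simp add: B3_def)

lemma B3_borel [measurable]: "B3 \<in> sets borel"
  by (simp add: B3_def)

text \<open>A finite measure on all Borel sets of \<open>real^3\<close>, as the compactness theorem
  requires, instead of a measure on the subspace \<open>B3\<close>.\<close>

definition lborel_B3 :: "(real^3) measure" where
  "lborel_B3 = density lborel (\<lambda>z. ennreal (indicator B3 z))"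

lemma sets_lborel_B3: "sets lborel_B3 = sets borel"
  by (simp add: lborel_B3_def)

lemma finite_measure_lborel_B3: "finite_measure lborel_B3"
proof
  have "emeasure lborel_B3 (space lborel_B3) = emeasure lborel B3"
    unfolding lborel_B3_def by (subst emeasure_density) (auto simp: ennreal_indicator)
  then show "emeasure lborel_B3 (space lborel_B3) \<noteq> \<infinity>"
    using emeasure_bounded_finite[OF bounded_ball, of "0::real^3" 1] by (simp add: B3_def less_top)
qed

lemma
  fixes f :: "real^3 \<Rightarrow> real"
  assumes f: "f \<in> borel_measurable borel"
  shows integrable_lborel_B3: "integrable lborel_B3 f \<longleftrightarrow> integrable lborel (\<lambda>z. indicator B3 z * f z)"
    and integral_lborel_B3: "integral\<^sup>L lborel_B3 f = (LBINT z. indicator B3 z * f z)"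
proof -
  have f': "f \<in> borel_measurable lborel" using f by simp
  have b: "(\<lambda>z::real^3. indicator B3 z :: real) \<in> borel_measurable lborel"
    by (intro borel_measurable_indicator) simp
  show "integrable lborel_B3 f \<longleftrightarrow> integrable lborel (\<lambda>z. indicator B3 z * f z)"
    unfolding lborel_B3_def using integrable_density[OF f' b] by simp
  show "integral\<^sup>L lborel_B3 f = (LBINT z. indicator B3 z * f z)"
    unfolding lborel_B3_def using integral_density[OF f' b] by simp
qed

text \<open>Spherical slices are null sets, so composing with the parametrisation of a sphere calls
  for a Borel function. The exceptional set is collected in a Borel null set N, which can be sliced
  in turn; extension by 0 lets integrals run over the whole space.\<close>

lemma ex_borel_version:
  fixes F :: form2
  assumes F: "F \<in> borel_measurable (lebesgue_on B3)"
  shows "\<exists>F' N. F' \<in> borel_measurable borel \<and> N \<in> null_sets lborel \<and> (\<forall>z. z \<notin> B3 \<longrightarrow> F' z = 0) \<and> (\<forall>z\<in>B3 - N. F z = F' z)"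
proof -
  define f where "f z = (if z \<in> B3 then F z else 0)" for z
  have fm: "f \<in> borel_measurable lebesgue"
    unfolding f_def[abs_def] using F by (intro borel_measurable_if_I) auto
  have "\<exists>g. g \<in> borel_measurable borel \<and> (AE z in lborel. f z $ i = g z)" for i
    using completion_ex_borel_measurable_real[OF borel_measurable_vec_nth[OF fm, of i]] by auto
  then have "\<forall>i. \<exists>g. g \<in> borel_measurable borel \<and> (AE z in lborel. f z $ i = g z)" by (rule allI)
  from choice[OF this] obtain g where g: "\<forall>i. g i \<in> borel_measurable borel \<and> (AE z in lborel. f z $ i = g i z)"
    by (rule exE)
  define F' where "F' z = (if z \<in> B3 then (\<chi> i. g i z) else 0)" for z
  have gm: "(\<lambda>z. \<chi> i. g i z) \<in> borel_measurable borel"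
    using g by (intro borel_measurable_vec_lambda) blast
  have F'm: "F' \<in> borel_measurable borel"
    unfolding F'_def[abs_def] using gm by (intro measurable_If_set) auto
  have "AE z in lborel. \<forall>i. f z $ i = g i z"
    using g by (intro AE_finite_all[THEN iffD2, of UNIV, simplified]) auto
  then obtain N where N: "N \<in> null_sets lborel" "{z \<in> space lborel. \<not> (\<forall>i. f z $ i = g i z)} \<subseteq> N"
    unfolding eventually_ae_filter by blast
  have "F z = F' z" if "z \<in> B3 - N" for z
  proof -
    have "\<forall>i. f z $ i = g i z" using N(2) that by auto
    then show ?thesis using that by (simp add: f_def F'_def vec_eq_iff)
  qed
  then show ?thesis
    using F'm N(1) by (intro exI[of _ F'] exI[of _ N]) (auto simp: F'_def)
qed

lemma
  fixes f f' :: "real^3 \<Rightarrow> real"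
  assumes f: "f \<in> borel_measurable (lebesgue_on B3)" and f': "f' \<in> borel_measurable borel"
    and N: "N \<in> null_sets lborel" and eq: "\<And>z. z \<in> B3 - N \<Longrightarrow> f z = f' z"
  shows integrable_borel_version: "integrable (lebesgue_on B3) f \<longleftrightarrow> integrable lborel_B3 f'"
    and integral_borel_version: "integral\<^sup>L (lebesgue_on B3) f = integral\<^sup>L lborel_B3 f'"
proof -
  have B: "B3 \<inter> space lebesgue \<in> sets lebesgue" by simp
  have f'l: "f' \<in> borel_measurable (lebesgue_on B3)"
    using f' by (intro measurable_restrict_space1 measurable_completion) simp
  have AE: "AE z in lebesgue_on B3. f z = f' z"
  proof -
    have "AE z in lborel. z \<in> B3 \<longrightarrow> f z = f' z"
      using AE_not_in[OF N] by eventually_elim (simp add: eq)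
    then show ?thesis
      unfolding AE_restrict_space_iff[OF B] by (rule AE_completion)
  qed
  have m: "(\<lambda>z. indicator B3 z *\<^sub>R f' z) \<in> borel_measurable lborel"
    using f' by (intro borel_measurable_scaleR borel_measurable_indicator) auto
  have "integrable (lebesgue_on B3) f \<longleftrightarrow> integrable (lebesgue_on B3) f'"
    using f f'l AE by (rule integrable_cong_AE)
  then show "integrable (lebesgue_on B3) f \<longleftrightarrow> integrable lborel_B3 f'"
    using integrable_restrict_space[OF B, of f'] integrable_completion[OF m] integrable_lborel_B3[OF f'] by simp
  have "integral\<^sup>L (lebesgue_on B3) f = integral\<^sup>L (lebesgue_on B3) f'"
    using f f'l AE by (rule integral_cong_AE)
  then show "integral\<^sup>L (lebesgue_on B3) f = integral\<^sup>L lborel_B3 f'"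
    using integral_restrict_space[OF B, of f'] integral_completion[OF m] integral_lborel_B3[OF f'] by simp
qed

text \<open>The polar formula for the indicator of N has value 0, so for almost every r the inner
  integral vanishes. The Jacobian is strictly positive on \<open>sph_dom\<close>, hence the slice of
  N is null in the parameters.\<close>

lemma AE_sphere_avoids_null_set:
  assumes N: "N \<in> null_sets (lborel :: (real^3) measure)"
  shows "AE r in lborel. 0 < r \<longrightarrow> (AE w in lborel. w \<in> sph_dom \<longrightarrow> y + r *\<^sub>R sph (fst w) (snd w) \<notin> N)"
proof -
  have Nb [measurable]: "N \<in> sets borel" using N by (auto simp: null_sets_def)
  have Nm: "(\<lambda>z. indicator N z) \<in> borel_measurable borel" by (intro borel_measurable_indicator Nb)
  have z: "(\<integral>\<^sup>+r. (\<integral>\<^sup>+w. ennreal (r\<^sup>2 * sin (fst w)) * indicator N (y + r *\<^sub>R sph (fst w) (snd w)) * indicator sph_dom w \<partial>lborel) * indicator {0<..} r \<partial>lborel) = 0"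
    using nn_integral_polar[OF Nm, of y] N by (simp add: null_sets_def)
  note pm = polar_integrand_borel[OF Nm, of y]
  have "(\<lambda>r. (\<integral>\<^sup>+w. ennreal (r\<^sup>2 * sin (fst w)) * indicator N (y + r *\<^sub>R sph (fst w) (snd w)) * indicator sph_dom w \<partial>lborel) * indicator {0<..} r) \<in> borel_measurable lborel"
    using lborel.borel_measurable_nn_integral_fst[OF pm]
    by (intro borel_measurable_times_ennreal) simp_all
  from nn_integral_0_iff_AE[OF this] z
  have "AE r in lborel. (\<integral>\<^sup>+w. ennreal (r\<^sup>2 * sin (fst w)) * indicator N (y + r *\<^sub>R sph (fst w) (snd w)) * indicator sph_dom w \<partial>lborel) * indicator {0<..} r = 0"
    by simp
  then show ?thesis
  proof eventually_elim
    case (elim r)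
    show ?case
    proof
      assume r: "0 < r"
      then have z: "(\<integral>\<^sup>+w. ennreal (r\<^sup>2 * sin (fst w)) * indicator N (y + r *\<^sub>R sph (fst w) (snd w)) * indicator sph_dom w \<partial>lborel) = 0"
        using elim by simp
      have "(\<lambda>w. ennreal (r\<^sup>2 * sin (fst w)) * indicator N (y + r *\<^sub>R sph (fst w) (snd w)) * indicator sph_dom w) \<in> borel_measurable lborel"
        using measurable_Pair2[OF pm, of r] by simp
      from nn_integral_0_iff_AE[OF this] z
      have "AE w in lborel. ennreal (r\<^sup>2 * sin (fst w)) * indicator N (y + r *\<^sub>R sph (fst w) (snd w)) * indicator sph_dom w = 0"
        by simp
      then show "AE w in lborel. w \<in> sph_dom \<longrightarrow> y + r *\<^sub>R sph (fst w) (snd w) \<notin> N"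
      proof eventually_elim
        case (elim w)
        show ?case
        proof
          assume w: "w \<in> sph_dom"
          then have "0 < sin (fst w)" by (auto simp: sph_dom_def intro!: sin_gt_zero)
          then have "0 < r\<^sup>2 * sin (fst w)" using r by simp
          then show "y + r *\<^sub>R sph (fst w) (snd w) \<notin> N"
            using elim w by (auto split: split_indicator_asm)
        qed
      qed
    qed
  qed
qed

text \<open>F is only Lebesgue measurable, so its pullback to a given sphere could fail to be
  measurable. Integrability of the pullback is part of the premise for this reason; it supplies the
  measurability needed to compare the two integrals.\<close>

lemma AE_sphere_flux_borel_version:
  fixes F F' :: form2
  assumes F': "F' \<in> borel_measurable borel" and N: "N \<in> null_sets lborel"
    and eq: "\<And>z. z \<in> B3 - N \<Longrightarrow> F z = F' z"
  shows "AE r in lborel. 0 < r \<and> r < 1 - norm y \<and> integrable (lebesgue_on sph_dom) (sphere_pullback F y r)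
    \<longrightarrow> sphere_flux F' y r = sphere_flux F y r"
  using AE_sphere_avoids_null_set[OF N, of y]
proof eventually_elim
  case (elim r)
  show ?case
  proof
    assume r: "0 < r \<and> r < 1 - norm y \<and> integrable (lebesgue_on sph_dom) (sphere_pullback F y r)"
    then have avoid: "AE w in lborel. w \<in> sph_dom \<longrightarrow> y + r *\<^sub>R sph (fst w) (snd w) \<notin> N"
      using elim by blast
    have "AE w in lborel. w \<in> sph_dom \<longrightarrow> sphere_pullback F' y r w = sphere_pullback F y r w"
      using avoid
    proof eventually_elim
      case (elim w)
      have "norm (y + r *\<^sub>R sph (fst w) (snd w)) \<le> norm y + r"
        using norm_triangle_ineq[of y "r *\<^sub>R sph (fst w) (snd w)"] r by simp
      then have "y + r *\<^sub>R sph (fst w) (snd w) \<in> B3" using r by (simp add: B3_iff)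
      then show ?case using elim eq by (auto simp: sphere_pullback_def split_beta')
    qed
    then have "AE w in lebesgue. w \<in> sph_dom \<longrightarrow> sphere_pullback F' y r w = sphere_pullback F y r w"
      by (rule AE_completion)
    then have "AE w in lebesgue_on sph_dom. sphere_pullback F' y r w = sphere_pullback F y r w"
      by (subst AE_restrict_space_iff) auto
    moreover have "sphere_pullback F' y r \<in> borel_measurable (lebesgue_on sph_dom)"
      using sphere_pullback_borel[OF F', of y r]
      by (intro measurable_restrict_space1 measurable_completion) simp
    moreover have "sphere_pullback F y r \<in> borel_measurable (lebesgue_on sph_dom)"
      using r by (intro borel_measurable_integrable) simp
    ultimately show "sphere_flux F' y r = sphere_flux F y r"
      unfolding sphere_flux_def by (intro integral_cong_AE)
  qed
qed

lemma infdist_compl_B3: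
  assumes "x \<in> B3"
  shows "infdist x (- B3) = 1 - norm x"
proof (rule antisym)
  define a :: "real^3" where "a = (if x = 0 then axis 1 1 else sgn x)"
  have a: "norm a = 1" by (simp add: a_def norm_sgn)
  have "dist x a = 1 - norm x"
  proof (cases "x = 0")
    case False
    have "x - a = (norm x - 1) *\<^sub>R sgn x"
      using False by (simp add: a_def sgn_div_norm algebra_simps)
    then show ?thesis
      using False assms by (simp add: dist_norm norm_sgn B3_iff)
  qed (simp add: a_def)
  moreover have "a \<in> - B3" using a by (simp add: B3_iff)
  ultimately show "infdist x (- B3) \<le> 1 - norm x" by (metis infdist_le)
  have "1 - norm x \<le> dist x z" if "z \<in> - B3" for z
    using that norm_triangle_ineq2[of z x] by (simp add: B3_iff dist_norm norm_minus_commute)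
  moreover have "- B3 \<noteq> {}" using \<open>a \<in> - B3\<close> by blast
  ultimately show "1 - norm x \<le> infdist x (- B3)"
    unfolding infdist_def by (auto intro: cINF_greatest)
qed

lemma AE_lebesgue_on_radii:
  assumes "x \<in> B3"
  shows "(AE r in lebesgue_on {0<..<infdist x (- B3)}. P r) \<longleftrightarrow> (AE r in lborel. 0 < r \<and> r < 1 - norm x \<longrightarrow> P r)"
  unfolding infdist_compl_B3[OF assms]
  by (subst AE_restrict_space_iff) (auto simp: AE_completion_iff)

theorem theorem2p8:
  fixes p C :: real and Fs :: "nat \<Rightarrow> form2"
  assumes "p > 1"
    and "\<And>n. Fs n \<in> FpZ p"
    and "\<And>n. Lp_norm p (Fs n) \<le> C"
  shows "\<exists>r F. strict_mono r \<and> F \<in> FpZ p \<and> weak_Lp_conv p (Fs \<circ> r) F"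
proof -
  interpret M: finite_measure lborel_B3 by (rule finite_measure_lborel_B3)
  have p: "1 < p" by fact
  have Fsm: "Fs n \<in> borel_measurable (lebesgue_on B3)"
    and Fsp: "integrable (lebesgue_on B3) (\<lambda>x. norm (Fs n x) powr p)"
    and Fsf: "\<And>x. x \<in> B3 \<Longrightarrow> AE r in lebesgue_on {0<..<infdist x (- B3)}.
        integrable (lebesgue_on sph_dom) (sphere_pullback (Fs n) x r) \<and> sphere_flux (Fs n) x r \<in> \<int>" for n
    using assms(2)[of n] by (simp_all add: FpZ_def)
  have "\<forall>n. \<exists>F'. F' \<in> borel_measurable borel \<and> (\<forall>z. z \<notin> B3 \<longrightarrow> F' z = 0) \<and> (\<exists>N. N \<in> null_sets lborel \<and> (\<forall>z\<in>B3 - N. Fs n z = F' z))"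
    using ex_borel_version[OF Fsm] by blast
  from choice[OF this] obtain F where F: "\<forall>n. F n \<in> borel_measurable borel \<and> (\<forall>z. z \<notin> B3 \<longrightarrow> F n z = 0) \<and> (\<exists>N. N \<in> null_sets lborel \<and> (\<forall>z\<in>B3 - N. Fs n z = F n z))"
    by (rule exE)
  have Fm: "F n \<in> borel_measurable borel" and F0: "\<And>z. z \<notin> B3 \<Longrightarrow> F n z = 0" for n
    using spec[OF F, of n] by blast+
  have "\<forall>n. \<exists>N. N \<in> null_sets lborel \<and> (\<forall>z\<in>B3 - N. Fs n z = F n z)" using F by blast
  from choice[OF this] obtain N where N: "\<forall>n. N n \<in> null_sets lborel \<and> (\<forall>z\<in>B3 - N n. Fs n z = F n z)"
    by (rule exE)
  have N0: "N n \<in> null_sets lborel" and FsF: "\<And>z. z \<in> B3 - N n \<Longrightarrow> Fs n z = F n z" for n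
    using spec[OF N, of n] by blast+
  have Fpm: "(\<lambda>z. norm (F n z) powr p) \<in> borel_measurable borel" for n
    using Fm[of n] by measurable
  have Fspm: "(\<lambda>x. norm (Fs n x) powr p) \<in> borel_measurable (lebesgue_on B3)" for n
    using Fsp by (rule borel_measurable_integrable)
  have Fpi: "integrable lborel_B3 (\<lambda>z. norm (F n z) powr p)" for n
    using Fsp[of n] by (subst integrable_borel_version[OF Fspm Fpm N0[of n], symmetric]) (simp_all only: FsF)
  \<comment> \<open>As a bound for a norm C is nonnegative; writing \<open>\<bar>C\<bar>\<close>
    avoids arguing this separately.\<close>
  have FpC: "(LINT z|lborel_B3. norm (F n z) powr p) \<le> \<bar>C\<bar> powr p" for n
  proof -
    let ?I = "LINT z|lborel_B3. norm (F n z) powr p"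
    have I0: "0 \<le> ?I" by (rule Bochner_Integration.integral_nonneg) simp
    have "(\<integral>x. norm (Fs n x) powr p \<partial>lebesgue_on B3) = ?I"
      by (rule integral_borel_version[OF Fspm Fpm N0[of n]]) (simp only: FsF)
    then have "?I powr (1 / p) \<le> \<bar>C\<bar>"
      using assms(3)[of n] by (simp add: Lp_norm_def)
    then have "(?I powr (1 / p)) powr p \<le> \<bar>C\<bar> powr p"
      using p by (intro powr_mono2) auto
    then show ?thesis using p I0 by (simp add: powr_powr)
  qed
  have FpM: "(\<integral>\<^sup>+z. ennreal (norm (F n z) powr p) \<partial>lborel_B3) \<le> ennreal (\<bar>C\<bar> powr p)" for n
    using FpC[of n] by (subst nn_integral_eq_integral[OF Fpi]) (auto intro: ennreal_leI)
  have Fp: "(\<integral>\<^sup>+z. ennreal (norm (F n z) powr p) \<partial>lborel) \<le> ennreal (\<bar>C\<bar> powr p)" for n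
  proof -
    have "(\<integral>\<^sup>+z. ennreal (norm (F n z) powr p) \<partial>lborel_B3) = (\<integral>\<^sup>+z. ennreal (indicator B3 z) * ennreal (norm (F n z) powr p) \<partial>lborel)"
      unfolding lborel_B3_def by (rule nn_integral_density) (use Fpm in \<open>auto intro!: borel_measurable_indicator\<close>)
    also have "\<dots> = (\<integral>\<^sup>+z. ennreal (norm (F n z) powr p) \<partial>lborel)"
      by (rule nn_integral_cong) (auto simp: F0 split: split_indicator)
    finally show ?thesis using FpM[of n] by simp
  qed
  obtain r G0 where r: "strict_mono r" and G0: "G0 \<in> borel_measurable borel" "integrable lborel_B3 (\<lambda>x. norm (G0 x) powr p)"
    and conv: "\<And>g. g \<in> borel_measurable borel \<Longrightarrow> integrable lborel_B3 (\<lambda>x. norm (g x) powr (p / (p - 1))) \<Longrightarrow>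
      (\<lambda>n. LINT x|lborel_B3. F (r n) x \<bullet> g x) \<longlonglongrightarrow> (LINT x|lborel_B3. G0 x \<bullet> g x)"
    using weakly_convergent_subsequence[where F=F, OF finite_measure_lborel_B3 sets_lborel_B3 p _ Fm FpM] by auto
  \<comment> \<open>The measure \<open>lborel_B3\<close> does not see the values of
    \<open>G0\<close> outside the ball; they are set to 0 so that G can be integrated over the whole
    space and sliced by spheres.\<close>
  define G where "G z = (if z \<in> B3 then G0 z else 0)" for z
  have Gm: "G \<in> borel_measurable borel"
    unfolding G_def[abs_def] using G0(1) by (intro measurable_If_set) auto
  have G0out: "G z = 0" if "z \<notin> B3" for z using that by (simp add: G_def)
  have pair: "(LINT z|lborel_B3. H z \<bullet> g z) = (LBINT z. H' z \<bullet> g z)"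
    if "H \<in> borel_measurable borel" "g \<in> borel_measurable borel" "\<And>z. z \<notin> B3 \<Longrightarrow> H' z = 0" "\<And>z. z \<in> B3 \<Longrightarrow> H' z = H z" for H H' g :: form2
  proof -
    have "(\<lambda>z. H z \<bullet> g z) \<in> borel_measurable borel" using that by simp
    then have "(LINT z|lborel_B3. H z \<bullet> g z) = (LBINT z. indicator B3 z * (H z \<bullet> g z))"
      by (rule integral_lborel_B3)
    also have "\<dots> = (LBINT z. H' z \<bullet> g z)"
      by (rule Bochner_Integration.integral_cong) (auto simp: that split: split_indicator)
    finally show ?thesis .
  qed
  have GM: "(LINT z|lborel_B3. G0 z \<bullet> g z) = (LINT z|lborel_B3. G z \<bullet> g z)" if "g \<in> borel_measurable borel" for g
    using pair[OF G0(1) that G0out] pair[OF Gm that G0out] by (simp add: G_def)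
  have Gp: "integrable lborel_B3 (\<lambda>z. norm (G z) powr p)"
  proof -
    have "(\<lambda>z. indicator B3 z * norm (G z) powr p) = (\<lambda>z. indicator B3 z * norm (G0 z) powr p)"
      by (auto simp: G_def split: split_indicator)
    then show ?thesis
      using G0 Gm by (simp add: integrable_lborel_B3)
  qed
  have Gpn: "(\<integral>\<^sup>+z. ennreal (norm (G z) powr p) \<partial>lborel) < \<infinity>"
  proof -
    have "integrable lborel (\<lambda>z. indicator B3 z * norm (G z) powr p)"
      using Gp Gm by (simp add: integrable_lborel_B3)
    also have "(\<lambda>z. indicator B3 z * norm (G z) powr p) = (\<lambda>z. norm (G z) powr p)"
      using G0out by (auto split: split_indicator)
    finally show ?thesis by (simp add: integrable_iff_bounded)
  qed
  then obtain K where K: "0 \<le> K" "(\<integral>\<^sup>+z. ennreal (norm (G z) powr p) \<partial>lborel) \<le> ennreal K"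
    by (cases "\<integral>\<^sup>+z. ennreal (norm (G z) powr p) \<partial>lborel") auto
  have Gi: "integrable lborel G"
    by (rule integrable_of_powr_integrable_on_ball(1)[OF Gm p _ K(2,1)]) (simp add: G0out B3_iff)
  have flux: "AE s in lborel. 0 < s \<and> s < 1 - norm x \<longrightarrow> sphere_flux G x s \<in> \<int>" if x: "norm x < 1" for x
  proof (rule limit_flux_integer[where F="\<lambda>n. F (r n)", OF p Fm Gm _ _ Fp _ Gi _ _ x])
    fix n y assume y: "norm (y :: real^3) < 1"
    then have yB: "y \<in> B3" by (simp add: B3_iff)
    have "AE s in lborel. 0 < s \<and> s < 1 - norm y \<longrightarrow>
        integrable (lebesgue_on sph_dom) (sphere_pullback (Fs (r n)) y s) \<and> sphere_flux (Fs (r n)) y s \<in> \<int>"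
      using Fsf[OF yB, of "r n"] unfolding AE_lebesgue_on_radii[OF yB] .
    moreover have "AE s in lborel. 0 < s \<and> s < 1 - norm y \<and> integrable (lebesgue_on sph_dom) (sphere_pullback (Fs (r n)) y s)
        \<longrightarrow> sphere_flux (F (r n)) y s = sphere_flux (Fs (r n)) y s"
      by (rule AE_sphere_flux_borel_version[OF Fm N0 FsF])
    ultimately show "AE s in lborel. 0 < s \<and> s < 1 - norm y \<longrightarrow> sphere_flux (F (r n)) y s \<in> \<int>"
      by eventually_elim auto
  next
    fix g :: form2 and B :: real
    assume g: "g \<in> borel_measurable borel" "\<And>z. norm (g z) \<le> B"
    \<comment> \<open>On a finite measure every bounded field has an integrable power p / (p - 1),
      so weak L^p convergence covers bounded tests.\<close>
    have "integrable lborel_B3 (\<lambda>x. norm (g x) powr (p / (p - 1)))"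
    proof (rule M.integrable_const_bound)
      show "AE x in lborel_B3. norm (norm (g x) powr (p / (p - 1))) \<le> B powr (p / (p - 1))"
        using g(2) p by (auto intro!: powr_mono2)
      show "(\<lambda>x. norm (g x) powr (p / (p - 1))) \<in> borel_measurable lborel_B3"
        using g(1) by (simp add: measurable_cong_sets[OF sets_lborel_B3])
    qed
    note lim = conv[OF g(1) this]
    have F_pair: "(LINT z|lborel_B3. F m z \<bullet> g z) = (LBINT z. F m z \<bullet> g z)" for m
      by (rule pair[OF Fm g(1)]) (simp_all add: F0)
    have G_pair: "(LINT z|lborel_B3. G z \<bullet> g z) = (LBINT z. G z \<bullet> g z)"
      by (rule pair[OF Gm g(1)]) (simp_all add: G0out)
    show "(\<lambda>n. LBINT z. F (r n) z \<bullet> g z) \<longlonglongrightarrow> (LBINT z. G z \<bullet> g z)"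
      using lim unfolding GM[OF g(1)] F_pair G_pair .
  qed (simp_all add: F0 G0out B3_iff)
  have "G \<in> FpZ p"
  proof -
    have Gl: "G \<in> borel_measurable (lebesgue_on B3)"
      using Gm by (intro measurable_restrict_space1 measurable_completion) simp
    have "(\<lambda>z. norm (G z) powr p) \<in> borel_measurable borel" using Gm by measurable
    moreover from this have "(\<lambda>z. norm (G z) powr p) \<in> borel_measurable (lebesgue_on B3)"
      by (intro measurable_restrict_space1 measurable_completion) simp
    ultimately have "integrable (lebesgue_on B3) (\<lambda>z. norm (G z) powr p)"
      using Gp by (subst integrable_borel_version[where N="{}"]) auto
    moreover have "AE s in lebesgue_on {0<..<infdist x (- B3)}.
        integrable (lebesgue_on sph_dom) (sphere_pullback G x s) \<and> sphere_flux G x s \<in> \<int>" if x: "x \<in> B3" for x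
    proof -
      have "AE s in lborel. 0 < s \<and> s < 1 - norm x \<longrightarrow> sphere_flux G x s \<in> \<int>"
        using x by (intro flux) (simp add: B3_iff)
      \<comment> \<open>For the limit, integrability of the pullback on almost every sphere does not
        come from the sequence; it follows from slicing, since G is Borel and integrable.\<close>
      with AE_integrable_sphere_pullback[OF Gi Gm, of x]
      have "AE s in lborel. 0 < s \<and> s < 1 - norm x \<longrightarrow> integrable (lebesgue_on sph_dom) (sphere_pullback G x s) \<and> sphere_flux G x s \<in> \<int>"
        by eventually_elim auto
      then show ?thesis by (simp only: AE_lebesgue_on_radii[OF x])
    qed
    ultimately show ?thesis using Gl by (simp add: FpZ_def)
  qed
  moreover have "weak_Lp_conv p (Fs \<circ> r) G"
    unfolding weak_Lp_conv_def
  proof (intro allI impI, elim conjE)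
    fix g :: form2
    assume g: "g \<in> borel_measurable (lebesgue_on B3)" "integrable (lebesgue_on B3) (\<lambda>x. norm (g x) powr (p / (p - 1)))"
    obtain g' N' where g': "g' \<in> borel_measurable borel" "N' \<in> null_sets lborel" "\<And>z. z \<in> B3 - N' \<Longrightarrow> g z = g' z"
      using ex_borel_version[OF g(1)] by blast
    have g'q: "(\<lambda>x. norm (g' x) powr (p / (p - 1))) \<in> borel_measurable borel"
      using g'(1) by measurable
    have "integrable lborel_B3 (\<lambda>x. norm (g' x) powr (p / (p - 1)))"
      using g(2) by (subst integrable_borel_version[OF borel_measurable_integrable[OF g(2)] g'q g'(2), symmetric]) (simp_all only: g'(3))
    from conv[OF g'(1) this]
    have lim: "(\<lambda>n. LINT x|lborel_B3. F (r n) x \<bullet> g' x) \<longlonglongrightarrow> (LINT x|lborel_B3. G x \<bullet> g' x)"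
      unfolding GM[OF g'(1)] .
    have Feq: "(\<integral>x. Fs m x \<bullet> g x \<partial>lebesgue_on B3) = (LINT x|lborel_B3. F m x \<bullet> g' x)" for m
    proof (rule integral_borel_version[where N="N m \<union> N'"])
      show "N m \<union> N' \<in> null_sets lborel" using N0 g'(2) by (rule null_sets.Un)
      show "(\<lambda>x. Fs m x \<bullet> g x) \<in> borel_measurable (lebesgue_on B3)" using Fsm g(1) by (rule borel_measurable_inner)
      show "(\<lambda>x. F m x \<bullet> g' x) \<in> borel_measurable borel" using Fm g'(1) by (rule borel_measurable_inner)
      show "Fs m z \<bullet> g z = F m z \<bullet> g' z" if "z \<in> B3 - (N m \<union> N')" for z
        using that FsF[of z m] g'(3)[of z] by auto
    qed
    have Geq: "(\<integral>x. G x \<bullet> g x \<partial>lebesgue_on B3) = (LINT x|lborel_B3. G x \<bullet> g' x)"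
    proof (rule integral_borel_version[where N="N'"])
      have "G \<in> borel_measurable (lebesgue_on B3)"
        using Gm by (intro measurable_restrict_space1 measurable_completion) simp
      then show "(\<lambda>x. G x \<bullet> g x) \<in> borel_measurable (lebesgue_on B3)" using g(1) by (rule borel_measurable_inner)
      show "(\<lambda>x. G x \<bullet> g' x) \<in> borel_measurable borel" using Gm g'(1) by (rule borel_measurable_inner)
      show "G z \<bullet> g z = G z \<bullet> g' z" if "z \<in> B3 - N'" for z
        using that g'(3)[of z] by auto
    qed (rule g'(2))
    show "(\<lambda>n. \<integral>x. (Fs \<circ> r) n x \<bullet> g x \<partial>lebesgue_on B3) \<longlonglongrightarrow> (\<integral>x. G x \<bullet> g x \<partial>lebesgue_on B3)"
      unfolding o_def Feq Geq by (rule lim)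
  qed
  ultimately show ?thesis using r by blast
qed

end
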